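(* Let $p=(p_0,p_1,\ldots)$ be an offspring distribution with mean $\mu\in(0,1]$ and $p_1\ne1$, let $\tau$ be a Galton-Watson tree with offspring distribution $p$, and $\tau^*$ the immortal tree associated with $p$. (1) Let $p$ be critical ($\mu=1$) and let $\mathcal{A}\subset\mathbb{Z}_+$ with $\sum_{k\in\mathcal{A}}p_k>0$. Then as $n\to\infty$ along the infinite sub-sequence $\{n\in\mathbb{N}:\mathbf{P}(L_{\mathcal{A}}(\tau)=n)>0\}$, $$\mathrm{dist}(\tau\mid L_{\mathcal{A}}(\tau)=n)\to\mathrm{dist}(\tau^* ).$$ (2) Let $p$ be critical, with $\{n\in\mathbb{N}:p_n>0\}$ infinite. Then as $n\to\infty$ along the sub-sequence $\{n\in\mathbb{N}:p_n>0\}$, $$\mathrm{dist}(\tau\mid M(\tau)=n)\to\mathrm{dist}(\tau^* ).$$ (3) Let $p$ be critical with bounded support. Then as $n\to\infty$ along the infinite sub-sequence $\{n\in\mathbb{N}:\mathbf{P}(W(\tau)=n)>0\}$, $$\mathrm{dist}(\tau\mid W(\tau)=n)\to\mathrm{dist}(\tau^* ).$$ (4) Let $p$ be critical or subcritical ($0<\mu\le 1$). Then as $n\to\infty$, $$\mathrm{dist}(\tau\mid H(\tau)=n)\to\mathrm{dist}(\tau^* ).$$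
   Context: $\mathbb{Z}_+=\{0,1,2,\ldots\}$, $\mathbb{N}=\{1,2,\ldots\}$. Trees are rooted ordered trees in Neveu's formalism: a tree $\mathbf{t}$ is a set of finite sequences of positive integers containing the empty sequence $\emptyset$ (the root), closed under taking prefixes, such that for each $u\in\mathbf{t}$ there is $k_u(\mathbf{t})\in\mathbb{Z}_+$ (the out-degree) with $ui\in\mathbf{t}$ iff $1\le i\le k_u(\mathbf{t})$. $|u|$ is the length (height) of $u$; $Y_b(\mathbf{t})$ is the number of nodes of $\mathbf{t}$ at height $b$. Functionals: $L_{\mathcal{A}}(\mathbf{t})$ is the number of nodes $u\in\mathbf{t}$ with $k_u(\mathbf{t})\in\mathcal{A}$; $M(\mathbf{t})=\sup\{k_u(\mathbf{t}):u\in\mathbf{t}\}$ (maximal out-degree); $W(\mathbf{t})=\sup_{b\in\mathbb{Z}_+}Y_b(\mathbf{t})$ (width); $H(\mathbf{t})=\sup\{|u|:u\in\mathbf{t}\}$ (height). $\mathbb{T}$ is the set of trees, $\mathbb{T}^{(h)}=\{\mathbf{t}:H(\mathbf{t})\le h\}$, $r_h(\mathbf{t})=\{u\in\mathbf{t}:|u|\le h\}$. Convergence in distribution of $\mathbb{T}$-valued random variables is with respect to the distance $d(\mathbf{t},\mathbf{t}')=2^{-\sup\{h\in\mathbb{Z}_+:r_h(\mathbf{t})=r_h(\mathbf{t}')\}}$; equivalently, $T_n\to T$ in distribution iff $\mathbf{P}[r_h(T_n)=\mathbf{t}]\to\mathbf{P}[r_h(T)=\mathbf{t}]$ for all $h\in\mathbb{N}$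 and $\mathbf{t}\in\mathbb{T}^{(h)}$. A Galton-Watson tree $\tau$ with offspring distribution $p$ is a random tree in which the out-degree of the root has law $p$ and, conditionally on it being $n$, the $n$ subtrees rooted at the children of the root are independent and distributed as $\tau$. The immortal tree $\tau^*$ of $p$: nodes are normal or special; the root is special; normal nodes have offspring distribution $p$, special nodes have the size-biased offspring distribution $\hat p_k=kp_k/\mu$; the offspring numbers of all nodes are independent; all children of a normal node are normal; among the children of a special node one chosen uniformly at random is special and the others are normal. *)

theory Defs
  imports "HOL-Probability.Probability" "HOL-Library.Sublist" "HOL-Library.Extended_Nat"
begin

definition is_neveu_tree :: "nat list set \<Rightarrow> bool" where
  "is_neveu_tree t \<longleftrightarrow>
     [] \<in> t \<and>
     (\<forall>u\<in>t. \<forall>i\<in>set u. 1 \<le> i) \<and>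
     (\<forall>u\<in>t. \<forall>v. prefix v u \<longrightarrow> v \<in> t) \<and>
     (\<forall>u\<in>t. \<exists>k::nat. \<forall>i. u @ [i] \<in> t \<longleftrightarrow> 1 \<le> i \<and> i \<le> k)"

typedef neveu_tree = "{t. is_neveu_tree t}"
  morphisms tree_nodes Abs_neveu_tree
proof
  show "{[]} \<in> {t. is_neveu_tree t}"
    by (auto simp: is_neveu_tree_def intro!: exI[of _ 0])
qed

setup_lifting type_definition_neveu_tree

definition out_degree :: "neveu_tree \<Rightarrow> nat list \<Rightarrow> nat" where
  "out_degree t u = (THE k. \<forall>i. u @ [i] \<in> tree_nodes t \<longleftrightarrow> 1 \<le> i \<and> i \<le> k)"

lemma out_degree_iff:
  assumes "u \<in> tree_nodes t"
  shows "u @ [i] \<in> tree_nodes t \<longleftrightarrow> 1 \<le> i \<and> i \<le> out_degree t u"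
proof -
  have "is_neveu_tree (tree_nodes t)"
    using tree_nodes[of t] by simp
  then obtain k where k: "\<forall>i. u @ [i] \<in> tree_nodes t \<longleftrightarrow> 1 \<le> i \<and> i \<le> k"
    using assms unfolding is_neveu_tree_def by blast
  have "k' = k" if "\<forall>i. u @ [i] \<in> tree_nodes t \<longleftrightarrow> 1 \<le> i \<and> i \<le> k'" for k'
  proof (rule antisym)
    show "k' \<le> k" using k that by (cases "k' = 0") (auto simp: Suc_le_eq)
    show "k \<le> k'" using k that by (cases "k = 0") (auto simp: Suc_le_eq)
  qed
  then have "out_degree t u = k"
    unfolding out_degree_def using k by (intro the_equality) auto
  then show ?thesis using k by simp
qed

lift_definition tree_trunc :: "nat \<Rightarrow> neveu_tree \<Rightarrow> neveu_tree"
  is "\<lambda>h t. {u \<in> t. length u \<le> h}"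
proof -
  fix h :: nat and t :: "nat list set"
  assume t: "is_neveu_tree t"
  have "\<exists>k. \<forall>i. (u @ [i] \<in> t \<and> length (u @ [i]) \<le> h) \<longleftrightarrow> 1 \<le> i \<and> i \<le> k"
    if "u \<in> t" for u
  proof (cases "length u < h")
    case True
    then show ?thesis using t that unfolding is_neveu_tree_def by auto
  next
    case False
    then show ?thesis by (intro exI[of _ 0]) auto
  qed
  then show "is_neveu_tree {u \<in> t. length u \<le> h}"
    using t unfolding is_neveu_tree_def by (auto dest: prefix_length_le)
qed

text \<open>
  The subtree above the child \<open>i\<close> of the root, read from \<open>i\<close>.  If \<open>i\<close> is not a
  child of the root, it is by convention the tree consisting of the root only.
\<close>

lift_definition child_subtree :: "nat \<Rightarrow> neveu_tree \<Rightarrow> neveu_tree"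
  is "\<lambda>i t. if [i] \<in> t then {u. i # u \<in> t} else {[]}"
proof -
  fix i :: nat and t :: "nat list set"
  assume t: "is_neveu_tree t"
  have "is_neveu_tree {u. i # u \<in> t}" if "[i] \<in> t"
    unfolding is_neveu_tree_def
  proof (intro conjI ballI allI impI)
    show "[] \<in> {u. i # u \<in> t}" using that by simp
  next
    fix u j assume "u \<in> {u. i # u \<in> t}" "j \<in> set u"
    then show "1 \<le> j" using t unfolding is_neveu_tree_def by auto
  next
    fix u v assume u: "u \<in> {u. i # u \<in> t}" "prefix v u"
    then have "prefix (i # v) (i # u)" by simp
    then show "v \<in> {u. i # u \<in> t}" using t u unfolding is_neveu_tree_def by blast
  next
    fix u assume "u \<in> {u. i # u \<in> t}"
    then show "\<exists>k. \<forall>j. u @ [j] \<in> {u. i # u \<in> t} \<longleftrightarrow> 1 \<le> j \<and> j \<le> k"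
      using t unfolding is_neveu_tree_def by (metis append_Cons mem_Collect_eq)
  qed
  moreover have "is_neveu_tree {[]}"
    by (auto simp: is_neveu_tree_def intro!: exI[of _ 0])
  ultimately show "is_neveu_tree (if [i] \<in> t then {u. i # u \<in> t} else {[]})"
    by simp
qed

text \<open>
  The tree in which every node \<open>u\<close> has out-degree \<open>d u\<close>; the values of \<open>d\<close> at
  sequences outside the tree are irrelevant.
\<close>

lift_definition tree_of_degrees :: "(nat list \<Rightarrow> nat) \<Rightarrow> neveu_tree"
  is "\<lambda>d. {u. \<forall>j<length u. 1 \<le> u ! j \<and> u ! j \<le> d (take j u)}"
proof -
  fix d :: "nat list \<Rightarrow> nat"
  let ?t = "{u. \<forall>j<length u. 1 \<le> u ! j \<and> u ! j \<le> d (take j u)}"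
  show "is_neveu_tree ?t"
    unfolding is_neveu_tree_def
  proof (intro conjI ballI allI impI)
    show "[] \<in> ?t" by simp
  next
    fix u i assume "u \<in> ?t" "i \<in> set u"
    then show "1 \<le> i" by (auto simp: in_set_conv_nth)
  next
    fix u v assume u: "u \<in> ?t" and "prefix v u"
    then obtain w where w: "u = v @ w" by (auto simp: prefix_def)
    show "v \<in> ?t"
    proof (intro CollectI allI impI)
      fix j assume j: "j < length v"
      then have "j < length u" using w by simp
      then have "1 \<le> u ! j \<and> u ! j \<le> d (take j u)" using u by blast
      moreover have "take j u = take j v" "u ! j = v ! j"
        using j w by (simp_all add: nth_append)
      ultimately show "1 \<le> v ! j \<and> v ! j \<le> d (take j v)" by simp
    qed
  next
    fix u assume u: "u \<in> ?t"
    have "u @ [i] \<in> ?t \<longleftrightarrow> 1 \<le> i \<and> i \<le> d u" for i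
    proof
      assume "u @ [i] \<in> ?t"
      then show "1 \<le> i \<and> i \<le> d u"
        by (auto dest: spec[of _ "length u"])
    next
      assume "1 \<le> i \<and> i \<le> d u"
      then show "u @ [i] \<in> ?t"
        using u by (auto simp: nth_append less_Suc_eq)
    qed
    then show "\<exists>k. \<forall>i. u @ [i] \<in> ?t \<longleftrightarrow> 1 \<le> i \<and> i \<le> k" by blast
  qed
qed

lemma tree_trunc_mono:
  assumes "tree_trunc h t = tree_trunc h t'" "h' \<le> h"
  shows "tree_trunc h' t = tree_trunc h' t'"
proof -
  have *: "tree_trunc h' s = tree_trunc h' (tree_trunc h s)" for s
    using assms(2) by transfer auto
  show ?thesis using *[of t] *[of t'] assms(1) by simp
qed

lemma tree_trunc_0 [simp]: "tree_trunc 0 t = tree_trunc 0 t'"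
  by transfer (auto simp: is_neveu_tree_def)

lemma tree_trunc_all_eq:
  assumes "\<And>h. tree_trunc h t = tree_trunc h t'"
  shows "t = t'"
  using assms by transfer (auto simp: set_eq_iff)

lemma tree_trunc_eq_iff_le_Sup:
  assumes "t \<noteq> t'"
  shows "tree_trunc h t = tree_trunc h t' \<longleftrightarrow> h \<le> Sup {h. tree_trunc h t = tree_trunc h t'}"
proof -
  let ?S = "{h. tree_trunc h t = tree_trunc h t'}"
  obtain h0 where h0: "tree_trunc h0 t \<noteq> tree_trunc h0 t'"
    using assms tree_trunc_all_eq by blast
  have "?S \<subseteq> {..h0}"
    using h0 tree_trunc_mono[of _ t t' h0] by (force simp: not_le)
  then have fin: "finite ?S" by (rule finite_subset) simp
  have ne: "?S \<noteq> {}" using tree_trunc_0 by blast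
  have sup: "Sup ?S = Max ?S" using fin ne by (simp add: cSup_eq_Max)
  show ?thesis
  proof
    assume "tree_trunc h t = tree_trunc h t'"
    then show "h \<le> Sup ?S" unfolding sup using fin by (intro Max_ge) auto
  next
    assume "h \<le> Sup ?S"
    moreover have "Max ?S \<in> ?S" using fin ne by (rule Max_in)
    ultimately show "tree_trunc h t = tree_trunc h t'"
      unfolding sup using tree_trunc_mono by blast
  qed
qed

instantiation neveu_tree :: metric_space
begin

text \<open>The first case is the convention \<open>sup = \<infinity>\<close>, \<open>2 powr (- \<infinity>) = 0\<close>.\<close>

definition dist_neveu_tree :: "neveu_tree \<Rightarrow> neveu_tree \<Rightarrow> real" where
  "dist_neveu_tree t t' =
     (if t = t' then 0
      else 2 powr (- real (Sup {h. tree_trunc h t = tree_trunc h t'})))"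

definition uniformity_neveu_tree :: "(neveu_tree \<times> neveu_tree) filter" where
  "uniformity_neveu_tree = (INF e\<in>{0 <..}. principal {(x, y). dist x y < e})"

definition open_neveu_tree :: "neveu_tree set \<Rightarrow> bool" where
  "open_neveu_tree U \<longleftrightarrow> (\<forall>x\<in>U. \<forall>\<^sub>F (x', y) in uniformity. x' = x \<longrightarrow> y \<in> U)"

instance
proof
  fix x y :: neveu_tree
  show "dist x y = 0 \<longleftrightarrow> x = y" by (simp add: dist_neveu_tree_def)
next
  fix x y z :: neveu_tree
  let ?s = "\<lambda>x y. Sup {h. tree_trunc h x = tree_trunc h y}"
  have comm: "?s y z = ?s z y"
    by (rule arg_cong[where f = Sup]) auto
  show "dist x y \<le> dist x z + dist y z"
  proof (cases "x = y \<or> x = z \<or> y = z")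
    case True
    then show ?thesis using comm by (auto simp: dist_neveu_tree_def)
  next
    case False
    then have ne: "x \<noteq> y" "x \<noteq> z" "y \<noteq> z" by auto
    let ?m = "min (?s x z) (?s y z)"
    have "tree_trunc ?m x = tree_trunc ?m z" "tree_trunc ?m y = tree_trunc ?m z"
      using tree_trunc_eq_iff_le_Sup[OF ne(2), of ?m] tree_trunc_eq_iff_le_Sup[OF ne(3), of ?m]
      by auto
    then have "?m \<le> ?s x y"
      using tree_trunc_eq_iff_le_Sup[OF ne(1), of ?m] by simp
    then have "(2::real) powr (- real (?s x y)) \<le> 2 powr (- real ?m)"
      by simp
    also have "\<dots> \<le> 2 powr (- real (?s x z)) + 2 powr (- real (?s y z))"
      by (simp add: min_def)
    finally show ?thesis using ne by (simp add: dist_neveu_tree_def)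
  qed
qed (simp_all add: uniformity_neveu_tree_def open_neveu_tree_def)

end

definition set_ecard :: "'a set \<Rightarrow> enat" where
  "set_ecard X = (if finite X then enat (card X) else \<infinity>)"

definition tree_L :: "nat set \<Rightarrow> neveu_tree \<Rightarrow> enat" where
  "tree_L A t = set_ecard {u \<in> tree_nodes t. out_degree t u \<in> A}"

definition tree_M :: "neveu_tree \<Rightarrow> enat" where
  "tree_M t = (SUP u\<in>tree_nodes t. enat (out_degree t u))"

definition tree_Y :: "nat \<Rightarrow> neveu_tree \<Rightarrow> enat" where
  "tree_Y b t = set_ecard {u \<in> tree_nodes t. length u = b}"

definition tree_W :: "neveu_tree \<Rightarrow> enat" where
  "tree_W t = (SUP b. tree_Y b t)"

definition tree_H :: "neveu_tree \<Rightarrow> enat" where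
  "tree_H t = (SUP u\<in>tree_nodes t. enat (length u))"

text \<open>
  If the mean is infinite, the Bochner integral below is \<open>0\<close>; all statements
  using it assume that it is positive.
\<close>

definition offspring_mean :: "nat pmf \<Rightarrow> real" where
  "offspring_mean p = measure_pmf.expectation p real"

definition galton_watson_tree ::
    "nat pmf \<Rightarrow> 'a measure \<Rightarrow> ('a \<Rightarrow> neveu_tree) \<Rightarrow> bool" where
  "galton_watson_tree p \<Omega> \<tau> \<longleftrightarrow>
     prob_space \<Omega> \<and> \<tau> \<in> borel_measurable \<Omega> \<and>
     distr \<Omega> (count_space UNIV) (\<lambda>\<omega>. out_degree (\<tau> \<omega>) []) = measure_pmf p \<and>
     (\<forall>n. pmf p n > 0 \<longrightarrow>
        (let \<Omega>n = uniform_measure \<Omega> {\<omega>\<in>space \<Omega>. out_degree (\<tau> \<omega>) [] = n} in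
           prob_space.indep_vars \<Omega>n (\<lambda>_. borel) (\<lambda>i \<omega>. child_subtree i (\<tau> \<omega>)) {1..n} \<and>
           (\<forall>i\<in>{1..n}. distr \<Omega>n borel (\<lambda>\<omega>. child_subtree i (\<tau> \<omega>)) = distr \<Omega> borel \<tau>)))"

definition size_biased :: "nat pmf \<Rightarrow> nat pmf" where
  "size_biased p = embed_pmf (\<lambda>k. real k * pmf p k / offspring_mean p)"

lemma pmf_size_biased:
  assumes "offspring_mean p > 0"
  shows "pmf (size_biased p) k = real k * pmf p k / offspring_mean p"
  unfolding size_biased_def
proof (rule pmf_embed_pmf)
  show "0 \<le> real x * pmf p x / offspring_mean p" for x
    using assms by simp
  have int: "integrable (measure_pmf p) real"
    using assms not_integrable_integral_eq[of "measure_pmf p" real]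
    unfolding offspring_mean_def by auto
  have "(\<integral>\<^sup>+x. ennreal (real x * pmf p x / offspring_mean p) \<partial>count_space UNIV)
      = (\<integral>\<^sup>+x. ennreal (pmf p x) * ennreal (real x / offspring_mean p) \<partial>count_space UNIV)"
    using assms by (intro nn_integral_cong) (simp flip: ennreal_mult add: field_simps)
  also have "\<dots> = (\<integral>\<^sup>+x. ennreal (real x / offspring_mean p) \<partial>measure_pmf p)"
    by (simp add: nn_integral_measure_pmf)
  also have "\<dots> = ennreal (\<integral>x. real x / offspring_mean p \<partial>measure_pmf p)"
    using int assms by (intro nn_integral_eq_integral) auto
  also have "(\<integral>x. real x / offspring_mean p \<partial>measure_pmf p) = 1"
    using assms by (simp add: offspring_mean_def)
  finally show "(\<integral>\<^sup>+x. ennreal (real x * pmf p x / offspring_mean p) \<partial>count_space UNIV) = 1"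
    by simp
qed

text \<open>
  Every sequence \<open>u\<close> independently carries a triple \<open>(a, b, c)\<close>: the number \<open>a\<close> of
  children that \<open>u\<close> has if it is a normal node, and, independently, the number \<open>b\<close> of
  children that it has if it is a special node together with the child \<open>c\<close>, uniform
  in \<open>{1..b}\<close>, that is special in this case.
\<close>

definition immortal_node_pmf :: "nat pmf \<Rightarrow> (nat \<times> nat \<times> nat) pmf" where
  "immortal_node_pmf p =
     pair_pmf p
       (bind_pmf (size_biased p) (\<lambda>b. map_pmf (\<lambda>c. (b, c)) (pmf_of_set {1..b})))"

definition immortal_special :: "(nat list \<Rightarrow> nat \<times> nat \<times> nat) \<Rightarrow> nat list \<Rightarrow> bool" where
  "immortal_special \<omega> u \<longleftrightarrow> (\<forall>j<length u. u ! j = snd (snd (\<omega> (take j u))))"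

definition immortal_tree :: "(nat list \<Rightarrow> nat \<times> nat \<times> nat) \<Rightarrow> neveu_tree" where
  "immortal_tree \<omega> =
     tree_of_degrees
       (\<lambda>u. if immortal_special \<omega> u then fst (snd (\<omega> u)) else fst (\<omega> u))"

definition immortal_tree_law :: "nat pmf \<Rightarrow> neveu_tree measure" where
  "immortal_tree_law p =
     distr (\<Pi>\<^sub>M u\<in>UNIV. measure_pmf (immortal_node_pmf p)) borel immortal_tree"

definition cond_law ::
    "'a measure \<Rightarrow> ('a \<Rightarrow> neveu_tree) \<Rightarrow> (neveu_tree \<Rightarrow> bool) \<Rightarrow> neveu_tree measure" where
  "cond_law \<Omega> \<tau> E = distr (uniform_measure \<Omega> {\<omega>\<in>space \<Omega>. E (\<tau> \<omega>)}) borel \<tau>"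

definition conv_in_distribution ::
    "('i \<Rightarrow> 'b::metric_space measure) \<Rightarrow> 'b measure \<Rightarrow> 'i filter \<Rightarrow> bool" where
  "conv_in_distribution P Q F \<longleftrightarrow>
     (\<forall>f::'b \<Rightarrow> real. continuous_on UNIV f \<and> bounded (range f) \<longrightarrow>
        ((\<lambda>i. \<integral>x. f x \<partial>P i) \<longlongrightarrow> (\<integral>x. f x \<partial>Q)) F)"

text \<open>The limit \<open>n \<rightarrow> \<infinity>\<close> along \<open>n \<in> S\<close>; it is not trivial iff \<open>S\<close> is infinite.\<close>

definition sequentially_along :: "nat set \<Rightarrow> nat filter" where
  "sequentially_along S = inf sequentially (principal S)"

end

theory Submission
  imports Defs
begin

text \<open>
  Under \<open>P\<close> the tree \<open>\<tau>\<close> is almost surely finite.  Given that \<open>\<tau>\<close> restricted to height \<open>h\<close> is \<open>x\<close>, the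
  subtrees above the \<open>k\<close> nodes of \<open>x\<close> at height \<open>h\<close> are \<open>k\<close> independent copies of \<open>\<tau>\<close>, and the
  immortal tree gives \<open>x\<close> the mass \<open>k / \<mu>\<^sup>h\<close> times that given by \<open>\<tau>\<close>.  By Fatou's lemma it therefore
  suffices to show that conditioning multiplies the mass of \<open>x\<close> by at least \<open>k / \<mu>\<^sup>h\<close> in the limit,
  and for this it is enough that one of the \<open>k\<close> subtrees is large.

  For the maximal out-degree and the height one has explicit formulas in terms of distribution
  functions (for the height, \<open>P(H = n + 1) \<le> \<mu> P(H = n)\<close> by convexity).  For the width, bounded
  support forces a large width to be reached at a large height, when the other subtrees are extinct.

  For \<open>L\<^sub>A\<close> one needs the ratio limit property \<open>P(L\<^sub>A = n - c) \<ge> (1 - o(1)) P(L\<^sub>A = n)\<close> and its analogue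
  for forests.  Kemperman's formula expresses these masses by walks with exchangeable steps.  The
  conditional probability that the first step is \<open>d\<close> is the mean proportion of steps equal to \<open>d\<close>,
  which is close to \<open>p\<^sub>d\<close> up to an exponentially small error; so removing a step \<open>d\<close> is asymptotically
  harmless, because \<open>P(L\<^sub>A = n)\<close> does not decay exponentially when \<open>p\<close> is critical.
\<close>

section \<open>Finite ordered trees\<close>

text \<open>As a rewrite rule \<open>tree_trunc 0 t = tree_trunc 0 t'\<close> loops.\<close>

declare tree_trunc_0 [simp del]

text \<open>A Galton--Watson tree is given as a random variable with values in an uncountable space,
  with a branching property stated under conditional measures. Almost sure finiteness moves
  everything to the countable type \<open>ftree\<close>, where the law is a pmf and the branching
  property the fixed-point equation \<open>gw_pmf_rec\<close>. Each functional then only has to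
  provide the inequality \<open>spine_bound\<close>. The hard case is \<open>occ A\<close>: neither
  a finite variance nor aperiodicity is assumed, so a local limit theorem is not at hand. Instead,
  two masses of walks are compared directly. Deleting a step d with \<open>pmf p d > 0\<close> costs
  a factor close to 1 and an additive error that is exponentially small in n, uniformly in the end
  point; the weight 1 / m in Kemperman's formula only improves when a step is deleted. A truncation
  \<open>x\<close> involves finitely many deletions, so no rate of convergence is needed.\<close>

datatype ftree = Node (subtrees: "ftree list")

instance ftree :: countable
  by countable_datatype

primrec occ :: "nat set \<Rightarrow> ftree \<Rightarrow> nat" where
  "occ A (Node ts) = of_bool (length ts \<in> A) + sum_list (map (occ A) ts)"

primrec maxdeg :: "ftree \<Rightarrow> nat" where
  "maxdeg (Node ts) = Max (insert (length ts) (set (map maxdeg ts)))"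

primrec height :: "ftree \<Rightarrow> nat" where
  "height (Node ts) = Max (insert 0 (Suc ` set (map height ts)))"

primrec level :: "nat \<Rightarrow> ftree \<Rightarrow> nat" where
  "level 0 t = 1"
| "level (Suc b) t = sum_list (map (level b) (subtrees t))"

primrec prune :: "nat \<Rightarrow> ftree \<Rightarrow> ftree" where
  "prune 0 t = Node []"
| "prune (Suc h) t = Node (map (prune h) (subtrees t))"

text \<open>Neveu labels number children from 1, list positions start at 0; hence
  \<open>i - 1\<close>.\<close>

primrec addr :: "nat list \<Rightarrow> ftree \<Rightarrow> bool" where
  "addr [] t = True"
| "addr (i # u) t = (1 \<le> i \<and> i \<le> length (subtrees t) \<and> addr u (subtrees t ! (i - 1)))"

section \<open>Embedding of the finite trees into the Neveu trees\<close>

definition to_neveu :: "ftree \<Rightarrow> neveu_tree" where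
  "to_neveu t = Abs_neveu_tree {u. addr u t}"

lemma addr_append1: "addr (u @ v) t \<Longrightarrow> addr u t"
  by (induction u arbitrary: t) auto

lemma addr_snoc: "addr u t \<Longrightarrow> \<exists>k. \<forall>i. addr (u @ [i]) t \<longleftrightarrow> 1 \<le> i \<and> i \<le> k"
  by (induction u arbitrary: t) auto

lemma addr_pos: "addr u t \<Longrightarrow> i \<in> set u \<Longrightarrow> 1 \<le> i"
  by (induction u arbitrary: t) auto

lemma tree_nodes_embed [simp]: "tree_nodes (to_neveu t) = {u. addr u t}"
proof -
  have "is_neveu_tree {u. addr u t}"
    unfolding is_neveu_tree_def
    using addr_snoc addr_pos addr_append1 by (auto simp: prefix_def)
  then show ?thesis unfolding to_neveu_def by (simp add: Abs_neveu_tree_inverse)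
qed

lemma is_neveu_tree_nodes [simp]: "is_neveu_tree (tree_nodes s)"
  using tree_nodes by blast

lemma root_in_tree_nodes [simp]: "[] \<in> tree_nodes s"
  using is_neveu_tree_nodes[of s] unfolding is_neveu_tree_def by blast

lemma tree_nodes_prefix: "u @ v \<in> tree_nodes s \<Longrightarrow> u \<in> tree_nodes s"
  using is_neveu_tree_nodes[of s] unfolding is_neveu_tree_def prefix_def by blast

lemma out_degree_eqI:
  assumes "\<And>i. u @ [i] \<in> tree_nodes s \<longleftrightarrow> 1 \<le> i \<and> i \<le> k"
  shows "out_degree s u = k"
proof -
  have "k' = k" if "\<And>i. u @ [i] \<in> tree_nodes s \<longleftrightarrow> 1 \<le> i \<and> i \<le> k'" for k'
    using assms that by (metis One_nat_def Suc_leI le_zero_eq linorder_not_less nle_le not_gr0)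
  then show ?thesis
    unfolding out_degree_def using assms by (intro the_equality) auto
qed

lemma singleton_in_tree_nodes: "[i] \<in> tree_nodes s \<longleftrightarrow> i \<in> {1..out_degree s []}"
  using out_degree_iff[of "[]" s i] by simp

lemma tree_nodes_child_subtree:
  "i \<in> {1..out_degree s []} \<Longrightarrow> tree_nodes (child_subtree i s) = {u. i # u \<in> tree_nodes s}"
  unfolding singleton_in_tree_nodes[symmetric] by transfer simp

lemma Cons_in_tree_nodes:
  "i # u \<in> tree_nodes s \<longleftrightarrow> i \<in> {1..out_degree s []} \<and> u \<in> tree_nodes (child_subtree i s)"
  using tree_nodes_child_subtree[of i s] tree_nodes_prefix[of "[i]" u s]
  by (auto simp: singleton_in_tree_nodes)

lemma out_degree_child_subtree:
  "i \<in> {1..out_degree s []} \<Longrightarrow> out_degree (child_subtree i s) u = out_degree s (i # u)"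
  unfolding out_degree_def[of "child_subtree i s"] out_degree_def[of s "i # u"]
  by (subst tree_nodes_child_subtree) simp_all

lemma neveu_tree_eq_iff:
  "s = s' \<longleftrightarrow> out_degree s [] = out_degree s' [] \<and>
     (\<forall>i\<in>{1..out_degree s []}. child_subtree i s = child_subtree i s')"
proof safe
  assume *: "out_degree s [] = out_degree s' []"
    "\<forall>i\<in>{1..out_degree s []}. child_subtree i s = child_subtree i s'"
  have "u \<in> tree_nodes s \<longleftrightarrow> u \<in> tree_nodes s'" for u
    using * by (cases u) (auto simp: Cons_in_tree_nodes)
  then show "s = s'"
    by (intro tree_nodes_inject[THEN iffD1]) auto
qed

lemma out_degree_embed_root [simp]: "out_degree (to_neveu t) [] = length (subtrees t)"
  by (rule out_degree_eqI) auto

lemma child_subtree_embed [simp]: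
  "i \<in> {1..length (subtrees t)} \<Longrightarrow> child_subtree i (to_neveu t) = to_neveu (subtrees t ! (i - 1))"
  by (intro tree_nodes_inject[THEN iffD1]) (auto simp: tree_nodes_child_subtree)

lemma out_degree_embed_Cons:
  "i \<in> {1..length (subtrees t)} \<Longrightarrow>
     out_degree (to_neveu t) (i # u) = out_degree (to_neveu (subtrees t ! (i - 1))) u"
  using out_degree_child_subtree[of i "to_neveu t" u] by simp

lemma eq_embed_iff:
  "s = to_neveu (Node ts) \<longleftrightarrow> out_degree s [] = length ts \<and>
     (\<forall>i\<in>{1..length ts}. child_subtree i s = to_neveu (ts ! (i - 1)))"
  by (subst neveu_tree_eq_iff) auto

lemma inj_embed: "inj to_neveu"
proof -
  have "to_neveu t = to_neveu t' \<Longrightarrow> t = t'" for t t'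
  proof (induction t arbitrary: t')
    case (Node ts)
    obtain ts' where t': "t' = Node ts'" by (cases t')
    from Node.prems have len: "length ts = length ts'"
      and ch: "\<forall>i\<in>{1..length ts'}. child_subtree i (to_neveu (Node ts)) = to_neveu (ts' ! (i - 1))"
      unfolding t' eq_embed_iff by auto
    have "ts ! j = ts' ! j" if "j < length ts" for j
      using ch[rule_format, of "Suc j"] that len Node.IH[of "ts ! j" "ts' ! j"] by simp
    then show ?case using len t' by (auto intro: nth_equalityI)
  qed
  then show ?thesis by (auto intro: injI)
qed

lemma embed_eq_iff [simp]: "to_neveu t = to_neveu t' \<longleftrightarrow> t = t'"
  using inj_embed by (auto dest: injD)

lemma tree_nodes_trunc: "tree_nodes (tree_trunc h s) = {u \<in> tree_nodes s. length u \<le> h}"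
  by transfer simp

lemma out_degree_trunc:
  "u \<in> tree_nodes s \<Longrightarrow> length u < h \<Longrightarrow> out_degree (tree_trunc h s) u = out_degree s u"
  by (rule out_degree_eqI) (auto simp: tree_nodes_trunc out_degree_iff)

lemma child_subtree_trunc:
  "i \<in> {1..out_degree s []} \<Longrightarrow>
     child_subtree i (tree_trunc (Suc h) s) = tree_trunc h (child_subtree i s)"
  by (intro tree_nodes_inject[THEN iffD1])
     (auto simp: tree_nodes_child_subtree tree_nodes_trunc out_degree_trunc)

lemma addr_leaf [simp]: "addr u (Node []) \<longleftrightarrow> u = []"
  by (cases u) auto

lemma tree_trunc_0_eq_embed: "tree_trunc 0 s = to_neveu (Node [])"
proof -
  have "tree_nodes (tree_trunc 0 s) = {[]}"
    unfolding tree_nodes_trunc by auto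
  then show ?thesis
    by (intro tree_nodes_inject[THEN iffD1]) simp
qed

lemma tree_trunc_Suc_eq_embed_iff:
  "tree_trunc (Suc h) s = to_neveu (Node ts) \<longleftrightarrow> out_degree s [] = length ts \<and>
     (\<forall>i\<in>{1..length ts}. tree_trunc h (child_subtree i s) = to_neveu (ts ! (i - 1)))"
  unfolding eq_embed_iff by (auto simp: out_degree_trunc child_subtree_trunc)

text \<open>Finiteness passes from the branches to the tree because the root has finite out-degree.
  The set \<open>X\<close> carries along a property of the branches, such as a bound on their
  height.\<close>

lemma in_embed_image_if_subtrees:
  assumes "\<forall>i\<in>{1..out_degree s []}. child_subtree i s \<in> to_neveu ` X"
  shows "\<exists>ts. s = to_neveu (Node ts) \<and> set ts \<subseteq> X"
proof -
  define f where "f i = inv to_neveu (child_subtree i s)" for i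
  have f: "child_subtree i s = to_neveu (f i) \<and> f i \<in> X" if "i \<in> {1..out_degree s []}" for i
    using bspec[OF assms that] by (auto simp: f_def inv_f_f[OF inj_embed])
  define ts where "ts = map (\<lambda>j. f (Suc j)) [0..<out_degree s []]"
  have len: "length ts = out_degree s []"
    by (simp add: ts_def)
  have nth: "ts ! (i - 1) = f i" if "i \<in> {1..out_degree s []}" for i
  proof -
    have "i - 1 < out_degree s []" using that by auto
    then show ?thesis using that by (simp add: ts_def)
  qed
  have "s = to_neveu (Node ts)"
    unfolding eq_embed_iff len using f nth by simp
  moreover have "set ts \<subseteq> X"
    using f by (auto simp: ts_def)
  ultimately show ?thesis by blast
qed

text \<open>Truncations of locally finite trees are finite. Cylinders are therefore indexed by the
  countable type \<open>ftree\<close>.\<close>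

lemma tree_trunc_in_range_embed: "tree_trunc h s \<in> range to_neveu"
proof (induction h arbitrary: s)
  case 0
  then show ?case by (simp add: tree_trunc_0_eq_embed)
next
  case (Suc h)
  have "child_subtree i (tree_trunc (Suc h) s) \<in> range to_neveu"
    if "i \<in> {1..out_degree (tree_trunc (Suc h) s) []}" for i
    using that Suc by (simp add: out_degree_trunc child_subtree_trunc)
  then show ?case
    using in_embed_image_if_subtrees[of "tree_trunc (Suc h) s" UNIV] by auto
qed

lemma tree_trunc_embed [simp]: "tree_trunc h (to_neveu t) = to_neveu (prune h t)"
proof (induction h arbitrary: t)
  case 0
  then show ?case by (simp add: tree_trunc_0_eq_embed)
next
  case (Suc h)
  have *: "\<forall>i\<in>{1..length (subtrees t)}.
      tree_trunc h (child_subtree i (to_neveu t)) = to_neveu (map (prune h) (subtrees t) ! (i - 1))"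
  proof
    fix i assume i: "i \<in> {1..length (subtrees t)}"
    then have "i - 1 < length (subtrees t)" by auto
    then show "tree_trunc h (child_subtree i (to_neveu t)) = to_neveu (map (prune h) (subtrees t) ! (i - 1))"
      by (simp only: child_subtree_embed[OF i] Suc nth_map)
  qed
  show ?case
    unfolding prune.simps tree_trunc_Suc_eq_embed_iff length_map out_degree_embed_root
    by (rule conjI[OF refl *])
qed

lemma prune_prune [simp]: "prune h (prune h t) = prune h t"
  by (induction h arbitrary: t) simp_all

lemma finite_addr [simp]: "finite {u. addr u t}"
proof (induction t)
  case (Node ts)
  have "{u. addr u (Node ts)} \<subseteq> insert [] (\<Union>i\<in>{1..length ts}. Cons i ` {u. addr u (ts ! (i - 1))})"
  proof
    fix u assume "u \<in> {u. addr u (Node ts)}"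
    then show "u \<in> insert [] (\<Union>i\<in>{1..length ts}. Cons i ` {u. addr u (ts ! (i - 1))})"
      by (cases u) auto
  qed
  moreover have "finite {u. addr u (ts ! (i - 1))}" if "i \<in> {1..length ts}" for i
    using that by (intro Node nth_mem) auto
  ultimately show ?case by (metis (no_types, lifting) finite_UN finite_atLeastAtMost finite_imageI finite_insert finite_subset)
qed

text \<open>Counting recursion shared by \<open>tree_L\<close> and \<open>tree_Y\<close>.
  \<open>Q\<close> may depend on the branch, as the out-degree of a node is to be read in the branch
  that contains it.\<close>

lemma card_addr_Node:
  assumes "\<And>i u. i \<in> {1..length ts} \<Longrightarrow> addr u (ts ! (i - 1)) \<Longrightarrow> P (i # u) \<longleftrightarrow> Q (ts ! (i - 1)) u"
  shows "card {u. addr u (Node ts) \<and> P u} =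
     of_bool (P []) + sum_list (map (\<lambda>t. card {u. addr u t \<and> Q t u}) ts)"
proof -
  let ?B = "\<lambda>i. Cons (Suc i) ` {u. addr u (ts ! i) \<and> Q (ts ! i) u}"
  have *: "{u. addr u (Node ts) \<and> P u} = {u. u = [] \<and> P u} \<union> (\<Union>i<length ts. ?B i)" (is "?L = ?R")
  proof (rule set_eqI)
    fix u
    show "u \<in> ?L \<longleftrightarrow> u \<in> ?R"
    proof (cases u)
      case (Cons i v)
      have "1 \<le> i \<and> i \<le> length ts \<Longrightarrow> \<exists>j<length ts. i = Suc j"
        by (metis Suc_le_D Suc_le_eq One_nat_def)
      then show ?thesis using assms[of i v] Cons by (auto 4 4)
    qed auto
  qed
  have "card {u. addr u (Node ts) \<and> P u} = card {u. u = [] \<and> P u} + card (\<Union>i<length ts. ?B i)"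
    unfolding * by (intro card_Un_disjoint) auto
  also have "card {u. u = [] \<and> P u} = of_bool (P [])"
  proof -
    have "{u. u = [] \<and> P u} = (if P [] then {[]} else {})" by auto
    then show ?thesis by simp
  qed
  also have "card (\<Union>i<length ts. ?B i) = (\<Sum>i<length ts. card (?B i))"
    by (intro card_UN_disjoint) auto
  also have "\<dots> = (\<Sum>i<length ts. card {u. addr u (ts ! i) \<and> Q (ts ! i) u})"
    by (intro sum.cong card_image) auto
  also have "\<dots> = sum_list (map (\<lambda>t. card {u. addr u t \<and> Q t u}) ts)"
    by (simp add: sum_list_sum_nth atLeast0LessThan)
  finally show ?thesis .
qed

section \<open>The four functionals on finite trees\<close>

lemma set_ecard_addr: "set_ecard {u. addr u t \<and> P u} = enat (card {u. addr u t \<and> P u})"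
  unfolding set_ecard_def using finite_subset[OF _ finite_addr[of t], of "{u. addr u t \<and> P u}"] by auto

lemma tree_L_embed [simp]: "tree_L A (to_neveu t) = enat (occ A t)"
proof -
  have "card {u. addr u t \<and> out_degree (to_neveu t) u \<in> A} = occ A t"
  proof (induction t)
    case (Node ts)
    have "card {u. addr u (Node ts) \<and> out_degree (to_neveu (Node ts)) u \<in> A} =
       of_bool (length ts \<in> A) + sum_list (map (\<lambda>t. card {u. addr u t \<and> out_degree (to_neveu t) u \<in> A}) ts)"
      by (subst card_addr_Node[where Q = "\<lambda>t u. out_degree (to_neveu t) u \<in> A"])
         (auto simp: out_degree_embed_Cons)
    also have "\<dots> = occ A (Node ts)"
      using Node by (simp cong: map_cong)
    finally show ?case .
  qed
  then show ?thesis by (simp add: tree_L_def set_ecard_addr)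
qed

lemma card_level: "card {u. addr u t \<and> length u = b} = level b t"
proof (induction b arbitrary: t)
  case 0
  have "{u. addr u t \<and> length u = 0} = {[]}" by auto
  then show ?case by simp
next
  case (Suc b)
  obtain ts where t: "t = Node ts" by (cases t)
  show ?case unfolding t
    by (subst card_addr_Node[where Q = "\<lambda>t u. length u = b"]) (auto simp: Suc)
qed

lemma tree_Y_embed [simp]: "tree_Y b (to_neveu t) = enat (level b t)"
  by (simp add: tree_Y_def set_ecard_addr card_level)

lemma level_eq_0: "height t < b \<Longrightarrow> level b t = 0"
proof (induction b arbitrary: t)
  case (Suc b)
  obtain ts where t: "t = Node ts" by (cases t)
  show ?case using Suc by (auto simp: t)
qed simp

lemma height_le_iff: "height (Node ts) \<le> Suc n \<longleftrightarrow> (\<forall>t\<in>set ts. height t \<le> n)"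
  by simp

lemma height_le_0_iff: "height (Node ts) \<le> 0 \<longleftrightarrow> ts = []"
  by (auto simp: Max_eq_iff)

lemma all_nth_pred_iff: "(\<forall>i\<in>{1..length ts}. P (ts ! (i - 1))) \<longleftrightarrow> (\<forall>t\<in>set ts. P t)"
proof -
  have "{1..length ts} = Suc ` {..<length ts}"
    by (auto simp: image_Suc_lessThan)
  then show ?thesis
    by (auto simp: all_set_conv_all_nth)
qed

text \<open>Suitable for suprema, since \<open>SUP_le_iff\<close> turns an upper bound into a bound
  on each member.\<close>

lemma enat_eqI_le:
  fixes x :: enat
  assumes "\<And>n. x \<le> enat n \<longleftrightarrow> m \<le> n"
  shows "x = enat m"
proof (rule antisym)
  show "x \<le> enat m" using assms by simp
  show "enat m \<le> x" using assms by (cases x) auto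
qed

lemma tree_M_embed [simp]: "tree_M (to_neveu t) = enat (maxdeg t)"
proof (rule enat_eqI_le)
  fix n
  show "tree_M (to_neveu t) \<le> enat n \<longleftrightarrow> maxdeg t \<le> n"
    unfolding tree_M_def SUP_le_iff
  proof (induction t)
    case (Node ts)
    have "(\<forall>u\<in>tree_nodes (to_neveu (Node ts)). enat (out_degree (to_neveu (Node ts)) u) \<le> enat n) \<longleftrightarrow>
       length ts \<le> n \<and> (\<forall>i\<in>{1..length ts}. \<forall>u\<in>tree_nodes (to_neveu (ts ! (i - 1))).
          enat (out_degree (to_neveu (ts ! (i - 1))) u) \<le> enat n)" (is "?L \<longleftrightarrow> ?R")
    proof
      assume L: ?L
      have "out_degree (to_neveu (ts ! (i - 1))) u \<le> n"
        if "i \<in> {1..length ts}" "addr u (ts ! (i - 1))" for i u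
        using L[rule_format, of "i # u"] that by (simp add: out_degree_embed_Cons)
      then show ?R using L[rule_format, of "[]"] by auto
    next
      assume R: ?R
      have "out_degree (to_neveu (Node ts)) u \<le> n" if "addr u (Node ts)" for u
        using R that by (cases u) (auto simp: out_degree_embed_Cons)
      then show ?L by auto
    qed
    also have "\<dots> \<longleftrightarrow> length ts \<le> n \<and> (\<forall>t\<in>set ts. maxdeg t \<le> n)"
      unfolding all_nth_pred_iff[of ts "\<lambda>t. \<forall>u\<in>tree_nodes (to_neveu t). enat (out_degree (to_neveu t) u) \<le> enat n"]
      using Node by blast
    also have "\<dots> \<longleftrightarrow> maxdeg (Node ts) \<le> n"
      by simp
    finally show ?case .
  qed
qed

lemma tree_H_embed [simp]: "tree_H (to_neveu t) = enat (height t)"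
proof (rule enat_eqI_le)
  fix n
  have "(\<forall>u. addr u t \<longrightarrow> length u \<le> n) \<longleftrightarrow> height t \<le> n"
  proof (induction n arbitrary: t)
    case 0
    obtain ts where t: "t = Node ts" by (cases t)
    show ?case unfolding t height_le_0_iff
    proof
      assume *: "\<forall>u. addr u (Node ts) \<longrightarrow> length u \<le> 0"
      show "ts = []"
        using *[rule_format, of "[1]"] by (cases ts) auto
    next
      assume "ts = []"
      then show "\<forall>u. addr u (Node ts) \<longrightarrow> length u \<le> 0" by auto
    qed
  next
    case (Suc n)
    obtain ts where t: "t = Node ts" by (cases t)
    have "(\<forall>u. addr u (Node ts) \<longrightarrow> length u \<le> Suc n) \<longleftrightarrow>
       (\<forall>i<length ts. \<forall>u. addr u (ts ! i) \<longrightarrow> length u \<le> n)" (is "?L \<longleftrightarrow> ?R")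
    proof
      assume L: ?L
      have "length u \<le> n" if "i < length ts" "addr u (ts ! i)" for i u
        using L[rule_format, of "Suc i # u"] that by simp
      then show ?R by blast
    next
      assume R: ?R
      have "length u \<le> Suc n" if "addr u (Node ts)" for u
        using R[rule_format, of "hd u - 1" "tl u"] that by (cases u) auto
      then show ?L by blast
    qed
    then show ?case unfolding t height_le_iff Suc by (simp add: all_set_conv_all_nth)
  qed
  then show "tree_H (to_neveu t) \<le> enat n \<longleftrightarrow> height t \<le> n"
    unfolding tree_H_def SUP_le_iff by auto
qed

lemma ex_max_level: "\<exists>n. (\<forall>b. level b t \<le> n) \<and> (\<exists>b. level b t = n)"
proof -
  define m where "m = (MAX b\<in>{..height t}. level b t)"
  have "level b t \<le> m" for b
  proof (cases "b \<le> height t")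
    case True
    then show ?thesis unfolding m_def by (intro Max_ge) auto
  next
    case False
    then show ?thesis using level_eq_0[of t b] by simp
  qed
  moreover have "m \<in> (\<lambda>b. level b t) ` {..height t}"
    unfolding m_def by (intro Max_in) auto
  ultimately show ?thesis by auto
qed

text \<open>Unlike the other functionals the width is not a function of its values on the branches,
  since levels add up across branches; it has no recursive counterpart and is described by its
  levels.\<close>

lemma tree_W_embed: "tree_W (to_neveu t) = enat n \<longleftrightarrow> (\<forall>b. level b t \<le> n) \<and> (\<exists>b. level b t = n)"
proof -
  obtain m b where le: "\<And>b. level b t \<le> m" and b: "level b t = m"
    using ex_max_level by blast
  have "tree_W (to_neveu t) = enat m"
    unfolding tree_W_def
  proof (rule antisym)
    show "(SUP b. tree_Y b (to_neveu t)) \<le> enat m" using le by (intro SUP_least) auto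
    show "enat m \<le> (SUP b. tree_Y b (to_neveu t))" using b by (intro SUP_upper2[of b]) auto
  qed
  then show ?thesis using le b by auto (metis le_antisym)
qed

section \<open>The local topology\<close>

lemma tree_trunc_eq_iff_dist: "tree_trunc h s = tree_trunc h t \<longleftrightarrow> dist s t \<le> 2 powr (- real h)"
proof (cases "s = t")
  case False
  then show ?thesis
    using tree_trunc_eq_iff_le_Sup[of s t h] by (simp add: dist_neveu_tree_def)
qed simp

lemma open_if_local:
  assumes "\<And>s t. tree_trunc h s = tree_trunc h t \<Longrightarrow> P s \<Longrightarrow> P t"
  shows "open {s. P s}"
  unfolding open_dist
proof (intro ballI exI conjI allI impI)
  fix s t assume "s \<in> {s. P s}" "dist t s < 2 powr (- real h)"
  then show "t \<in> {s. P s}"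
    using assms[of s t] by (simp add: tree_trunc_eq_iff_dist dist_commute)
qed simp

lemma borel_measurable_if_local:
  fixes f :: "neveu_tree \<Rightarrow> 'a :: topological_space"
  assumes "\<And>s t. tree_trunc h s = tree_trunc h t \<Longrightarrow> f s = f t"
  shows "f \<in> borel_measurable borel"
proof (rule borel_measurableI)
  fix U :: "'a set"
  have "open {s. f s \<in> U}"
    using assms by (intro open_if_local[of h]) metis
  then show "f -` U \<inter> space borel \<in> sets borel"
    by (auto simp: vimage_def intro: borel_open)
qed

lemma pred_if_local:
  assumes "\<And>s t. tree_trunc h s = tree_trunc h t \<Longrightarrow> P s \<Longrightarrow> P t"
  shows "Measurable.pred borel P"
  using borel_open[OF open_if_local[OF assms]] by (simp add: pred_def)

lemma open_cylinder: "open {s. tree_trunc h s = t}"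
  by (rule open_if_local[of h]) simp

lemma ex_cylinder_subset:
  assumes "open U" "s \<in> U"
  shows "\<exists>h. \<forall>t. tree_trunc h t = tree_trunc h s \<longrightarrow> t \<in> U"
proof -
  obtain e where e: "e > 0" "\<And>t. dist t s < e \<Longrightarrow> t \<in> U"
    using assms unfolding open_dist by blast
  obtain h where "(1/2::real) ^ h < e"
    using real_arch_pow_inv[OF e(1), of "1/2"] by auto
  then have "2 powr (- real h) < e"
    by (simp add: powr_minus powr_realpow field_simps power_one_over)
  then show ?thesis
    by (intro exI[of _ h] allI impI e(2)) (simp add: tree_trunc_eq_iff_dist)
qed

lemma continuous_onI_local:
  assumes "\<And>h. \<exists>h'. \<forall>s t. tree_trunc h' s = tree_trunc h' t \<longrightarrow> tree_trunc h (f s) = tree_trunc h (f t)"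
  shows "continuous_on UNIV (f :: neveu_tree \<Rightarrow> neveu_tree)"
  unfolding continuous_on_open_vimage[OF open_UNIV]
proof (intro allI impI)
  fix U :: "neveu_tree set" assume U: "open U"
  show "open (f -` U \<inter> UNIV)"
  proof (subst open_subopen, intro ballI)
    fix s assume s: "s \<in> f -` U \<inter> UNIV"
    then obtain h where h: "\<And>t. tree_trunc h t = tree_trunc h (f s) \<Longrightarrow> t \<in> U"
      using ex_cylinder_subset[OF U, of "f s"] by auto
    obtain h' where h': "\<And>s t. tree_trunc h' s = tree_trunc h' t \<Longrightarrow> tree_trunc h (f s) = tree_trunc h (f t)"
      using assms[of h] by blast
    show "\<exists>T. open T \<and> s \<in> T \<and> T \<subseteq> f -` U \<inter> UNIV"
      by (intro exI[of _ "{t. tree_trunc h' t = tree_trunc h' s}"]) (auto simp: open_cylinder intro: h h')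
  qed
qed

section \<open>Measurability of branches, out-degrees and the four functionals\<close>

lemma local_tree_nodes:
  "tree_trunc h s = tree_trunc h t \<Longrightarrow> length u \<le> h \<Longrightarrow> u \<in> tree_nodes s \<longleftrightarrow> u \<in> tree_nodes t"
  using tree_nodes_trunc[of h s] tree_nodes_trunc[of h t] by auto

lemma local_out_degree:
  "tree_trunc h s = tree_trunc h t \<Longrightarrow> length u < h \<Longrightarrow> u \<in> tree_nodes s \<Longrightarrow> out_degree s u = out_degree t u"
  using out_degree_trunc[of u s h] out_degree_trunc[of u t h] local_tree_nodes[of h s t u] by auto

lemma measurable_child_subtree [measurable]: "child_subtree i \<in> borel_measurable borel"
proof (intro borel_measurable_continuous_onI continuous_onI_local exI allI impI)
  fix h s t assume eq: "tree_trunc (Suc h) s = tree_trunc (Suc h) t"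
  have deg: "out_degree s [] = out_degree t []"
    using local_out_degree[OF eq, of "[]"] by simp
  show "tree_trunc h (child_subtree i s) = tree_trunc h (child_subtree i t)"
  proof (cases "i \<in> {1..out_degree s []}")
    case True
    then show ?thesis
      using deg eq child_subtree_trunc[of i s h] child_subtree_trunc[of i t h] by simp
  next
    case False
    then have "[i] \<notin> tree_nodes s" "[i] \<notin> tree_nodes t"
      by (simp_all only: singleton_in_tree_nodes deg not_False_eq_True)
    then have "child_subtree i s = child_subtree i t"
      by transfer simp
    then show ?thesis by simp
  qed
qed

lemma measurable_out_degree_root [measurable]:
  "(\<lambda>s. out_degree s []) \<in> measurable borel (count_space UNIV)"
proof (subst measurable_count_space_eq2_countable, intro conjI ballI)
  fix n :: nat
  have "open {s. out_degree s [] = n}"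
  proof (rule open_if_local)
    fix s t assume "tree_trunc 1 s = tree_trunc 1 t" "out_degree s [] = n"
    then show "out_degree t [] = n"
      using local_out_degree[of 1 s t "[]"] by simp
  qed
  then show "(\<lambda>s. out_degree s []) -` {n} \<inter> space borel \<in> sets borel"
    by (auto simp: vimage_def intro: borel_open)
qed auto

text \<open>Equality is reduced to upper bounds because the functionals are suprema or
  cardinalities: the events \<open>\<Phi> s \<le> enat n\<close> are countable intersections of
  events that depend on a truncation.\<close>

lemma pred_eq_enat:
  fixes \<Phi> :: "'a \<Rightarrow> enat"
  assumes [measurable]: "\<And>n. Measurable.pred M (\<lambda>s. \<Phi> s \<le> enat n)"
  shows "Measurable.pred M (\<lambda>s. \<Phi> s = enat n)"
proof -
  have "\<Phi> s = enat n \<longleftrightarrow> \<Phi> s \<le> enat n \<and> (\<forall>m\<in>{..<n}. \<not> \<Phi> s \<le> enat m)" for s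
    by (cases "\<Phi> s") (auto simp: not_le intro: le_antisym leI)
  then show ?thesis by simp
qed

lemma pred_tree_M: "Measurable.pred borel (\<lambda>s. tree_M s = enat n)"
proof (rule pred_eq_enat)
  fix n
  have [measurable]: "Measurable.pred borel (\<lambda>s. \<forall>u\<in>tree_nodes s. length u < h \<longrightarrow> out_degree s u \<le> n)" for h
    by (rule pred_if_local[of h]) (metis local_out_degree local_tree_nodes less_imp_le)
  have "tree_M s \<le> enat n \<longleftrightarrow> (\<forall>h. \<forall>u\<in>tree_nodes s. length u < h \<longrightarrow> out_degree s u \<le> n)" for s
    unfolding tree_M_def SUP_le_iff by auto
  then show "Measurable.pred borel (\<lambda>s. tree_M s \<le> enat n)" by simp
qed

lemma pred_tree_H: "Measurable.pred borel (\<lambda>s. tree_H s = enat n)"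
proof (rule pred_eq_enat)
  fix n
  have [measurable]: "Measurable.pred borel (\<lambda>s. \<forall>u\<in>tree_nodes s. length u \<le> h \<longrightarrow> length u \<le> n)" for h
    by (rule pred_if_local[of h]) (metis local_tree_nodes)
  have "tree_H s \<le> enat n \<longleftrightarrow> (\<forall>h. \<forall>u\<in>tree_nodes s. length u \<le> h \<longrightarrow> length u \<le> n)" for s
    unfolding tree_H_def SUP_le_iff by auto
  then show "Measurable.pred borel (\<lambda>s. tree_H s \<le> enat n)" by simp
qed

lemma pred_tree_W: "Measurable.pred borel (\<lambda>s. tree_W s = enat n)"
proof (rule pred_eq_enat)
  fix n
  have [measurable]: "Measurable.pred borel (\<lambda>s. tree_Y b s \<le> enat n)" for b
  proof (rule pred_if_local[of b])
    fix s t assume eq: "tree_trunc b s = tree_trunc b t" "tree_Y b s \<le> enat n"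
    then have "{u \<in> tree_nodes s. length u = b} = {u \<in> tree_nodes t. length u = b}"
      using local_tree_nodes by auto
    then show "tree_Y b t \<le> enat n" using eq by (simp add: tree_Y_def)
  qed
  have "tree_W s \<le> enat n \<longleftrightarrow> (\<forall>b. tree_Y b s \<le> enat n)" for s
    unfolding tree_W_def SUP_le_iff by auto
  then show "Measurable.pred borel (\<lambda>s. tree_W s \<le> enat n)" by simp
qed

text \<open>A violation is witnessed by n + 1 points, which lie in a single \<open>S h\<close> by
  monotonicity. This serves \<open>tree_L\<close>, an infinite count approached through the
  truncations.\<close>

lemma set_ecard_le_iff:
  assumes "incseq S"
  shows "set_ecard (\<Union>h. S h) \<le> enat n \<longleftrightarrow> (\<forall>h::nat. set_ecard (S h) \<le> enat n)"
proof
  assume *: "set_ecard (\<Union>h. S h) \<le> enat n"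
  then have fin: "finite (\<Union>h. S h)" and "card (\<Union>h. S h) \<le> n"
    by (auto simp: set_ecard_def split: if_splits)
  moreover have "finite (S h)" for h
    using fin by (rule finite_subset[rotated]) auto
  moreover have "card (S h) \<le> card (\<Union>h. S h)" for h
    using fin by (intro card_mono) auto
  ultimately show "\<forall>h. set_ecard (S h) \<le> enat n"
    by (auto simp: set_ecard_def intro: order_trans)
next
  assume *: "\<forall>h. set_ecard (S h) \<le> enat n"
  have "card X \<le> n" if X: "X \<subseteq> (\<Union>h. S h)" "finite X" for X
  proof -
    have "\<exists>h. X \<subseteq> S h"
      using X(2,1)
    proof (induction X)
      case (insert x X)
      then obtain h k where "X \<subseteq> S h" "x \<in> S k" by auto
      then have "insert x X \<subseteq> S (max h k)"
        using assms by (auto simp: incseq_def) (meson max.cobounded1 max.cobounded2 subset_eq)+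
      then show ?case by blast
    qed simp
    then obtain h where h: "X \<subseteq> S h" by blast
    have "finite (S h)" "card (S h) \<le> n"
      using *[rule_format, of h] by (auto simp: set_ecard_def split: if_splits)
    then show ?thesis using card_mono[OF _ h] by linarith
  qed
  note bd = this
  have "finite (\<Union>h. S h)"
  proof (rule ccontr)
    assume "infinite (\<Union>h. S h)"
    then obtain X where "X \<subseteq> (\<Union>h. S h)" "finite X" "card X = Suc n"
      using infinite_arbitrarily_large by blast
    then show False using bd[of X] by simp
  qed
  then show "set_ecard (\<Union>h. S h) \<le> enat n"
    using bd[of "\<Union>h. S h"] by (simp add: set_ecard_def)
qed

lemma pred_tree_L: "Measurable.pred borel (\<lambda>s. tree_L A s = enat n)"
proof (rule pred_eq_enat)
  fix n
  let ?S = "\<lambda>s h. {u \<in> tree_nodes s. length u < h \<and> out_degree s u \<in> A}"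
  have [measurable]: "Measurable.pred borel (\<lambda>s. set_ecard (?S s h) \<le> enat n)" for h
  proof (rule pred_if_local[of h])
    fix s t assume eq: "tree_trunc h s = tree_trunc h t" "set_ecard (?S s h) \<le> enat n"
    have "?S s h = ?S t h"
      using local_tree_nodes[OF eq(1)] local_out_degree[OF eq(1)] by (auto simp: less_imp_le)
    then show "set_ecard (?S t h) \<le> enat n" using eq by simp
  qed
  have "tree_L A s \<le> enat n \<longleftrightarrow> (\<forall>h. set_ecard (?S s h) \<le> enat n)" for s
  proof -
    have "{u \<in> tree_nodes s. out_degree s u \<in> A} = (\<Union>h. ?S s h)" by auto
    moreover have "incseq (?S s)" by (auto simp: incseq_def)
    ultimately show ?thesis
      unfolding tree_L_def by (simp only: set_ecard_le_iff)
  qed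
  then show "Measurable.pred borel (\<lambda>s. tree_L A s \<le> enat n)" by simp
qed

lemma sets_borel_embed [simp, measurable]: "to_neveu ` X \<in> sets borel"
  by (rule sets.countable) (auto intro: borel_closed)

text \<open>
  The infimum of \<open>g\<close> over the cylinder of height \<open>h\<close> around a tree increases to \<open>g\<close>; hence a lower
  bound on the limiting masses of cylinders, applied to \<open>f\<close> and \<open>-f\<close> shifted to be nonnegative,
  yields convergence.
\<close>

lemma conv_in_distributionI:
  fixes P :: "nat \<Rightarrow> neveu_tree measure"
  assumes Q: "prob_space Q" "sets Q = sets borel"
    and P: "eventually (\<lambda>n. prob_space (P n) \<and> sets (P n) = sets borel) F"
    and lb: "\<And>h x c. prune h x = x \<Longrightarrow> c < measure Q {s. tree_trunc h s = to_neveu x} \<Longrightarrow>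
        eventually (\<lambda>n. c \<le> measure (P n) {s. tree_trunc h s = to_neveu x}) F"
  shows "conv_in_distribution P Q F"
proof -
  interpret Q: prob_space Q by fact
  note [measurable_cong] = Q(2)
  \<comment> \<open>A numbering of the cylinders; it is used only at truncations, where
    \<open>inv to_neveu\<close> is a genuine inverse.\<close>
  define code where "code = (\<lambda>s. to_nat (inv to_neveu s))"
  have key: "eventually (\<lambda>n. (\<integral>s. g s \<partial>Q) - e \<le> (\<integral>s. g s \<partial>P n)) F"
    if g: "continuous_on UNIV g" "\<And>s. 0 \<le> g s" "\<And>s. g s \<le> B" and e: "e > 0"
    for g :: "neveu_tree \<Rightarrow> real" and B e
  proof -
    have [measurable]: "g \<in> borel_measurable borel"
      using g(1) by (rule borel_measurable_continuous_onI)
    define m where "m h s = (INF t\<in>{t. tree_trunc h t = tree_trunc h s}. g t)" for h s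
    have bdd: "bdd_below (g ` X)" for X
      using g(2) by (intro bdd_belowI[of _ 0]) auto
    have m_le: "m h s \<le> g t" if "tree_trunc h t = tree_trunc h s" for h s t
      unfolding m_def using that bdd by (intro cINF_lower) auto
    have m_nonneg: "0 \<le> m h s" for h s
      unfolding m_def using g(2) by (intro cINF_greatest) auto
    have m_cong: "m h s = m h t" if "tree_trunc h t = tree_trunc h s" for h s t
      unfolding m_def that by simp
    \<comment> \<open>A second cut-off leaves only finitely many cylinders, so that the integral of
      \<open>K h N\<close> is a finite combination of cylinder masses.\<close>
    define K where "K h N s = m h s * of_bool (code (tree_trunc h s) \<le> N)" for h N s
    have [measurable]: "m h \<in> borel_measurable borel" "K h N \<in> borel_measurable borel" for h N
    proof -
      show "m h \<in> borel_measurable borel"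
        by (rule borel_measurable_if_local[of h]) (rule m_cong, simp)
      show "K h N \<in> borel_measurable borel"
        by (rule borel_measurable_if_local[of h]) (simp only: K_def, metis m_cong)
    qed
    have "(\<lambda>h. \<integral>s. m h s \<partial>Q) \<longlonglongrightarrow> (\<integral>s. g s \<partial>Q)"
    proof (rule integral_dominated_convergence[where w = "\<lambda>_. B"])
      show "AE s in Q. (\<lambda>h. m h s) \<longlonglongrightarrow> g s"
      proof (rule AE_I2)
        fix s
        show "(\<lambda>h. m h s) \<longlonglongrightarrow> g s"
        proof (rule LIMSEQ_I)
          fix r :: real assume r: "r > 0"
          have "open (g -` {g s - r/2<..})"
            using g(1) by (simp add: continuous_on_open_vimage)
          then obtain h0 where h0: "\<And>t. tree_trunc h0 t = tree_trunc h0 s \<Longrightarrow> g t > g s - r/2"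
            using ex_cylinder_subset[of "g -` {g s - r/2<..}" s] r by auto
          have "g s - r/2 \<le> m h s" if "h \<ge> h0" for h
            unfolding m_def
          proof (rule cINF_greatest)
            fix t assume "t \<in> {t. tree_trunc h t = tree_trunc h s}"
            then have "tree_trunc h0 t = tree_trunc h0 s"
              using that tree_trunc_mono by blast
            then show "g s - r/2 \<le> g t" using h0 by force
          qed auto
          then have "norm (m h s - g s) < r" if "h \<ge> h0" for h
            using m_le[of h s s] that r by (fastforce simp: abs_if)
          then show "\<exists>h0. \<forall>h\<ge>h0. norm (m h s - g s) < r" by blast
        qed
      qed
      show "AE s in Q. norm (m h s) \<le> B" for h
        using m_le m_nonneg g(3) by (intro AE_I2) (metis order_trans real_norm_def abs_of_nonneg)
    qed auto
    then have "eventually (\<lambda>h. (\<integral>s. m h s \<partial>Q) > (\<integral>s. g s \<partial>Q) - e/2) sequentially"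
      using e by (intro order_tendstoD(1)) auto
    then obtain h where h: "(\<integral>s. m h s \<partial>Q) > (\<integral>s. g s \<partial>Q) - e/2"
      unfolding eventually_sequentially by blast
    have "(\<lambda>N. \<integral>s. K h N s \<partial>Q) \<longlonglongrightarrow> (\<integral>s. m h s \<partial>Q)"
    proof (rule integral_dominated_convergence[where w = "\<lambda>_. B"])
      show "AE s in Q. (\<lambda>N. K h N s) \<longlonglongrightarrow> m h s"
      proof (rule AE_I2)
        fix s
        have "eventually (\<lambda>N. K h N s = m h s) sequentially"
          using eventually_ge_at_top[of "code (tree_trunc h s)"]
          by eventually_elim (simp add: K_def)
        then show "(\<lambda>N. K h N s) \<longlonglongrightarrow> m h s" by (rule tendsto_eventually)
      qed
      show "AE s in Q. norm (K h N s) \<le> B" for N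
      proof (rule AE_I2)
        fix s
        have "0 \<le> K h N s" "K h N s \<le> m h s" "m h s \<le> B"
          using m_nonneg[of h s] m_le[of h s s] g(3)[of s] by (auto simp: K_def)
        then show "norm (K h N s) \<le> B" by simp
      qed
    qed auto
    then have "eventually (\<lambda>N. (\<integral>s. K h N s \<partial>Q) > (\<integral>s. g s \<partial>Q) - e/2) sequentially"
      using h by (intro order_tendstoD(1)) auto
    then obtain N where N: "(\<integral>s. K h N s \<partial>Q) > (\<integral>s. g s \<partial>Q) - e/2"
      unfolding eventually_sequentially by blast
    define X where "X = {x. prune h x = x \<and> to_nat x \<le> N}"
    have "finite X"
      unfolding X_def by (rule finite_subset[of _ "to_nat -` {..N}"]) (auto intro: finite_vimageI)
    have K_eq: "K h N s = (\<Sum>x\<in>X. m h (to_neveu x) * indicator {s. tree_trunc h s = to_neveu x} s)" for s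
    proof -
      obtain x where x: "tree_trunc h s = to_neveu x"
        using tree_trunc_in_range_embed[of h s] by auto
      have px: "prune h x = x"
      proof -
        have "to_neveu (prune h x) = tree_trunc h (tree_trunc h s)" by (simp add: x)
        also have "\<dots> = to_neveu x" unfolding x[symmetric] by transfer auto
        finally show ?thesis by simp
      qed
      have "m h s = m h (to_neveu x)"
        by (rule m_cong) (simp add: px x)
      then have "K h N s = (if x \<in> X then m h (to_neveu x) else 0)"
        by (simp add: K_def X_def code_def x px inv_f_f[OF inj_embed])
      also have "\<dots> = (\<Sum>y\<in>X. if y = x then m h (to_neveu y) else 0)"
        using \<open>finite X\<close> by simp
      also have "\<dots> = (\<Sum>x\<in>X. m h (to_neveu x) * indicator {s. tree_trunc h s = to_neveu x} s)"
        by (intro sum.cong) (auto simp: x indicator_def)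
      finally show ?thesis .
    qed
    have cyl [measurable]: "{s. tree_trunc h s = to_neveu x} \<in> sets borel" for x
      by (intro borel_open open_cylinder)
    have K_int: "(\<integral>s. K h N s \<partial>R) = (\<Sum>x\<in>X. m h (to_neveu x) * measure R {s. tree_trunc h s = to_neveu x})"
      if "prob_space R" "sets R = sets borel" for R
    proof -
      interpret R: prob_space R by fact
      have [measurable_cong]: "sets R = sets borel" by fact
      have [simp]: "space R = UNIV" using sets_eq_imp_space_eq[OF that(2)] by simp
      have "integrable R (indicator {s. tree_trunc h s = to_neveu x} :: _ \<Rightarrow> real)" for x
        by (intro R.integrable_const_bound[where B = 1]) (auto simp: indicator_def)
      then show ?thesis
        unfolding K_eq by (subst Bochner_Integration.integral_sum) auto
    qed
    \<comment> \<open>The summand 1 keeps \<open>M\<close> positive, and the total error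
      \<open>(M - 1) * (e / (2 * M))\<close> still stays below \<open>e/2\<close>.\<close>
    define M where "M = (\<Sum>x\<in>X. m h (to_neveu x)) + 1"
    have M: "M > 0" unfolding M_def using m_nonneg by (simp add: add_nonneg_pos sum_nonneg)
    have "eventually (\<lambda>n. \<forall>x\<in>X. measure Q {s. tree_trunc h s = to_neveu x} - e / (2 * M)
        \<le> measure (P n) {s. tree_trunc h s = to_neveu x}) F"
      unfolding eventually_ball_finite_distrib[OF \<open>finite X\<close>]
      using e M by (intro ballI lb) (auto simp: X_def)
    then show ?thesis
      using P
    proof eventually_elim
      case (elim n)
      interpret P: prob_space "P n" using elim by simp
      have sP [measurable_cong]: "sets (P n) = sets borel" using elim by simp
      have "(\<integral>s. g s \<partial>Q) - e/2 \<le> (\<Sum>x\<in>X. m h (to_neveu x) * measure Q {s. tree_trunc h s = to_neveu x})"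
        using N K_int[OF Q] by simp
      also have "\<dots> \<le> (\<Sum>x\<in>X. m h (to_neveu x) * (measure (P n) {s. tree_trunc h s = to_neveu x} + e / (2 * M)))"
        using elim m_nonneg by (intro sum_mono mult_left_mono) (auto simp: algebra_simps)
      also have "\<dots> = (\<integral>s. K h N s \<partial>P n) + (M - 1) * (e / (2 * M))"
      proof -
        have "(\<Sum>x\<in>X. m h (to_neveu x) * (measure (P n) {s. tree_trunc h s = to_neveu x} + c)) =
            (\<integral>s. K h N s \<partial>P n) + (M - 1) * c" for c
          using elim by (simp add: K_int M_def distrib_left sum.distrib flip: sum_distrib_right)
        then show ?thesis .
      qed
      also have "(M - 1) * (e / (2 * M)) \<le> e/2"
        using M e by (simp add: field_simps)
      also have "(\<integral>s. K h N s \<partial>P n) \<le> (\<integral>s. g s \<partial>P n)"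
      proof (rule integral_mono)
        have "0 \<le> K h N s" "K h N s \<le> g s" for s
          using m_nonneg[of h s] m_le[of h s s] g(2)[of s] by (auto simp: K_def)
        then show "K h N s \<le> g s" for s by simp
        have "norm (K h N s) \<le> B" "norm (g s) \<le> B" for s
          using \<open>\<And>s. 0 \<le> K h N s\<close> \<open>\<And>s. K h N s \<le> g s\<close> g(2,3)[of s]
          by (auto intro: order_trans[of _ "g s"])
        then show "integrable (P n) (K h N)" "integrable (P n) g"
          by (auto intro!: P.integrable_const_bound[where B = B])
      qed
      finally show ?case by simp
    qed
  qed
  show ?thesis
    unfolding conv_in_distribution_def
  proof (intro allI impI)
    fix f :: "neveu_tree \<Rightarrow> real"
    assume "continuous_on UNIV f \<and> bounded (range f)"
    then obtain B where f: "continuous_on UNIV f" and B: "\<And>s. \<bar>f s\<bar> \<le> B"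
      by (auto simp: bounded_iff)
    have [measurable]: "f \<in> borel_measurable borel"
      using f by (rule borel_measurable_continuous_onI)
    have int: "integrable R f" "(\<integral>s. f s + B \<partial>R) = (\<integral>s. f s \<partial>R) + B" "(\<integral>s. B - f s \<partial>R) = B - (\<integral>s. f s \<partial>R)"
      if "prob_space R" "sets R = sets borel" for R
    proof -
      interpret R: prob_space R by fact
      have [measurable_cong]: "sets R = sets borel" by fact
      show *: "integrable R f"
        using B by (intro R.integrable_const_bound[where B = B]) auto
      show "(\<integral>s. f s + B \<partial>R) = (\<integral>s. f s \<partial>R) + B" "(\<integral>s. B - f s \<partial>R) = B - (\<integral>s. f s \<partial>R)"
        using * by (simp_all add: R.prob_space)
    qed
    show "((\<lambda>n. \<integral>s. f s \<partial>P n) \<longlongrightarrow> (\<integral>s. f s \<partial>Q)) F"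
    proof (rule tendstoI)
      fix e :: real assume e: "e > 0"
      have b: "f s \<le> B" "- B \<le> f s" for s using B[of s] by auto
      have "eventually (\<lambda>n. (\<integral>s. f s + B \<partial>Q) - e/2 \<le> (\<integral>s. f s + B \<partial>P n)) F"
      proof (rule key[of "\<lambda>s. f s + B" "2 * B"])
        show "0 \<le> f s + B" "f s + B \<le> 2 * B" for s using b[of s] by auto
      qed (use e f in \<open>auto intro!: continuous_intros\<close>)
      moreover have "eventually (\<lambda>n. (\<integral>s. B - f s \<partial>Q) - e/2 \<le> (\<integral>s. B - f s \<partial>P n)) F"
      proof (rule key[of "\<lambda>s. B - f s" "2 * B"])
        show "0 \<le> B - f s" "B - f s \<le> 2 * B" for s using b[of s] by auto
      qed (use e f in \<open>auto intro!: continuous_intros\<close>)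
      ultimately show "eventually (\<lambda>n. dist (\<integral>s. f s \<partial>P n) (\<integral>s. f s \<partial>Q) < e) F"
        using P by eventually_elim (use e in \<open>auto simp: int Q dist_real_def abs_less_iff Q.prob_space\<close>)
    qed
  qed
qed

section \<open>The law of a Galton--Watson tree\<close>

primrec weight :: "nat pmf \<Rightarrow> ftree \<Rightarrow> real" where
  "weight p (Node ts) = pmf p (length ts) * prod_list (map (weight p) ts)"

lemma weight_nonneg: "0 \<le> weight p t"
  by (induction t) (auto intro!: mult_nonneg_nonneg prod_list_nonneg)

section \<open>The generating function of the offspring law\<close>

lemma integrable_offspring: "0 < offspring_mean p \<Longrightarrow> integrable (measure_pmf p) real"
  unfolding offspring_mean_def using not_integrable_integral_eq by fastforce

text \<open>Bernoulli's inequality with strictness. Values x > 1 matter too: they occur as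
  exponential moments of \<open>occ A\<close>.\<close>

lemma one_plus_mult_less_power:
  fixes x :: real
  assumes "0 \<le> x" "x \<noteq> 1" "2 \<le> n"
  shows "1 + real n * (x - 1) < x ^ n"
  using assms(3)
proof (induction n rule: dec_induct)
  case base
  have "0 < (x - 1)\<^sup>2" using assms by simp
  then show ?case by (simp add: power2_eq_square algebra_simps)
next
  case (step n)
  have "1 + real (Suc n) * (x - 1) \<le> x * (1 + real n * (x - 1))"
  proof -
    have "x * (1 + real n * (x - 1)) - (1 + real (Suc n) * (x - 1)) = real n * (x - 1)\<^sup>2"
      by (simp add: power2_eq_square algebra_simps)
    then show ?thesis by (metis diff_ge_0_iff_ge of_nat_0_le_iff zero_le_mult_iff zero_le_power2)
  qed
  also have "x * (1 + real n * (x - 1)) \<le> x * x ^ n"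
    using step.IH assms(1) by (intro mult_left_mono) auto
  finally have le: "1 + real (Suc n) * (x - 1) \<le> x ^ Suc n" by simp
  show ?case
  \<comment> \<open>Multiplication by x is strictly monotone only for x > 0.\<close>
  proof (cases "x = 0")
    case True
    then show ?thesis using step by simp
  next
    case False
    then have "x * (1 + real n * (x - 1)) < x * x ^ n"
      using step.IH assms(1) by (intro mult_strict_left_mono) auto
    moreover have "1 + real (Suc n) * (x - 1) \<le> x * (1 + real n * (x - 1))" by fact
    ultimately show ?thesis by simp
  qed
qed

lemma one_plus_mult_le_power:
  fixes x :: real
  assumes "0 \<le> x"
  shows "1 + real n * (x - 1) \<le> x ^ n"
proof -
  consider "x = 1" | "n = 0" | "n = 1" | "x \<noteq> 1" "2 \<le> n" by linarith
  then show ?thesis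
    using one_plus_mult_less_power[OF assms, of n] by cases auto
qed

text \<open>The power \<open>x ^ k\<close> lies strictly above its tangent at 1 as soon as k is at
  least 2, and \<open>p\<close> charges such a k. Integration of the tangents gives the line of
  slope \<open>offspring_mean p\<close> through (1, 1).\<close>

lemma pgf_greater_line:
  fixes x :: real
  assumes mean: "0 < offspring_mean p" and x: "0 \<le> x" "x \<noteq> 1"
    and int: "integrable (measure_pmf p) (\<lambda>k. x ^ k)" and k: "2 \<le> k" "pmf p k > 0"
  shows "1 + offspring_mean p * (x - 1) < (\<integral>k. x ^ k \<partial>measure_pmf p)"
proof -
  let ?f = "\<lambda>k. x ^ k - (1 + real k * (x - 1))"
  have int1: "integrable (measure_pmf p) (\<lambda>k. 1 + real k * (x - 1))"
    using integrable_offspring[OF mean] by auto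
  have int2: "integrable (measure_pmf p) ?f"
    using int int1 by (rule Bochner_Integration.integrable_diff)
  have "(\<integral>k. ?f k \<partial>measure_pmf p) \<noteq> 0"
  proof
    assume "(\<integral>k. ?f k \<partial>measure_pmf p) = 0"
    then have "AE k in measure_pmf p. ?f k = 0"
      using integral_nonneg_eq_0_iff_AE[OF int2] one_plus_mult_le_power[OF x(1)] by simp
    then have "?f k = 0"
      using k(2) by (auto simp: AE_measure_pmf_iff set_pmf_iff)
    then show False using one_plus_mult_less_power[OF x k(1)] by simp
  qed
  moreover have "(\<integral>k. ?f k \<partial>measure_pmf p) \<ge> 0"
    using one_plus_mult_le_power[OF x(1)] by (intro integral_nonneg_AE) simp
  ultimately have "0 < (\<integral>k. ?f k \<partial>measure_pmf p)" by simp
  also have "\<dots> = (\<integral>k. x ^ k \<partial>measure_pmf p) - (\<integral>k. 1 + real k * (x - 1) \<partial>measure_pmf p)"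
    using int int1 by (rule Bochner_Integration.integral_diff)
  also have "(\<integral>k. 1 + real k * (x - 1) \<partial>measure_pmf p) = 1 + offspring_mean p * (x - 1)"
    using integrable_offspring[OF mean] by (simp add: offspring_mean_def)
  finally show ?thesis by simp
qed

text \<open>If \<open>p\<close> did not charge 0, every offspring number would be at least 1 with
  mean at most 1, hence equal to 1.\<close>

lemma pmf_0_pos:
  assumes mean: "0 < offspring_mean p" "offspring_mean p \<le> 1" and p1: "pmf p 1 \<noteq> 1"
  shows "pmf p 0 > 0"
proof (rule ccontr)
  assume "\<not> pmf p 0 > 0"
  then have 0: "k \<ge> 1" if "k \<in> set_pmf p" for k
    using that pmf_nonneg[of p 0] by (cases k) (auto simp: set_pmf_iff)
  have int: "integrable (measure_pmf p) (\<lambda>k. real k - 1)"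
    using integrable_offspring[OF mean(1)] by auto
  have nn: "AE k in measure_pmf p. 0 \<le> real k - 1"
    using 0 by (auto simp: AE_measure_pmf_iff)
  have "(\<integral>k. real k - 1 \<partial>measure_pmf p) = offspring_mean p - 1"
    using integrable_offspring[OF mean(1)] by (simp add: offspring_mean_def)
  then have "(\<integral>k. real k - 1 \<partial>measure_pmf p) = 0"
    using mean(2) integral_nonneg_AE[OF nn] by simp
  then have "AE k in measure_pmf p. real k - 1 = 0"
    using integral_nonneg_eq_0_iff_AE[OF int nn] by simp
  then have "set_pmf p \<subseteq> {1}" by (auto simp: AE_measure_pmf_iff)
  then have "p = return_pmf 1" by (simp add: set_pmf_subset_singleton)
  then show False using p1 by simp
qed

text \<open>A law on {0, 1} has mean \<open>pmf p 1\<close>, which would have to be 1.\<close>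

lemma ex_pmf_ge_2:
  assumes mean: "offspring_mean p = 1" and p1: "pmf p 1 \<noteq> 1"
  shows "\<exists>k\<ge>2. pmf p k > 0"
proof (rule ccontr)
  assume "\<not> (\<exists>k\<ge>2. pmf p k > 0)"
  then have "k < 2" if "k \<in> set_pmf p" for k
    using that by (meson not_le pmf_positive)
  then have sub: "set_pmf p \<subseteq> {0, 1}"
    by (auto simp: less_2_cases_iff)
  then have "offspring_mean p = pmf p 1"
    unfolding offspring_mean_def by (subst integral_measure_pmf_real[of "{0, 1}"]) auto
  then show False using assms by simp
qed

text \<open>Absence of fixed points in [0, 1). In the critical case the tangent at 1 is the diagonal
  and strictness comes from convexity; in the subcritical case the tangent itself lies strictly
  above the diagonal.\<close>

lemma pgf_greater:
  fixes x :: real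
  assumes mean: "0 < offspring_mean p" "offspring_mean p \<le> 1" and p1: "pmf p 1 \<noteq> 1"
    and x: "0 \<le> x" "x < 1"
  shows "x < (\<integral>k. x ^ k \<partial>measure_pmf p)"
proof -
  have int: "integrable (measure_pmf p) (\<lambda>k. x ^ k)"
    using x by (intro measure_pmf.integrable_const_bound[where B = 1]) (auto simp: power_le_one)
  show ?thesis
  proof (cases "offspring_mean p = 1")
    case True
    then show ?thesis
      using ex_pmf_ge_2[OF True p1] pgf_greater_line[OF mean(1) x(1) _ int] x by auto
  next
    case False
    then have "x < 1 + offspring_mean p * (x - 1)"
      using mean x by (smt (verit) mult_less_cancel_right1 mult_minus_left)
    also have "\<dots> = (\<integral>k. 1 + real k * (x - 1) \<partial>measure_pmf p)"
      using integrable_offspring[OF mean(1)] by (simp add: offspring_mean_def)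
    also have "\<dots> \<le> (\<integral>k. x ^ k \<partial>measure_pmf p)"
      using int integrable_offspring[OF mean(1)] one_plus_mult_le_power[OF x(1)]
      by (intro integral_mono) auto
    finally show ?thesis .
  qed
qed

text \<open>The sequence increases because the generating function exceeds the identity, and its
  limit is a fixed point, which can only be 1. It is applied to the probabilities of extinction by
  height \<open>h\<close>.\<close>

lemma pgf_iterates_tendsto_1:
  fixes a :: "nat \<Rightarrow> real"
  assumes mean: "0 < offspring_mean p" "offspring_mean p \<le> 1" and p1: "pmf p 1 \<noteq> 1"
    and a: "\<And>h. 0 \<le> a h" "\<And>h. a h \<le> 1" and rec: "\<And>h. a (Suc h) = (\<integral>k. a h ^ k \<partial>measure_pmf p)"
  shows "a \<longlonglongrightarrow> 1"
proof -
  have "a h \<le> a (Suc h)" for h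
  proof (cases "a h = 1")
    case True
    then show ?thesis using rec[of h] by simp
  next
    case False
    then show ?thesis
      using pgf_greater[OF mean p1 a(1), of h] a(2)[of h] rec[of h] by simp
  qed
  then have "incseq a" by (rule incseq_SucI)
  then obtain l where l: "a \<longlonglongrightarrow> l"
    using incseq_convergent[of a 1] a(2) by blast
  have l01: "0 \<le> l" "l \<le> 1"
    using LIMSEQ_le_const[OF l] LIMSEQ_le_const2[OF l] a by blast+
  have "(\<lambda>h. \<integral>k. a h ^ k \<partial>measure_pmf p) \<longlonglongrightarrow> (\<integral>k. l ^ k \<partial>measure_pmf p)"
    by (rule integral_dominated_convergence[where w = "\<lambda>_. 1"])
       (use l a in \<open>auto intro!: tendsto_power power_le_one\<close>)
  then have "(\<lambda>h. a (Suc h)) \<longlonglongrightarrow> (\<integral>k. l ^ k \<partial>measure_pmf p)"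
    by (simp add: rec)
  moreover have "(\<lambda>h. a (Suc h)) \<longlonglongrightarrow> l"
    using l by (rule LIMSEQ_Suc)
  ultimately have "(\<integral>k. l ^ k \<partial>measure_pmf p) = l"
    by (rule LIMSEQ_unique)
  then have "l = 1"
    using pgf_greater[OF mean p1 l01(1)] l01 by fastforce
  then show ?thesis using l by simp
qed

text \<open>That \<open>weight p\<close> has total mass 1, as \<open>embed_pmf\<close> requires,
  amounts to almost sure finiteness; see \<open>pmf_gw_pmf\<close>.\<close>

definition gw_pmf :: "nat pmf \<Rightarrow> ftree pmf" where
  "gw_pmf p = embed_pmf (weight p)"

lemma pmf_replicate_pmf:
  "pmf (replicate_pmf n q) xs = of_bool (length xs = n) * prod_list (map (pmf q) xs)"
proof (induction n arbitrary: xs)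
  case 0
  then show ?case by (auto simp: indicator_def)
next
  case (Suc n)
  have "replicate_pmf (Suc n) q = map_pmf (\<lambda>(x, xs). x # xs) (pair_pmf q (replicate_pmf n q))"
    by (simp add: pair_pmf_def map_bind_pmf)
  moreover have "pmf (map_pmf (\<lambda>(x, xs). x # xs) (pair_pmf q (replicate_pmf n q))) xs =
     of_bool (length xs = Suc n) * prod_list (map (pmf q) xs)"
  proof (cases xs)
    case Nil
    then show ?thesis by (subst pmf_map_outside) auto
  next
    case (Cons y ys)
    have inj: "inj (\<lambda>(x::'a, xs). x # xs)" by (auto simp: inj_def)
    show ?thesis
      using pmf_map_inj'[OF inj, of "pair_pmf q (replicate_pmf n q)" "(y, ys)"] Suc Cons
      by (simp add: pmf_pair)
  qed
  ultimately show ?case by simp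
qed

section \<open>From the random variable to a pmf on finite trees\<close>

context
  fixes p :: "nat pmf" and \<Omega> :: "'a measure" and \<tau> :: "'a \<Rightarrow> neveu_tree"
  assumes gw: "galton_watson_tree p \<Omega> \<tau>"
begin

lemma gw_prob_space: "prob_space \<Omega>" and gw_measurable [measurable]: "\<tau> \<in> borel_measurable \<Omega>"
  using gw by (auto simp: galton_watson_tree_def)

interpretation prob_space \<Omega> by (rule gw_prob_space)

lemma prob_out_degree: "prob {\<omega>\<in>space \<Omega>. out_degree (\<tau> \<omega>) [] = n} = pmf p n"
proof -
  have "distr \<Omega> (count_space UNIV) (\<lambda>\<omega>. out_degree (\<tau> \<omega>) []) = measure_pmf p"
    using gw by (simp add: galton_watson_tree_def)
  then have "pmf p n = measure (distr \<Omega> (count_space UNIV) (\<lambda>\<omega>. out_degree (\<tau> \<omega>) [])) {n}"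
    by (simp add: pmf.rep_eq)
  also have "\<dots> = prob {\<omega>\<in>space \<Omega>. out_degree (\<tau> \<omega>) [] = n}"
    by (subst measure_distr) (auto simp: vimage_def Int_def conj_commute)
  finally show ?thesis ..
qed

lemma prob_branches:
  assumes [measurable]: "\<And>i. B i \<in> sets borel"
  shows "prob {\<omega>\<in>space \<Omega>. out_degree (\<tau> \<omega>) [] = n \<and> (\<forall>i\<in>{1..n}. child_subtree i (\<tau> \<omega>) \<in> B i)} =
    pmf p n * (\<Prod>i\<in>{1..n}. prob {\<omega>\<in>space \<Omega>. \<tau> \<omega> \<in> B i})"
proof -
  let ?D = "{\<omega>\<in>space \<Omega>. out_degree (\<tau> \<omega>) [] = n}"
  let ?E = "{\<omega>\<in>space \<Omega>. \<forall>i\<in>{1..n}. child_subtree i (\<tau> \<omega>) \<in> B i}"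
  have DE: "{\<omega>\<in>space \<Omega>. out_degree (\<tau> \<omega>) [] = n \<and> (\<forall>i\<in>{1..n}. child_subtree i (\<tau> \<omega>) \<in> B i)} = ?D \<inter> ?E"
    by auto
  show ?thesis
  \<comment> \<open>For \<open>pmf p n = 0\<close> the definition of a Galton--Watson tree says
    nothing about the branches, but both sides vanish.\<close>
  proof (cases "pmf p n > 0")
    case False
    then have "prob ?D = 0" using prob_out_degree[of n] pmf_nonneg[of p n] by linarith
    moreover have "prob (?D \<inter> ?E) \<le> prob ?D"
      by (intro finite_measure_mono) auto
    ultimately have "prob (?D \<inter> ?E) = 0"
      using measure_nonneg[of \<Omega> "?D \<inter> ?E"] by linarith
    then show ?thesis
      using False pmf_nonneg[of p n] unfolding DE by simp
  next
    case True
    define \<Omega>n where "\<Omega>n = uniform_measure \<Omega> ?D"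
    have ind: "prob_space.indep_vars \<Omega>n (\<lambda>_. borel) (\<lambda>i \<omega>. child_subtree i (\<tau> \<omega>)) {1..n}"
      and law: "\<And>i. i \<in> {1..n} \<Longrightarrow> distr \<Omega>n borel (\<lambda>\<omega>. child_subtree i (\<tau> \<omega>)) = distr \<Omega> borel \<tau>"
      using gw True unfolding galton_watson_tree_def \<Omega>n_def Let_def by blast+
    have pos: "emeasure \<Omega> ?D \<noteq> 0" "emeasure \<Omega> ?D \<noteq> \<infinity>"
      using True prob_out_degree[of n] by (auto simp: emeasure_eq_measure)
    interpret n: prob_space \<Omega>n
      unfolding \<Omega>n_def using pos by (rule prob_space_uniform_measure)
    have [measurable_cong]: "sets \<Omega>n = sets \<Omega>" by (simp add: \<Omega>n_def)
    have [simp]: "space \<Omega>n = space \<Omega>" by (simp add: \<Omega>n_def)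
    have "n.prob ?E = (\<Prod>i\<in>{1..n}. prob {\<omega>\<in>space \<Omega>. \<tau> \<omega> \<in> B i})"
    \<comment> \<open>An intersection over the empty index set would be \<open>UNIV\<close>, so
      \<open>n = 0\<close> is treated apart.\<close>
    proof (cases "n = 0")
      case True
      then show ?thesis using n.prob_space by simp
    next
      case False
      have "?E = (\<Inter>i\<in>{1..n}. (\<lambda>\<omega>. child_subtree i (\<tau> \<omega>)) -` B i \<inter> space \<Omega>n)"
        using False by auto
      also have "n.prob \<dots> = (\<Prod>i\<in>{1..n}. n.prob ((\<lambda>\<omega>. child_subtree i (\<tau> \<omega>)) -` B i \<inter> space \<Omega>n))"
        using False by (intro n.indep_varsD[OF ind]) auto
      also have "\<dots> = (\<Prod>i\<in>{1..n}. prob {\<omega>\<in>space \<Omega>. \<tau> \<omega> \<in> B i})"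
      proof (intro prod.cong refl)
        fix i assume i: "i \<in> {1..n}"
        have "n.prob ((\<lambda>\<omega>. child_subtree i (\<tau> \<omega>)) -` B i \<inter> space \<Omega>n) =
            measure (distr \<Omega>n borel (\<lambda>\<omega>. child_subtree i (\<tau> \<omega>))) (B i)"
          by (subst measure_distr) auto
        also have "\<dots> = prob {\<omega>\<in>space \<Omega>. \<tau> \<omega> \<in> B i}"
          unfolding law[OF i] by (subst measure_distr) (auto simp: vimage_def Int_def conj_commute)
        finally show "n.prob ((\<lambda>\<omega>. child_subtree i (\<tau> \<omega>)) -` B i \<inter> space \<Omega>n) =
          prob {\<omega>\<in>space \<Omega>. \<tau> \<omega> \<in> B i}" .
      qed
      finally show ?thesis .
    qed
    moreover have "n.prob ?E = prob (?D \<inter> ?E) / prob ?D"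
      unfolding \<Omega>n_def using pos by (intro measure_uniform_measure) auto
    ultimately show ?thesis
      unfolding DE using True by (simp add: prob_out_degree field_simps)
  qed
qed

lemma prob_eq_embed: "prob {\<omega>\<in>space \<Omega>. \<tau> \<omega> = to_neveu t} = weight p t"
proof (induction t)
  case (Node ts)
  have "prob {\<omega>\<in>space \<Omega>. \<tau> \<omega> = to_neveu (Node ts)} =
     prob {\<omega>\<in>space \<Omega>. out_degree (\<tau> \<omega>) [] = length ts \<and>
       (\<forall>i\<in>{1..length ts}. child_subtree i (\<tau> \<omega>) \<in> {to_neveu (ts ! (i - 1))})}"
    by (simp only: eq_embed_iff singleton_iff)
  also have "\<dots> = pmf p (length ts) * (\<Prod>i\<in>{1..length ts}. prob {\<omega>\<in>space \<Omega>. \<tau> \<omega> \<in> {to_neveu (ts ! (i - 1))}})"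
    by (rule prob_branches) simp
  also have "(\<Prod>i\<in>{1..length ts}. prob {\<omega>\<in>space \<Omega>. \<tau> \<omega> \<in> {to_neveu (ts ! (i - 1))}}) =
      (\<Prod>i\<in>{1..length ts}. weight p (ts ! (i - 1)))"
    by (intro prod.cong refl) (auto simp: Node)
  also have "\<dots> = (\<Prod>i<length ts. weight p (ts ! i))"
    by (rule prod.reindex_bij_witness[of _ Suc "\<lambda>i. i - 1"]) auto
  also have "\<dots> = prod_list (map (weight p) ts)"
    by (simp add: prod.list_conv_set_nth atLeast0LessThan)
  finally show ?case by simp
qed

text \<open>One iteration of the generating function: split by the root degree k and apply the
  branching property to all k branches. The image under \<open>to_neveu\<close> keeps infinite trees
  out, so that the limit in \<open>h\<close> bounds the probability of finiteness from
  below.\<close>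

lemma prob_height_le_Suc:
  "prob {\<omega>\<in>space \<Omega>. \<tau> \<omega> \<in> to_neveu ` {t. height t \<le> Suc h}} =
    (\<integral>k. prob {\<omega>\<in>space \<Omega>. \<tau> \<omega> \<in> to_neveu ` {t. height t \<le> h}} ^ k \<partial>measure_pmf p)"
proof -
  let ?B = "to_neveu ` {t. height t \<le> h}"
  let ?a = "prob {\<omega>\<in>space \<Omega>. \<tau> \<omega> \<in> ?B}"
  let ?E = "\<lambda>k. {\<omega>\<in>space \<Omega>. out_degree (\<tau> \<omega>) [] = k \<and> (\<forall>i\<in>{1..k}. child_subtree i (\<tau> \<omega>) \<in> ?B)}"
  have iff: "s \<in> to_neveu ` {t. height t \<le> Suc h} \<longleftrightarrow>
      (\<forall>i\<in>{1..out_degree s []}. child_subtree i s \<in> ?B)" for s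
  proof
    assume "s \<in> to_neveu ` {t. height t \<le> Suc h}"
    then obtain t where t: "s = to_neveu t" "height t \<le> Suc h" by auto
    obtain ts where ts: "t = Node ts" by (cases t)
    have "child_subtree i s \<in> ?B" if i: "i \<in> {1..length ts}" for i
    proof -
      have "ts ! (i - 1) \<in> set ts" using i by (intro nth_mem) auto
      then show ?thesis using t i unfolding ts by auto
    qed
    then show "\<forall>i\<in>{1..out_degree s []}. child_subtree i s \<in> ?B"
      by (simp add: t ts)
  next
    assume *: "\<forall>i\<in>{1..out_degree s []}. child_subtree i s \<in> ?B"
    then obtain ts where "s = to_neveu (Node ts)" "set ts \<subseteq> {t. height t \<le> h}"
      using in_embed_image_if_subtrees by blast
    then show "s \<in> to_neveu ` {t. height t \<le> Suc h}"
      using height_le_iff by blast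
  qed
  have "{\<omega>\<in>space \<Omega>. \<tau> \<omega> \<in> to_neveu ` {t. height t \<le> Suc h}} = (\<Union>k. ?E k)"
    unfolding iff by auto
  then have "emeasure \<Omega> {\<omega>\<in>space \<Omega>. \<tau> \<omega> \<in> to_neveu ` {t. height t \<le> Suc h}} =
      (\<integral>\<^sup>+k. emeasure \<Omega> (?E k) \<partial>count_space UNIV)"
    by (simp only:) (intro emeasure_UN_countable, auto simp: disjoint_family_on_def)
  also have "\<dots> = (\<integral>\<^sup>+k. ennreal (pmf p k) * ennreal (?a ^ k) \<partial>count_space UNIV)"
    by (intro nn_integral_cong)
       (simp only: emeasure_eq_measure prob_branches[of "\<lambda>_. ?B", OF sets_borel_embed] prod_constant card_atLeastAtMost,
        simp add: ennreal_mult)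
  also have "\<dots> = (\<integral>\<^sup>+k. ennreal (?a ^ k) \<partial>measure_pmf p)"
    by (simp add: nn_integral_measure_pmf)
  also have "\<dots> = ennreal (\<integral>k. ?a ^ k \<partial>measure_pmf p)"
    by (intro nn_integral_eq_integral measure_pmf.integrable_const_bound[where B = 1])
       (auto intro!: AE_I2 power_le_one)
  finally show ?thesis
    by (simp add: emeasure_eq_measure integral_nonneg)
qed

context
  assumes mean: "0 < offspring_mean p" "offspring_mean p \<le> 1" and p1: "pmf p 1 \<noteq> 1"
begin

lemma prob_finite: "prob {\<omega>\<in>space \<Omega>. \<tau> \<omega> \<in> range to_neveu} = 1"
proof -
  let ?a = "\<lambda>h. prob {\<omega>\<in>space \<Omega>. \<tau> \<omega> \<in> to_neveu ` {t. height t \<le> h}}"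
  have "?a \<longlonglongrightarrow> 1"
    by (rule pgf_iterates_tendsto_1[OF mean p1]) (simp_all add: prob_height_le_Suc)
  moreover have "?a h \<le> prob {\<omega>\<in>space \<Omega>. \<tau> \<omega> \<in> range to_neveu}" for h
    by (intro finite_measure_mono) auto
  ultimately have "1 \<le> prob {\<omega>\<in>space \<Omega>. \<tau> \<omega> \<in> range to_neveu}"
    by (intro LIMSEQ_le_const2) auto
  then show ?thesis by (intro antisym) auto
qed

lemma nn_integral_weight_eq_prob:
  "emeasure \<Omega> {\<omega>\<in>space \<Omega>. \<tau> \<omega> \<in> to_neveu ` X} = (\<integral>\<^sup>+t. ennreal (weight p t) \<partial>count_space X)"
proof -
  have "{\<omega>\<in>space \<Omega>. \<tau> \<omega> \<in> to_neveu ` X} = (\<Union>t\<in>X. {\<omega>\<in>space \<Omega>. \<tau> \<omega> = to_neveu t})"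
    by auto
  then have "emeasure \<Omega> {\<omega>\<in>space \<Omega>. \<tau> \<omega> \<in> to_neveu ` X} =
      (\<integral>\<^sup>+t. emeasure \<Omega> {\<omega>\<in>space \<Omega>. \<tau> \<omega> = to_neveu t} \<partial>count_space X)"
    by (simp only:) (intro emeasure_UN_countable, auto simp: disjoint_family_on_def)
  then show ?thesis
    by (simp add: emeasure_eq_measure prob_eq_embed)
qed

lemma pmf_gw_pmf: "pmf (gw_pmf p) = weight p"
  unfolding gw_pmf_def fun_eq_iff
  using nn_integral_weight_eq_prob[of UNIV] prob_finite
  by (intro allI pmf_embed_pmf) (auto simp: weight_nonneg emeasure_eq_measure)

text \<open>The branching property as a fixed-point equation. The locale \<open>gw_tree_pmf\<close>
  keeps nothing else of the law of \<tau>.\<close>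

lemma gw_pmf_rec: "gw_pmf p = map_pmf Node (bind_pmf p (\<lambda>k. replicate_pmf k (gw_pmf p)))"
proof (rule pmf_eqI)
  fix t
  obtain ts where t: "t = Node ts" by (cases t)
  have inj: "inj Node" by (auto simp: inj_def)
  have "pmf (bind_pmf p (\<lambda>k. replicate_pmf k (gw_pmf p))) ts =
     (\<integral>k. prod_list (map (weight p) ts) * indicator {length ts} k \<partial>measure_pmf p)"
    unfolding pmf_bind
    by (intro Bochner_Integration.integral_cong refl) (auto simp: pmf_replicate_pmf pmf_gw_pmf indicator_def)
  also have "\<dots> = weight p (Node ts)"
    by (simp add: measure_pmf_single)
  finally show "pmf (gw_pmf p) t = pmf (map_pmf Node (bind_pmf p (\<lambda>k. replicate_pmf k (gw_pmf p)))) t"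
    by (simp add: t pmf_map_inj'[OF inj] pmf_gw_pmf)
qed

text \<open>Infinite trees have probability 0, so every event may be evaluated on finite trees
  only.\<close>

lemma prob_eq_gw_pmf:
  assumes [measurable]: "Measurable.pred borel P"
  shows "prob {\<omega>\<in>space \<Omega>. P (\<tau> \<omega>)} = measure_pmf.prob (gw_pmf p) {t. P (to_neveu t)}"
proof -
  have "AE \<omega> in \<Omega>. \<tau> \<omega> \<in> range to_neveu"
    using prob_finite by (subst (asm) prob_Collect_eq_1) auto
  then have "prob {\<omega>\<in>space \<Omega>. P (\<tau> \<omega>)} = prob {\<omega>\<in>space \<Omega>. \<tau> \<omega> \<in> to_neveu ` {t. P (to_neveu t)}}"
    by (intro finite_measure_eq_AE) (auto elim!: eventually_mono)
  also have "ennreal \<dots> = emeasure (measure_pmf (gw_pmf p)) {t. P (to_neveu t)}"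
    by (simp add: nn_integral_weight_eq_prob nn_integral_pmf[symmetric] pmf_gw_pmf flip: emeasure_eq_measure)
  finally show ?thesis
    by (simp add: measure_pmf.emeasure_eq_measure)
qed

lemma prob_cond_law:
  assumes [measurable]: "Measurable.pred borel E"
    and pos: "measure_pmf.prob (gw_pmf p) {t. E (to_neveu t)} > 0"
  shows prob_space_cond_law: "prob_space (cond_law \<Omega> \<tau> E)"
    and sets_cond_law: "sets (cond_law \<Omega> \<tau> E) = sets borel"
    and cond_law_cylinder: "measure (cond_law \<Omega> \<tau> E) {s. tree_trunc h s = to_neveu x} =
      measure_pmf.prob (gw_pmf p) {t. prune h t = x \<and> E (to_neveu t)} /
      measure_pmf.prob (gw_pmf p) {t. E (to_neveu t)}"
proof -
  let ?E = "{\<omega>\<in>space \<Omega>. E (\<tau> \<omega>)}"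
  have pE: "prob ?E = measure_pmf.prob (gw_pmf p) {t. E (to_neveu t)}"
    by (rule prob_eq_gw_pmf) simp
  have pos': "emeasure \<Omega> ?E \<noteq> 0" "emeasure \<Omega> ?E \<noteq> \<infinity>"
    using pos by (auto simp: emeasure_eq_measure pE)
  show "prob_space (cond_law \<Omega> \<tau> E)"
    unfolding cond_law_def
    by (intro prob_space.prob_space_distr prob_space_uniform_measure pos') simp
  show "sets (cond_law \<Omega> \<tau> E) = sets borel" by (simp add: cond_law_def)
  have [measurable]: "{s. tree_trunc h s = to_neveu x} \<in> sets borel"
    by (intro borel_open open_cylinder)
  have [measurable]: "Measurable.pred borel (\<lambda>s. tree_trunc h s = to_neveu x)"
    by (simp add: pred_def)
  have "measure (cond_law \<Omega> \<tau> E) {s. tree_trunc h s = to_neveu x} =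
      measure (uniform_measure \<Omega> ?E) {\<omega>\<in>space \<Omega>. tree_trunc h (\<tau> \<omega>) = to_neveu x}"
    unfolding cond_law_def by (subst measure_distr) (auto simp: vimage_def Int_def conj_commute)
  also have "\<dots> = prob (?E \<inter> {\<omega>\<in>space \<Omega>. tree_trunc h (\<tau> \<omega>) = to_neveu x}) / prob ?E"
    using pos' by (intro measure_uniform_measure) auto
  also have "?E \<inter> {\<omega>\<in>space \<Omega>. tree_trunc h (\<tau> \<omega>) = to_neveu x} =
      {\<omega>\<in>space \<Omega>. tree_trunc h (\<tau> \<omega>) = to_neveu x \<and> E (\<tau> \<omega>)}" by auto
  also have "prob \<dots> = measure_pmf.prob (gw_pmf p) {t. prune h t = x \<and> E (to_neveu t)}"
    by (subst prob_eq_gw_pmf) auto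
  finally show "measure (cond_law \<Omega> \<tau> E) {s. tree_trunc h s = to_neveu x} =
      measure_pmf.prob (gw_pmf p) {t. prune h t = x \<and> E (to_neveu t)} /
      measure_pmf.prob (gw_pmf p) {t. E (to_neveu t)}"
    by (simp add: pE)
qed

end

end

section \<open>The immortal tree\<close>

text \<open>For \<open>t\<close> pruned at height \<open>h\<close>, the mass of its cylinder under
  the Galton--Watson law (see \<open>PT_prune\<close>). Nodes at height \<open>h\<close> contribute
  no factor, since the truncation does not show their out-degrees.\<close>

primrec prune_weight :: "nat pmf \<Rightarrow> nat \<Rightarrow> ftree \<Rightarrow> real" where
  "prune_weight p 0 t = 1"
| "prune_weight p (Suc h) t = pmf p (length (subtrees t)) * prod_list (map (prune_weight p h) (subtrees t))"

lemma prune_weight_nonneg: "0 \<le> prune_weight p h t"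
  by (induction h arbitrary: t) (auto intro!: mult_nonneg_nonneg prod_list_nonneg)

text \<open>The recursive form fits the branching property, the product form the independent
  coordinates from which the immortal tree is built.\<close>

lemma prune_weight_eq_prod:
  "prune_weight p h t = (\<Prod>u\<in>{u. addr u t \<and> length u < h}. pmf p (out_degree (to_neveu t) u))"
proof (induction h arbitrary: t)
  case (Suc h)
  obtain ts where t: "t = Node ts" by (cases t)
  let ?N = "\<lambda>s. {u. addr u s \<and> length u < h}"
  let ?f = "\<lambda>u. pmf p (out_degree (to_neveu t) u)"
  have fin: "finite (?N s)" for s
    by (rule finite_subset[OF _ finite_addr[of s]]) auto
  have *: "{u. addr u t \<and> length u < Suc h} = insert [] (\<Union>i<length ts. Cons (Suc i) ` ?N (ts ! i))" (is "?L = ?R")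
  proof (rule set_eqI)
    fix u
    show "u \<in> ?L \<longleftrightarrow> u \<in> ?R"
    proof (cases u)
      case (Cons i v)
      have "1 \<le> i \<and> i \<le> length ts \<Longrightarrow> \<exists>j<length ts. i = Suc j"
        by (metis Suc_le_D Suc_le_eq One_nat_def)
      then show ?thesis using Cons by (auto 4 4 simp: t)
    qed auto
  qed
  have "prod ?f {u. addr u t \<and> length u < Suc h} =
      ?f [] * prod ?f (\<Union>i<length ts. Cons (Suc i) ` ?N (ts ! i))"
    unfolding * by (rule prod.insert) (use fin in auto)
  also have "prod ?f (\<Union>i<length ts. Cons (Suc i) ` ?N (ts ! i)) =
      (\<Prod>i<length ts. prod ?f (Cons (Suc i) ` ?N (ts ! i)))"
    using fin by (intro prod.UNION_disjoint) auto
  also have "\<dots> = (\<Prod>i<length ts. prune_weight p h (ts ! i))"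
  proof (intro prod.cong refl)
    fix i assume i: "i \<in> {..<length ts}"
    have "prod ?f (Cons (Suc i) ` ?N (ts ! i)) = (\<Prod>u\<in>?N (ts ! i). ?f (Suc i # u))"
      by (subst prod.reindex) (auto simp: inj_on_def)
    also have "\<dots> = (\<Prod>u\<in>?N (ts ! i). pmf p (out_degree (to_neveu (ts ! i)) u))"
      using i by (intro prod.cong refl) (simp add: t out_degree_embed_Cons)
    finally show "prod ?f (Cons (Suc i) ` ?N (ts ! i)) = prune_weight p h (ts ! i)"
      by (simp add: Suc)
  qed
  also have "\<dots> = prod_list (map (prune_weight p h) ts)"
    by (simp add: prod.list_conv_set_nth atLeast0LessThan)
  finally show ?case by (simp add: t)
qed simp

text \<open>An open set is a union of cylinders, and there are only countably many of them.\<close>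

lemma borel_measurable_neveuI:
  assumes "\<And>h x. {\<omega>\<in>space M. tree_trunc h (f \<omega>) = to_neveu x} \<in> sets M"
  shows "f \<in> borel_measurable M"
proof (rule borel_measurableI)
  fix U :: "neveu_tree set" assume U: "open U"
  define J where "J = {(h, x). {s. tree_trunc h s = to_neveu x} \<subseteq> U}"
  have "f \<omega> \<in> U \<longleftrightarrow> (\<exists>(h, x)\<in>J. tree_trunc h (f \<omega>) = to_neveu x)" for \<omega>
  proof
    assume "f \<omega> \<in> U"
    then obtain h where h: "\<And>t. tree_trunc h t = tree_trunc h (f \<omega>) \<Longrightarrow> t \<in> U"
      using ex_cylinder_subset[OF U] by blast
    obtain x where x: "tree_trunc h (f \<omega>) = to_neveu x"
      using tree_trunc_in_range_embed[of h "f \<omega>"] by auto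
    have "(h, x) \<in> J" unfolding J_def using h x by auto
    then show "\<exists>(h, x)\<in>J. tree_trunc h (f \<omega>) = to_neveu x" using x by blast
  qed (auto simp: J_def)
  then have "f -` U \<inter> space M = (\<Union>(h, x)\<in>J. {\<omega>\<in>space M. tree_trunc h (f \<omega>) = to_neveu x})"
    by auto
  also have "\<dots> \<in> sets M"
    using assms by (intro sets.countable_UN'') (auto intro: countableI_type)
  finally show "f -` U \<inter> space M \<in> sets M" .
qed

section \<open>Nodes and spine of the immortal tree\<close>

lemma tree_nodes_of_degrees:
  "tree_nodes (tree_of_degrees d) = {u. \<forall>j<length u. 1 \<le> u ! j \<and> u ! j \<le> d (take j u)}"
  by transfer simp

lemma snoc_in_tree_of_degrees:
  "u @ [i] \<in> tree_nodes (tree_of_degrees d) \<longleftrightarrow>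
     u \<in> tree_nodes (tree_of_degrees d) \<and> 1 \<le> i \<and> i \<le> d u"
  unfolding tree_nodes_of_degrees by (auto simp: less_Suc_eq nth_append)

lemma out_degree_tree_of_degrees:
  "u \<in> tree_nodes (tree_of_degrees d) \<Longrightarrow> out_degree (tree_of_degrees d) u = d u"
  by (rule out_degree_eqI) (auto simp: snoc_in_tree_of_degrees)

lemma immortal_special_snoc:
  "immortal_special \<omega> (u @ [i]) \<longleftrightarrow> immortal_special \<omega> u \<and> i = snd (snd (\<omega> u))"
  unfolding immortal_special_def by (auto simp: less_Suc_eq nth_append)

lemma immortal_special_take: "immortal_special \<omega> v \<Longrightarrow> immortal_special \<omega> (take j v)"
  unfolding immortal_special_def by (auto simp: min_def)

text \<open>The spine is unique: the third coordinate at a special sequence dictates which of its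
  extensions is special.\<close>

lemma immortal_special_unique:
  assumes "immortal_special \<omega> u" "immortal_special \<omega> v" "length u = length v"
  shows "u = v"
  using assms
proof (induction u arbitrary: v rule: rev_induct)
  case (snoc i u)
  then obtain v' j where v: "v = v' @ [j]"
    by (cases v rule: rev_cases) auto
  then show ?case using snoc by (auto simp: immortal_special_snoc)
qed auto

context
  fixes p :: "nat pmf"
  assumes mean: "0 < offspring_mean p"
begin

abbreviation immortal_space :: "(nat list \<Rightarrow> nat \<times> nat \<times> nat) measure" where
  "immortal_space \<equiv> \<Pi>\<^sub>M u\<in>UNIV. measure_pmf (immortal_node_pmf p)"

lemma measurable_coordinate: "(\<lambda>\<omega>. F (\<omega> u)) \<in> measurable immortal_space (count_space UNIV)"
  by (rule measurable_compose[OF measurable_component_singleton[of u]]) auto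

lemma measurable_immortal_tree [measurable]: "immortal_tree \<in> borel_measurable immortal_space"
proof (rule borel_measurable_neveuI)
  fix h x
  have [measurable]: "Measurable.pred immortal_space (\<lambda>\<omega>. immortal_special \<omega> u)" for u
  proof -
    have [measurable]: "Measurable.pred immortal_space (\<lambda>\<omega>. u ! j = snd (snd (\<omega> (take j u))))" for j
      by (rule measurable_coordinate)
    show ?thesis unfolding immortal_special_def by measurable
  qed
  have [measurable]: "Measurable.pred immortal_space (\<lambda>\<omega>. u \<in> tree_nodes (immortal_tree \<omega>))" for u
  proof -
    have [measurable]: "Measurable.pred immortal_space (\<lambda>\<omega>. i \<le> fst (snd (\<omega> v)))"
      "Measurable.pred immortal_space (\<lambda>\<omega>. i \<le> fst (\<omega> v))" for i v
      by (rule measurable_coordinate)+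
    have "u \<in> tree_nodes (immortal_tree \<omega>) \<longleftrightarrow> (\<forall>j<length u. 1 \<le> u ! j \<and>
        (immortal_special \<omega> (take j u) \<longrightarrow> u ! j \<le> fst (snd (\<omega> (take j u)))) \<and>
        (\<not> immortal_special \<omega> (take j u) \<longrightarrow> u ! j \<le> fst (\<omega> (take j u))))" for \<omega>
      unfolding immortal_tree_def tree_nodes_of_degrees by auto
    then show ?thesis by simp
  qed
  have "tree_trunc h s = to_neveu x \<longleftrightarrow> (\<forall>u. (u \<in> tree_nodes s \<and> length u \<le> h) = addr u x)" for s
    unfolding tree_nodes_inject[symmetric] tree_nodes_trunc by auto
  then show "{\<omega>\<in>space immortal_space. tree_trunc h (immortal_tree \<omega>) = to_neveu x} \<in> sets immortal_space"
    by simp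
qed

lemma prob_space_immortal_space: "prob_space immortal_space"
  by (intro prob_space_PiM prob_space_measure_pmf)

lemma prob_space_immortal_tree_law: "prob_space (immortal_tree_law p)"
  unfolding immortal_tree_law_def
  by (intro prob_space.prob_space_distr prob_space_immortal_space measurable_immortal_tree)

lemma sets_immortal_tree_law: "sets (immortal_tree_law p) = sets borel"
  by (simp add: immortal_tree_law_def)

lemma prob_immortal_node_normal: "measure_pmf.prob (immortal_node_pmf p) {z. fst z = d} = pmf p d"
proof -
  have "measure_pmf.prob (immortal_node_pmf p) {z. fst z = d} = pmf (map_pmf fst (immortal_node_pmf p)) d"
    by (simp add: pmf_map vimage_def)
  then show ?thesis by (simp add: immortal_node_pmf_def map_fst_pair_pmf)
qed

text \<open>Size-biasing and the uniform choice of the special child cancel: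
  \<open>d * pmf p d / \<mu>\<close> times \<open>1 / d\<close>. Relative to a normal node, each
  node on the spine contributes the factor \<open>1 / \<mu>\<close>, whichever child continues
  it.\<close>

lemma prob_immortal_node_special:
  assumes "c \<in> {1..d}"
  shows "measure_pmf.prob (immortal_node_pmf p) {z. snd z = (d, c)} = pmf p d / offspring_mean p"
proof -
  have "measure_pmf.prob (immortal_node_pmf p) {z. snd z = (d, c)} = pmf (map_pmf snd (immortal_node_pmf p)) (d, c)"
    by (simp add: pmf_map vimage_def)
  also have "\<dots> = pmf (bind_pmf (size_biased p) (\<lambda>b. map_pmf (\<lambda>c. (b, c)) (pmf_of_set {1..b}))) (d, c)"
    by (simp add: immortal_node_pmf_def map_snd_pair_pmf)
  also have "\<dots> = (\<integral>b. (1 / real d) * indicator {d} b \<partial>measure_pmf (size_biased p))"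
    unfolding pmf_bind
  proof (intro Bochner_Integration.integral_cong refl)
    fix b :: nat
    have inj: "inj (Pair b :: nat \<Rightarrow> _)" by (auto simp: inj_def)
    show "pmf (map_pmf (Pair b) (pmf_of_set {1..b})) (d, c) = (1 / real d) * indicator {d} b"
    proof (cases "b = d")
      case True
      then show ?thesis
        using pmf_map_inj'[OF inj, of "pmf_of_set {1..b}" c] assms by (simp add: pmf_of_set)
    next
      case False
      then show ?thesis by (subst pmf_map_outside) auto
    qed
  qed
  also have "\<dots> = pmf (size_biased p) d / real d"
    by (simp add: measure_pmf_single)
  also have "\<dots> = pmf p d / offspring_mean p"
    using assms mean by (simp add: pmf_size_biased)
  finally show ?thesis .
qed

text \<open>The size-biased law does not charge 0, so a special node always has a child and the
  spine never stops.\<close>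

lemma set_immortal_node_pmf:
  assumes "z \<in> set_pmf (immortal_node_pmf p)"
  shows "snd (snd z) \<in> {1..fst (snd z)}"
proof -
  have "b > 0" if "b \<in> set_pmf (size_biased p)" for b
    using that pmf_size_biased[OF mean, of b] by (cases b) (auto simp: set_pmf_iff)
  then have "set_pmf (pmf_of_set {1..b}) = {1..b}" if "b \<in> set_pmf (size_biased p)" for b
    using that by (intro set_pmf_of_set) (auto simp: Suc_le_eq)
  then show ?thesis
    using assms by (auto simp: immortal_node_pmf_def)
qed

text \<open>
  A union bound over the vertex at which the spine meets level \<open>h\<close>.  (Equality holds, but the
  upper bound suffices, as the limits of the cylinder masses are bounded from below.)
\<close>

lemma immortal_tree_law_cylinder_le:
  assumes x: "prune h x = x"
  shows "measure (immortal_tree_law p) {s. tree_trunc h s = to_neveu x} \<le>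
    real (level h x) / offspring_mean p ^ h * prune_weight p h x"
proof -
  interpret I: prob_space immortal_space by (rule prob_space_immortal_space)
  interpret PP: product_prob_space "\<lambda>_::nat list. measure_pmf (immortal_node_pmf p)" UNIV
    by unfold_locales
  define N where "N = {u. addr u x \<and> length u < h}"
  define V where "V = {v. addr v x \<and> length v = h}"
  define d where "d = out_degree (to_neveu x)"
  \<comment> \<open>The demand on the coordinate at \<open>u\<close> if the spine is to pass through
    \<open>v\<close>: on the way to \<open>v\<close> the special degree and the child leading to
    \<open>v\<close> are prescribed, elsewhere the normal degree.\<close>
  define G where "G v u = (if prefix u v then {z. snd z = (d u, v ! length u)} else {z. fst z = d u})" for u v
  have fin: "finite N" "finite V"
    unfolding N_def V_def by (auto intro: finite_subset[OF _ finite_addr[of x]])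
  have G_prob: "I.prob {\<omega>\<in>space immortal_space. \<forall>u\<in>N. \<omega> u \<in> G v u} =
      prune_weight p h x / offspring_mean p ^ h" if v: "v \<in> V" for v
  proof -
    have pre: "{u\<in>N. prefix u v} = (\<lambda>j. take j v) ` {..<h}"
    proof (intro equalityI subsetI)
      fix u assume u: "u \<in> {u\<in>N. prefix u v}"
      then have "u = take (length u) v" by (auto simp: prefix_def)
      then show "u \<in> (\<lambda>j. take j v) ` {..<h}" using u by (auto simp: N_def)
    next
      fix u assume "u \<in> (\<lambda>j. take j v) ` {..<h}"
      then obtain j where "u = take j v" "j < h" by auto
      then show "u \<in> {u\<in>N. prefix u v}"
        using v addr_append1[of "take j v" "drop j v" x] by (auto simp: N_def V_def take_is_prefix)
    qed
    \<comment> \<open>Each of the \<open>h\<close> proper prefixes of \<open>v\<close> contributes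
      one factor \<open>1 / offspring_mean p\<close>.\<close>
    have card: "card {u\<in>N. prefix u v} = h"
    proof -
      have "inj_on (\<lambda>j. take j v) {..<h}"
      proof (rule inj_onI)
        fix i j assume *: "i \<in> {..<h}" "j \<in> {..<h}" "take i v = take j v"
        have "length (take i v) = i" "length (take j v) = j"
          using *(1,2) v by (simp_all add: V_def)
        then show "i = j" using *(3) by metis
      qed
      then show ?thesis unfolding pre by (simp add: card_image)
    qed
    have "ennreal (I.prob {\<omega>\<in>space immortal_space. \<forall>u\<in>N. \<omega> u \<in> G v u}) =
        (\<Prod>u\<in>N. emeasure (measure_pmf (immortal_node_pmf p)) (G v u))"
      unfolding I.emeasure_eq_measure[symmetric]
      by (rule PP.emeasure_PiM_Collect) (use fin in auto)
    also have "\<dots> = ennreal (\<Prod>u\<in>N. measure_pmf.prob (immortal_node_pmf p) (G v u))"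
      by (simp add: measure_pmf.emeasure_eq_measure prod_ennreal)
    finally have "I.prob {\<omega>\<in>space immortal_space. \<forall>u\<in>N. \<omega> u \<in> G v u} =
        (\<Prod>u\<in>N. measure_pmf.prob (immortal_node_pmf p) (G v u))"
      by (simp add: prod_nonneg)
    also have "\<dots> = (\<Prod>u\<in>N. pmf p (d u) * (if prefix u v then 1 / offspring_mean p else 1))"
    proof (intro prod.cong refl)
      fix u assume u: "u \<in> N"
      show "measure_pmf.prob (immortal_node_pmf p) (G v u) =
        pmf p (d u) * (if prefix u v then 1 / offspring_mean p else 1)"
      proof (cases "prefix u v")
        case True
        then obtain w where w: "v = u @ w" by (auto simp: prefix_def)
        with u v obtain i w' where iw: "w = i # w'" by (cases w) (auto simp: N_def V_def)
        have "addr (u @ [i]) x"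
          using v addr_append1[of "u @ [i]" w' x] by (simp add: V_def w iw)
        then have "v ! length u \<in> {1..d u}"
          using u out_degree_iff[of u "to_neveu x" i] by (simp add: d_def N_def w iw)
        then show ?thesis
          using True prob_immortal_node_special by (simp add: G_def)
      next
        case False
        then show ?thesis by (simp add: G_def prob_immortal_node_normal)
      qed
    qed
    also have "\<dots> = (\<Prod>u\<in>N. pmf p (d u)) * (\<Prod>u\<in>N. if prefix u v then 1 / offspring_mean p else 1)"
      by (rule prod.distrib)
    also have "(\<Prod>u\<in>N. if prefix u v then 1 / offspring_mean p else 1) = (1 / offspring_mean p) ^ h"
      using fin by (simp add: prod.If_cases Int_def card[simplified])
    also have "(\<Prod>u\<in>N. pmf p (d u)) = prune_weight p h x"
      unfolding prune_weight_eq_prod N_def d_def ..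
    finally show ?thesis by (simp add: power_one_over)
  qed
  have G_sets: "{\<omega>\<in>space immortal_space. \<forall>u\<in>N. \<omega> u \<in> G v u} \<in> I.events" for v
  proof -
    have [measurable]: "Measurable.pred immortal_space (\<lambda>\<omega>. \<omega> u \<in> G v u)" for u
      by (rule measurable_coordinate)
    show ?thesis using fin by measurable
  qed
  have cover: "\<exists>v\<in>V. \<forall>u\<in>N. \<omega> u \<in> G v u"
    if \<omega>: "\<And>u. \<omega> u \<in> set_pmf (immortal_node_pmf p)" and eq: "tree_trunc h (immortal_tree \<omega>) = to_neveu x" for \<omega>
  proof -
    define D where "D u = (if immortal_special \<omega> u then fst (snd (\<omega> u)) else fst (\<omega> u))" for u
    have tree: "immortal_tree \<omega> = tree_of_degrees D" unfolding immortal_tree_def D_def ..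
    have eq': "tree_trunc h (immortal_tree \<omega>) = tree_trunc h (to_neveu x)" using eq x by simp
    \<comment> \<open>On the support the special child is an actual child, so the spine reaches
      every height.\<close>
    have spine: "\<exists>v. length v = j \<and> immortal_special \<omega> v \<and> v \<in> tree_nodes (immortal_tree \<omega>)" for j
    proof (induction j)
      case 0
      show ?case by (intro exI[of _ "[]"]) (simp add: immortal_special_def)
    next
      case (Suc j)
      then obtain v where v: "length v = j" "immortal_special \<omega> v" "v \<in> tree_nodes (immortal_tree \<omega>)" by blast
      have "snd (snd (\<omega> v)) \<in> {1..D v}"
        using set_immortal_node_pmf[OF \<omega>[of v]] v(2) by (simp add: D_def)
      then show ?case
        using v by (intro exI[of _ "v @ [snd (snd (\<omega> v))]"]) (simp add: immortal_special_snoc tree snoc_in_tree_of_degrees)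
    qed
    then obtain v where v: "length v = h" "immortal_special \<omega> v" "v \<in> tree_nodes (immortal_tree \<omega>)" by blast
    have "v \<in> V"
      using v local_tree_nodes[OF eq', of v] by (simp add: V_def)
    moreover have "\<omega> u \<in> G v u" if u: "u \<in> N" for u
    proof -
      have un: "u \<in> tree_nodes (immortal_tree \<omega>)"
        using u local_tree_nodes[OF eq', of u] by (simp add: N_def)
      have "D u = d u"
        using u un local_out_degree[OF eq', of u] out_degree_tree_of_degrees[of u D]
        by (simp add: N_def d_def tree)
      show ?thesis
      proof (cases "prefix u v")
        case True
        then have tk: "u = take (length u) v" by (auto simp: prefix_def)
        then have "immortal_special \<omega> u"
          using immortal_special_take[OF v(2), of "length u"] by simp
        moreover have "v ! length u = snd (snd (\<omega> u))"
          using v u tk unfolding immortal_special_def N_def by (metis (mono_tags, lifting) mem_Collect_eq)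
        ultimately show ?thesis
          using \<open>D u = d u\<close> True by (auto simp: G_def D_def prod_eq_iff)
      next
        case False
        have "\<not> immortal_special \<omega> u"
        proof
          assume "immortal_special \<omega> u"
          then have "u = take (length u) v"
            using u v by (intro immortal_special_unique[OF _ immortal_special_take]) (auto simp: N_def)
          then show False using False take_is_prefix[of "length u" v] by simp
        qed
        then show ?thesis
          using \<open>D u = d u\<close> False by (auto simp: G_def D_def)
      qed
    qed
    ultimately show ?thesis by blast
  qed
  have AE: "AE \<omega> in immortal_space. \<forall>u. \<omega> u \<in> set_pmf (immortal_node_pmf p)"
    unfolding AE_all_countable
    by (intro allI AE_PiM_component) (auto simp: prob_space_measure_pmf AE_measure_pmf)
  have "measure (immortal_tree_law p) {s. tree_trunc h s = to_neveu x} =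
      I.prob {\<omega>\<in>space immortal_space. tree_trunc h (immortal_tree \<omega>) = to_neveu x}"
    unfolding immortal_tree_law_def
    by (subst measure_distr)
       (auto simp: vimage_def Int_def conj_commute intro: borel_open open_cylinder measurable_immortal_tree)
  also have "\<dots> \<le> I.prob (\<Union>v\<in>V. {\<omega>\<in>space immortal_space. \<forall>u\<in>N. \<omega> u \<in> G v u})"
    using AE cover G_sets fin by (intro I.finite_measure_mono_AE) (auto elim!: eventually_mono)
  also have "\<dots> \<le> (\<Sum>v\<in>V. I.prob {\<omega>\<in>space immortal_space. \<forall>u\<in>N. \<omega> u \<in> G v u})"
    using fin G_sets by (intro I.finite_measure_subadditive_finite) auto
  also have "\<dots> = real (card V) * (prune_weight p h x / offspring_mean p ^ h)"
    using G_prob by simp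
  also have "card V = level h x"
    unfolding V_def by (rule card_level)
  finally show ?thesis by simp
qed

end

section \<open>Height and maximal out-degree\<close>

lemma prob_replicate_pmf:
  fixes q :: "'a :: countable pmf"
  shows "measure_pmf.prob (replicate_pmf n q) {xs. length xs = n \<and> (\<forall>i<n. P i (xs ! i))} =
    (\<Prod>i<n. measure_pmf.prob q {x. P i x})"
proof (induction n arbitrary: P)
  case 0
  show ?case by simp
next
  case (Suc n)
  have "replicate_pmf (Suc n) q = map_pmf (\<lambda>(x, xs). x # xs) (pair_pmf q (replicate_pmf n q))"
    by (simp add: pair_pmf_def map_bind_pmf)
  moreover have "(\<lambda>(x, xs). x # xs) -` {xs. length xs = Suc n \<and> (\<forall>i<Suc n. P i (xs ! i))} =
      {x. P 0 x} \<times> {xs. length xs = n \<and> (\<forall>i<n. P (Suc i) (xs ! i))}"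
    by (auto simp: less_Suc_eq_0_disj)
  ultimately have "measure_pmf.prob (replicate_pmf (Suc n) q) {xs. length xs = Suc n \<and> (\<forall>i<Suc n. P i (xs ! i))} =
      measure_pmf.prob q {x. P 0 x} * (\<Prod>i<n. measure_pmf.prob q {x. P (Suc i) x})"
    by (simp add: measure_pmf_prob_product Suc[of "\<lambda>i. P (Suc i)"] del: replicate_pmf.simps)
  also have "\<dots> = (\<Prod>i<Suc n. measure_pmf.prob q {x. P i x})"
    by (simp only: prod.lessThan_Suc_shift)
  finally show ?case .
qed

lemma prob_bind_pmf:
  "measure_pmf.prob (bind_pmf q f) X = (\<integral>k. measure_pmf.prob (f k) X \<partial>measure_pmf q)"
proof -
  have "ennreal (measure_pmf.prob (bind_pmf q f) X) = (\<integral>\<^sup>+k. ennreal (measure_pmf.prob (f k) X) \<partial>measure_pmf q)"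
    by (simp flip: measure_pmf.emeasure_eq_measure)
  also have "\<dots> = ennreal (\<integral>k. measure_pmf.prob (f k) X \<partial>measure_pmf q)"
    by (intro nn_integral_eq_integral measure_pmf.integrable_const_bound[where B = 1]) auto
  finally show ?thesis by (simp add: integral_nonneg)
qed

text \<open>Mean value bounds: each term of the sum in the factorisation is at least
  \<open>y ^ (k - 1)\<close>, and at most 1 if \<open>x \<le> 1\<close>. For \<open>k = 0\<close>
  the factor \<open>real k\<close> neutralises the truncated exponent \<open>k - 1\<close>.\<close>

lemma power_diff_bounds:
  fixes x y :: real
  assumes "0 \<le> y" "y \<le> x"
  shows power_diff_ge: "real k * y ^ (k - 1) * (x - y) \<le> x ^ k - y ^ k"
    and power_diff_le: "x \<le> 1 \<Longrightarrow> x ^ k - y ^ k \<le> real k * (x - y)"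
proof -
  have eq: "x ^ k - y ^ k = (x - y) * (\<Sum>i<k. y ^ (k - Suc i) * x ^ i)"
    by (rule power_diff_sumr2)
  have "real k * y ^ (k - 1) = (\<Sum>i<k. y ^ (k - Suc i) * y ^ i)"
    by (simp flip: power_add)
  also have "\<dots> \<le> (\<Sum>i<k. y ^ (k - Suc i) * x ^ i)"
    using assms by (intro sum_mono mult_left_mono power_mono) auto
  finally show "real k * y ^ (k - 1) * (x - y) \<le> x ^ k - y ^ k"
    unfolding eq using assms by (subst mult.commute) (intro mult_left_mono, auto)
  show "x ^ k - y ^ k \<le> real k * (x - y)" if "x \<le> 1"
  proof -
    have "(\<Sum>i<k. y ^ (k - Suc i) * x ^ i) \<le> (\<Sum>i<k. 1 * 1)"
      using assms that by (intro sum_mono mult_mono power_le_one) auto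
    then show ?thesis
      unfolding eq using assms by (subst mult.commute) (intro mult_right_mono, auto)
  qed
qed

lemma prod_list_map_power:
  "prod_list (map (\<lambda>x. f x * (b::real) ^ g x) xs) = prod_list (map f xs) * b ^ sum_list (map g xs)"
  by (induction xs) (auto simp: power_add)

section \<open>Finite Galton--Watson trees given by the fixed-point equation\<close>

locale gw_tree_pmf =
  fixes p :: "nat pmf" and T :: "ftree pmf"
  assumes mean: "0 < offspring_mean p" "offspring_mean p \<le> 1" and p1: "pmf p 1 \<noteq> 1"
    and T_rec: "T = map_pmf Node (bind_pmf p (\<lambda>k. replicate_pmf k T))"
begin

abbreviation PT :: "(ftree \<Rightarrow> bool) \<Rightarrow> real" where
  "PT P \<equiv> measure_pmf.prob T {t. P t}"

lemma PT_mono: "(\<And>t. P t \<Longrightarrow> Q t) \<Longrightarrow> PT P \<le> PT Q"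
  by (intro measure_pmf.finite_measure_mono) auto

lemma PT_rec: "PT P = (\<integral>k. measure_pmf.prob (replicate_pmf k T) {ts. P (Node ts)} \<partial>measure_pmf p)"
proof -
  have "PT P = measure_pmf.prob (map_pmf Node (bind_pmf p (\<lambda>k. replicate_pmf k T))) {t. P t}"
    using T_rec by simp
  then show ?thesis by (simp add: prob_bind_pmf vimage_def)
qed

lemma AE_length_replicate: "measure_pmf.prob (replicate_pmf k T) {ts. P ts} =
    measure_pmf.prob (replicate_pmf k T) {ts. length ts = k \<and> P ts}"
  by (intro measure_pmf.finite_measure_eq_AE) (auto simp: AE_measure_pmf_iff set_replicate_pmf)

text \<open>\<open>P\<close> depends on the index, so that one branch can be treated differently
  from the others.\<close>

lemma PT_branches:
  "PT (\<lambda>t. length (subtrees t) = n \<and> (\<forall>i<n. P i (subtrees t ! i))) = pmf p n * (\<Prod>i<n. PT (P i))"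
proof -
  have "PT (\<lambda>t. length (subtrees t) = n \<and> (\<forall>i<n. P i (subtrees t ! i))) =
    (\<integral>k. (\<Prod>i<n. PT (P i)) * indicator {n} k \<partial>measure_pmf p)"
    unfolding PT_rec[of "\<lambda>t. length (subtrees t) = n \<and> (\<forall>i<n. P i (subtrees t ! i))"] ftree.sel
  proof (intro Bochner_Integration.integral_cong refl)
    fix k
    show "measure_pmf.prob (replicate_pmf k T) {ts. length ts = n \<and> (\<forall>i<n. P i (ts ! i))} =
        (\<Prod>i<n. PT (P i)) * indicator {n} k"
    proof (cases "k = n")
      case True
      then show ?thesis by (simp add: prob_replicate_pmf)
    next
      case False
      then show ?thesis by (subst AE_length_replicate) (simp cong: conj_cong)
    qed
  qed
  then show ?thesis by (simp add: measure_pmf_single)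
qed

lemma pmf_Node: "pmf T (Node ts) = pmf p (length ts) * prod_list (map (pmf T) ts)"
proof -
  have "pmf T (Node ts) = PT (\<lambda>t. length (subtrees t) = length ts \<and> (\<forall>i<length ts. subtrees t ! i = ts ! i))"
  proof -
    have "{t. length (subtrees t) = length ts \<and> (\<forall>i<length ts. subtrees t ! i = ts ! i)} = {Node ts}"
      by (auto simp: list_eq_iff_nth_eq intro: ftree.expand)
    then show ?thesis by (simp add: measure_pmf_single)
  qed
  also have "\<dots> = pmf p (length ts) * (\<Prod>i<length ts. pmf T (ts ! i))"
    by (subst PT_branches) (simp add: measure_pmf_single)
  finally show ?thesis
    by (simp add: prod.list_conv_set_nth atLeast0LessThan)
qed

text \<open>
  \<open>P h t\<close> says that all subtrees of \<open>t\<close> at height \<open>h\<close> satisfy \<open>P 0\<close> and that the out-degrees below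
  height \<open>h\<close> satisfy \<open>c\<close>.
\<close>

lemma PT_prune_and:
  assumes P: "\<And>h t. P (Suc h) t \<longleftrightarrow> c (length (subtrees t)) \<and> (\<forall>s\<in>set (subtrees t). P h s)"
    and "prune h x = x" "\<And>k. k \<le> maxdeg x \<Longrightarrow> c k"
  shows "PT (\<lambda>t. prune h t = x \<and> P h t) = prune_weight p h x * PT (P 0) ^ level h x"
  using assms(2,3)
proof (induction h arbitrary: x)
  case 0
  then have "x = Node []" by simp
  then show ?case by simp
next
  case (Suc h)
  obtain ys where x: "x = Node ys" by (cases x)
  have y: "map (prune h) ys = ys" using Suc.prems(1) by (simp add: x)
  have c: "c (length ys)" using Suc.prems(2) by (simp add: x)
  have "(prune (Suc h) t = x \<and> P (Suc h) t) \<longleftrightarrow> (length (subtrees t) = length ys \<and>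
      (\<forall>i<length ys. prune h (subtrees t ! i) = ys ! i \<and> P h (subtrees t ! i)))" for t
    using c by (auto simp: x P list_eq_iff_nth_eq all_set_conv_all_nth)
  then have "PT (\<lambda>t. prune (Suc h) t = x \<and> P (Suc h) t) = PT (\<lambda>t. length (subtrees t) = length ys \<and>
      (\<forall>i<length ys. prune h (subtrees t ! i) = ys ! i \<and> P h (subtrees t ! i)))"
    by (simp only:)
  also have "\<dots> = pmf p (length ys) * (\<Prod>i<length ys. PT (\<lambda>t. prune h t = ys ! i \<and> P h t))"
    by (rule PT_branches)
  also have "(\<Prod>i<length ys. PT (\<lambda>t. prune h t = ys ! i \<and> P h t)) =
      (\<Prod>i<length ys. prune_weight p h (ys ! i) * PT (P 0) ^ level h (ys ! i))"
  proof (intro prod.cong refl Suc.IH)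
    fix i assume i: "i \<in> {..<length ys}"
    show "prune h (ys ! i) = ys ! i" using y i by (metis lessThan_iff nth_map)
    fix k assume "k \<le> maxdeg (ys ! i)"
    also have "\<dots> \<le> maxdeg x" using i by (auto simp: x intro!: Max_ge)
    finally show "c k" by (rule Suc.prems(2))
  qed
  also have "\<dots> = prod_list (map (\<lambda>y. prune_weight p h y * PT (P 0) ^ level h y) ys)"
    by (simp add: prod.list_conv_set_nth atLeast0LessThan)
  also have "\<dots> = prod_list (map (prune_weight p h) ys) * PT (P 0) ^ sum_list (map (level h) ys)"
    by (rule prod_list_map_power)
  finally show ?case by (simp add: x)
qed

lemma PT_prune: "prune h x = x \<Longrightarrow> PT (\<lambda>t. prune h t = x) = prune_weight p h x"
  using PT_prune_and[of "\<lambda>_ _. True" "\<lambda>_. True" h x] by simp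

lemma PT_tendsto_1:
  assumes "\<And>t. P (f t) t" "\<And>m n t. m \<le> n \<Longrightarrow> P m t \<Longrightarrow> P n t"
  shows "(\<lambda>n. PT (P n)) \<longlonglongrightarrow> 1"
proof -
  have "(\<lambda>n. PT (P n)) \<longlonglongrightarrow> measure_pmf.prob T (\<Union>n. {t. P n t})"
    by (rule measure_pmf.finite_Lim_measure_incseq) (auto simp: incseq_def assms(2))
  also have "(\<Union>n. {t. P n t}) = UNIV" using assms(1) by auto
  finally show ?thesis by simp
qed

lemma PT_prune_and_tendsto:
  assumes "\<And>t. P (f t) t" "\<And>m n t. m \<le> n \<Longrightarrow> P m t \<Longrightarrow> P n t" and x: "prune h x = x"
  shows "(\<lambda>n. PT (\<lambda>t. prune h t = x \<and> P n t)) \<longlonglongrightarrow> prune_weight p h x"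
proof -
  have "(\<lambda>n. PT (\<lambda>t. prune h t = x \<and> P n t)) \<longlonglongrightarrow> measure_pmf.prob T (\<Union>n. {t. prune h t = x \<and> P n t})"
    by (rule measure_pmf.finite_Lim_measure_incseq) (auto simp: incseq_def assms(2))
  also have "(\<Union>n. {t. prune h t = x \<and> P n t}) = {t. prune h t = x}" using assms(1) by auto
  finally show ?thesis by (simp add: PT_prune[OF x])
qed

lemma PT_le_and_eq_Suc:
  "PT (\<lambda>t. Q t \<and> f t \<le> Suc n) = PT (\<lambda>t. Q t \<and> f t \<le> n) + PT (\<lambda>t. Q t \<and> f t = Suc n)"
    for f :: "ftree \<Rightarrow> nat"
  by (subst measure_pmf.finite_measure_Union[symmetric]) (auto intro: arg_cong[where f = "measure_pmf.prob T"])

text \<open>In the limit, conditioning on \<open>E n\<close> multiplies the mass of \<open>x\<close> by \<open>level h x / \<mu>\<^sup>h\<close> at least.\<close>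

definition spine_bound :: "(nat \<Rightarrow> ftree \<Rightarrow> bool) \<Rightarrow> nat filter \<Rightarrow> bool" where
  "spine_bound E F \<longleftrightarrow> (\<forall>h x c. prune h x = x \<longrightarrow>
     c < real (level h x) / offspring_mean p ^ h * prune_weight p h x \<longrightarrow>
     (\<forall>\<^sub>F n in F. c * PT (E n) \<le> PT (\<lambda>t. prune h t = x \<and> E n t)))"

text \<open>Given the truncation \<open>x\<close>, height at most \<open>n + h\<close> means that
  all \<open>k = level h x\<close> branches above height h have height at most n; this has mass
  \<open>prune_weight p h x * a n ^ k\<close>. Differences in n produce the factor
  \<open>k * a n ^ (k - 1)\<close>, which tends to k, and the comparison of \<open>r (Suc n)\<close>
  with \<open>r (Suc (h + n))\<close> produces the power of the mean.\<close>

lemma spine_bound_height: "spine_bound (\<lambda>n t. height t = n) sequentially"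
  unfolding spine_bound_def
proof (intro allI impI)
  fix h x c assume x: "prune h x = x" and c: "c < real (level h x) / offspring_mean p ^ h * prune_weight p h x"
  define a where "a n = PT (\<lambda>t. height t \<le> n)" for n
  define r where "r n = PT (\<lambda>t. height t = n)" for n
  define k where "k = level h x"
  have a_Suc: "a (Suc n) = a n + r (Suc n)" for n
    using PT_le_and_eq_Suc[of "\<lambda>_. True" height n] by (simp add: a_def r_def)
  have a01: "0 \<le> a n" "a n \<le> 1" for n by (auto simp: a_def)
  have a_mono: "a n \<le> a (Suc n)" for n
    by (simp add: a_Suc r_def)
  have a_rec: "a (Suc n) = (\<integral>k. a n ^ k \<partial>measure_pmf p)" for n
    unfolding a_def PT_rec[of "\<lambda>t. height t \<le> Suc n"] height_le_iff
    using prob_replicate_pmf[of _ T "\<lambda>_ t. height t \<le> n"]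
    by (subst AE_length_replicate) (auto simp: all_set_conv_all_nth cong: conj_cong intro!: Bochner_Integration.integral_cong)
  have int: "integrable (measure_pmf p) (\<lambda>k. a n ^ k)" for n
    using a01 by (intro measure_pmf.integrable_const_bound[where B = 1]) (auto simp: power_le_one)
  \<comment> \<open>Indices start at \<open>Suc n\<close>, because \<open>r\<close> is a difference
    of values of \<open>a\<close> only at positive arguments.\<close>
  have r_Suc: "r (Suc (Suc n)) \<le> offspring_mean p * r (Suc n)" for n
  proof -
    have "r (Suc (Suc n)) = a (Suc (Suc n)) - a (Suc n)" by (simp add: a_Suc)
    also have "\<dots> = (\<integral>k. a (Suc n) ^ k - a n ^ k \<partial>measure_pmf p)"
      unfolding a_rec[of "Suc n"] a_rec[of n] using int[of "Suc n"] int[of n] by (simp add: a_rec)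
    also have "\<dots> \<le> (\<integral>k. real k * (a (Suc n) - a n) \<partial>measure_pmf p)"
      using integrable_offspring[OF mean(1)] int a01 a_mono
      by (intro integral_mono power_diff_le) auto
    also have "\<dots> = offspring_mean p * r (Suc n)"
      by (simp add: offspring_mean_def a_Suc)
    finally show ?thesis .
  qed
  have r_add: "r (Suc (h + n)) \<le> offspring_mean p ^ h * r (Suc n)" for h n
  proof (induction h)
    case (Suc h)
    have "r (Suc (Suc h + n)) \<le> offspring_mean p * r (Suc (h + n))" using r_Suc[of "h + n"] by simp
    also have "\<dots> \<le> offspring_mean p * (offspring_mean p ^ h * r (Suc n))"
      using Suc mean by (intro mult_left_mono) auto
    finally show ?case by (simp add: mult.assoc)
  qed simp
  have le: "PT (\<lambda>t. prune h t = x \<and> height t \<le> n + h) = prune_weight p h x * a n ^ k" for n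
    unfolding a_def k_def
    using PT_prune_and[of "\<lambda>h t. height t \<le> n + h" "\<lambda>_. True" h x] x height_le_iff[of "subtrees _"]
    by simp
  have lower: "real k * a n ^ (k - 1) * prune_weight p h x / offspring_mean p ^ h * r (Suc (h + n))
      \<le> PT (\<lambda>t. prune h t = x \<and> height t = Suc (h + n))" for n
  proof -
    have "real k * a n ^ (k - 1) * prune_weight p h x / offspring_mean p ^ h * r (Suc (h + n))
       \<le> real k * a n ^ (k - 1) * prune_weight p h x / offspring_mean p ^ h * (offspring_mean p ^ h * r (Suc n))"
      using r_add mean a01 prune_weight_nonneg by (intro mult_left_mono) auto
    also have "\<dots> = prune_weight p h x * (real k * a n ^ (k - 1) * (a (Suc n) - a n))"
      using mean by (simp add: a_Suc)
    also have "\<dots> \<le> prune_weight p h x * (a (Suc n) ^ k - a n ^ k)"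
      using a01 a_mono prune_weight_nonneg by (intro mult_left_mono power_diff_ge) auto
    also have "\<dots> = PT (\<lambda>t. prune h t = x \<and> height t \<le> Suc n + h) - PT (\<lambda>t. prune h t = x \<and> height t \<le> n + h)"
      unfolding le by (simp add: algebra_simps)
    also have "\<dots> = PT (\<lambda>t. prune h t = x \<and> height t = Suc (h + n))"
      using PT_le_and_eq_Suc[of "\<lambda>t. prune h t = x" height "n + h"] by (simp add: add.commute)
    finally show ?thesis .
  qed
  have "a \<longlonglongrightarrow> 1"
    unfolding a_def by (rule PT_tendsto_1[of _ height]) auto
  then have "(\<lambda>n. real k * a n ^ (k - 1) * prune_weight p h x / offspring_mean p ^ h) \<longlonglongrightarrow>
      real k * 1 ^ (k - 1) * prune_weight p h x / offspring_mean p ^ h"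
    using mean by (intro tendsto_intros) auto
  then have "\<forall>\<^sub>F n in sequentially. c < real k * a n ^ (k - 1) * prune_weight p h x / offspring_mean p ^ h"
    using c by (intro order_tendstoD(1)) (auto simp: k_def)
  then have "\<forall>\<^sub>F n in sequentially. c * r (n + Suc h) \<le> PT (\<lambda>t. prune h t = x \<and> height t = n + Suc h)"
  proof eventually_elim
    case (elim n)
    then have "c * r (Suc (h + n)) \<le> real k * a n ^ (k - 1) * prune_weight p h x / offspring_mean p ^ h * r (Suc (h + n))"
      by (intro mult_right_mono) (auto simp: r_def)
    also note lower
    finally show ?case by (simp add: add.commute)
  qed
  then show "\<forall>\<^sub>F n in sequentially. c * PT (\<lambda>t. height t = n) \<le> PT (\<lambda>t. prune h t = x \<and> height t = n)"
    unfolding r_def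
    by (rule eventually_sequentially_seg[of "\<lambda>n. c * PT (\<lambda>t. height t = n) \<le> PT (\<lambda>t. prune h t = x \<and> height t = n)" "Suc h", THEN iffD1])
qed

text \<open>Once n is at least \<open>maxdeg x\<close>, the out-degrees below height h are no
  constraint and the maximum is decided by the \<open>level h x\<close> branches, whose distribution
  function enters as a power. In contrast to the height, n is not shifted.\<close>

lemma spine_bound_maxdeg:
  assumes "offspring_mean p = 1"
  shows "spine_bound (\<lambda>n t. maxdeg t = n) sequentially"
  unfolding spine_bound_def
proof (intro allI impI)
  fix h x c assume x: "prune h x = x" and c: "c < real (level h x) / offspring_mean p ^ h * prune_weight p h x"
  define b where "b n = PT (\<lambda>t. maxdeg t \<le> n)" for n
  define k where "k = level h x"
  have b_Suc: "b (Suc n) = b n + PT (\<lambda>t. maxdeg t = Suc n)" for n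
    using PT_le_and_eq_Suc[of "\<lambda>_. True" maxdeg n] by (simp add: b_def)
  have b0: "0 \<le> b n" for n by (simp add: b_def)
  have b_mono: "b n \<le> b (Suc n)" for n by (simp add: b_Suc)
  have le: "PT (\<lambda>t. prune h t = x \<and> maxdeg t \<le> n) = prune_weight p h x * b n ^ k" if "maxdeg x \<le> n" for n
  proof -
    have "maxdeg t \<le> n \<longleftrightarrow> length (subtrees t) \<le> n \<and> (\<forall>s\<in>set (subtrees t). maxdeg s \<le> n)" for t
      by (cases t) simp
    from PT_prune_and[of "\<lambda>_ t. maxdeg t \<le> n", OF this x] that show ?thesis
      unfolding b_def k_def by (meson order_trans)
  qed
  have "b \<longlonglongrightarrow> 1"
    unfolding b_def by (rule PT_tendsto_1[of _ maxdeg]) auto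
  then have "(\<lambda>n. real k * b n ^ (k - 1) * prune_weight p h x) \<longlonglongrightarrow> real k * 1 ^ (k - 1) * prune_weight p h x"
    by (intro tendsto_intros)
  then have "\<forall>\<^sub>F n in sequentially. c < real k * b n ^ (k - 1) * prune_weight p h x"
    using c assms by (intro order_tendstoD(1)) (auto simp: k_def)
  then have "\<forall>\<^sub>F n in sequentially. c * PT (\<lambda>t. maxdeg t = Suc n) \<le> PT (\<lambda>t. prune h t = x \<and> maxdeg t = Suc n)"
    using eventually_ge_at_top[of "maxdeg x"]
  proof eventually_elim
    case (elim n)
    have "c * PT (\<lambda>t. maxdeg t = Suc n) \<le> real k * b n ^ (k - 1) * prune_weight p h x * PT (\<lambda>t. maxdeg t = Suc n)"
      using elim by (intro mult_right_mono) auto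
    also have "\<dots> = prune_weight p h x * (real k * b n ^ (k - 1) * (b (Suc n) - b n))"
      by (simp add: b_Suc)
    also have "\<dots> \<le> prune_weight p h x * (b (Suc n) ^ k - b n ^ k)"
      using b0 b_mono prune_weight_nonneg by (intro mult_left_mono power_diff_ge) auto
    also have "\<dots> = PT (\<lambda>t. prune h t = x \<and> maxdeg t \<le> Suc n) - PT (\<lambda>t. prune h t = x \<and> maxdeg t \<le> n)"
      using elim by (simp add: le algebra_simps)
    also have "\<dots> = PT (\<lambda>t. prune h t = x \<and> maxdeg t = Suc n)"
      using PT_le_and_eq_Suc[of "\<lambda>t. prune h t = x" maxdeg n] by simp
    finally show ?case .
  qed
  then show "\<forall>\<^sub>F n in sequentially. c * PT (\<lambda>t. maxdeg t = n) \<le> PT (\<lambda>t. prune h t = x \<and> maxdeg t = n)"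
    by (rule eventually_sequentially_Suc[of "\<lambda>n. c * PT (\<lambda>t. maxdeg t = n) \<le> PT (\<lambda>t. prune h t = x \<and> maxdeg t = n)", THEN iffD1])
qed

end

section \<open>Width\<close>

context gw_tree_pmf
begin

lemma pmf_leaf_pos: "pmf T (Node []) > 0"
  using pmf_0_pos[OF mean p1] by (simp add: pmf_Node)

lemma pmf_star_pos: "pmf p d > 0 \<Longrightarrow> pmf T (Node (replicate d (Node []))) > 0"
  using pmf_leaf_pos by (subst pmf_Node) simp

lemma maxdeg_le_of_set_pmf:
  assumes "set_pmf p \<subseteq> {..d}" "t \<in> set_pmf T"
  shows "maxdeg t \<le> d"
  using assms(2)
proof (induction t)
  case (Node ts)
  have "pmf p (length ts) \<noteq> 0" "prod_list (map (pmf T) ts) \<noteq> 0"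
    using Node.prems by (auto simp: set_pmf_iff pmf_Node)
  then have "length ts \<in> set_pmf p" "\<And>s. s \<in> set ts \<Longrightarrow> s \<in> set_pmf T"
    by (auto simp: set_pmf_iff prod_list_zero_iff)
  then show ?case using Node.IH assms(1) by auto
qed

lemma PT_and_maxdeg:
  assumes "set_pmf p \<subseteq> {..d}"
  shows "PT P = PT (\<lambda>t. P t \<and> maxdeg t \<le> d)"
  using maxdeg_le_of_set_pmf[OF assms]
  by (intro measure_pmf.finite_measure_eq_AE) (auto simp: AE_measure_pmf_iff)

end

lemma level_le_power: "maxdeg t \<le> d \<Longrightarrow> level b t \<le> d ^ b"
proof (induction b arbitrary: t)
  case (Suc b)
  obtain ts where t: "t = Node ts" by (cases t)
  have "sum_list (map (level b) ts) \<le> sum_list (map (\<lambda>_. d ^ b) ts)"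
    using Suc by (intro sum_list_mono) (auto simp: t)
  also have "\<dots> \<le> d * d ^ b"
    using Suc.prems by (simp add: t sum_list_triv)
  finally show ?case by (simp add: t)
qed simp

definition width_is :: "nat \<Rightarrow> ftree \<Rightarrow> bool" where
  "width_is n t \<longleftrightarrow> (\<forall>b. level b t \<le> n) \<and> (\<exists>b. level b t = n)"

lemma ex_width_is: "\<exists>n. width_is n t"
  unfolding width_is_def by (rule ex_max_level)

text \<open>
  If one branch has width \<open>n\<close> and the others have height at most \<open>m\<close>, then for large \<open>n\<close> the tree
  has width \<open>n\<close>: since out-degrees are bounded, level \<open>n\<close> is reached above height \<open>m\<close>.
\<close>

lemma width_is_of_branch:
  assumes d: "1 \<le> d" and i: "i < length ts" and wd: "width_is n (ts ! i)"
    and deg: "\<And>j. j < length ts \<Longrightarrow> maxdeg (ts ! j) \<le> d"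
    and ht: "\<And>j. j < length ts \<Longrightarrow> j \<noteq> i \<Longrightarrow> height (ts ! j) \<le> m"
    and n: "length ts * d ^ m < n"
  shows "width_is n (Node ts)"
proof -
  have low: "level b t \<le> d ^ m" if "b \<le> m" "maxdeg t \<le> d" for b t
    using level_le_power[OF that(2), of b] power_increasing[OF that(1), of d] d by auto
  have len: "1 \<le> length ts" using i by auto
  then have dm: "d ^ m < n" using n by (metis (no_types) le_less_trans mult_le_mono1 nat_mult_1)
  have sum: "level (Suc b) (Node ts) = (\<Sum>j<length ts. level b (ts ! j))" for b
    by (simp add: sum_list_sum_nth atLeast0LessThan)
  have high: "level (Suc b) (Node ts) = level b (ts ! i)" if "m < b" for b
  proof -
    have "(\<Sum>j<length ts. level b (ts ! j)) = (\<Sum>j<length ts. if j = i then level b (ts ! i) else 0)"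
    proof (intro sum.cong refl)
      fix j assume "j \<in> {..<length ts}"
      then show "level b (ts ! j) = (if j = i then level b (ts ! i) else 0)"
        using ht[of j] that by (auto intro: level_eq_0)
    qed
    then show ?thesis unfolding sum using i by simp
  qed
  have "level b (Node ts) \<le> n" for b
  proof (cases b)
    case 0
    then show ?thesis using dm by simp
  next
    case (Suc b')
    show ?thesis
    proof (cases "b' \<le> m")
      case True
      have "(\<Sum>j<length ts. level b' (ts ! j)) \<le> (\<Sum>j<length ts. d ^ m)"
        using low[OF True] deg by (intro sum_mono) auto
      then show ?thesis unfolding Suc sum using n by simp
    next
      case False
      then show ?thesis unfolding Suc using high[of b'] wd by (simp add: width_is_def)
    qed
  qed
  moreover obtain b where b: "level b (ts ! i) = n"
    using wd by (auto simp: width_is_def)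
  have "m < b"
    using low[of b "ts ! i"] deg[OF i] b dm by (metis not_le)
  then have "level (Suc b) (Node ts) = n" using high b by simp
  ultimately show ?thesis unfolding width_is_def by blast
qed

context gw_tree_pmf
begin

text \<open>Induction on the height, splitting at the root. The events that branch i has width n
  while all others have height at most m are disjoint for large n, and each forces width n. Their
  masses add up, just as the levels of the branches add up to
  \<open>level (Suc h) x\<close>.\<close>

lemma spine_bound_width:
  assumes mean1: "offspring_mean p = 1" and d: "set_pmf p \<subseteq> {..d}" "1 \<le> d"
  shows "spine_bound width_is sequentially"
proof -
  define w where "w n = PT (width_is n)" for n
  have w_nonneg: "0 \<le> w n" for n by (simp add: w_def)
  have "\<forall>\<^sub>F n in sequentially. c * w n \<le> PT (\<lambda>t. prune h t = x \<and> width_is n t)"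
    if "prune h x = x" "c < real (level h x) * prune_weight p h x" for h x c
    using that
  proof (induction h arbitrary: x c)
    case 0
    then have "x = Node []" "c < 1" by simp_all
    moreover have "c * w n \<le> 1 * w n" if "c < 1" for n
      using that w_nonneg[of n] by (intro mult_right_mono) auto
    ultimately show ?case by (simp add: w_def)
  next
    case (Suc h)
    obtain ys where x: "x = Node ys" by (cases x)
    define k where "k = length ys"
    have y: "prune h (ys ! i) = ys ! i" if "i < k" for i
      using Suc.prems(1) that by (simp add: x k_def list_eq_iff_nth_eq)
    define Y where "Y i = real (level h (ys ! i))" for i
    define \<pi> where "\<pi> i = prune_weight p h (ys ! i)" for i
    define q where "q j m = PT (\<lambda>t. prune h t = ys ! j \<and> height t \<le> m)" for j m
    \<comment> \<open>The term \<open>inverse (real (Suc m))\<close> creates the strict inequality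
      demanded by the induction hypothesis; it disappears in the limit together with the restriction
      on the heights.\<close>
    define \<phi> where "\<phi> m = (\<Sum>i<k. pmf p k * ((Y i * \<pi> i - inverse (real (Suc m))) * (\<Prod>j\<in>{..<k} - {i}. q j m)))" for m
    have q: "(\<lambda>m. q j m) \<longlonglongrightarrow> \<pi> j" if "j < k" for j
      unfolding q_def \<pi>_def using y[OF that] by (intro PT_prune_and_tendsto[of _ height]) auto
    have "\<phi> \<longlonglongrightarrow> (\<Sum>i<k. pmf p k * ((Y i * \<pi> i - 0) * (\<Prod>j\<in>{..<k} - {i}. \<pi> j)))"
      unfolding \<phi>_def by (intro tendsto_intros LIMSEQ_inverse_real_of_nat q) auto
    also have "(\<Sum>i<k. pmf p k * ((Y i * \<pi> i - 0) * (\<Prod>j\<in>{..<k} - {i}. \<pi> j))) =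
        (\<Sum>i<k. Y i * (pmf p k * (\<Prod>j<k. \<pi> j)))"
      by (intro sum.cong refl) (simp add: prod.remove[of "{..<k}" _ \<pi>])
    also have "\<dots> = real (level (Suc h) x) * prune_weight p (Suc h) x"
      by (simp add: x Y_def \<pi>_def k_def sum_list_sum_nth prod.list_conv_set_nth atLeast0LessThan
          flip: sum_distrib_right)
    finally have "\<forall>\<^sub>F m in sequentially. c < \<phi> m"
      using Suc.prems(2) by (rule order_tendstoD(1))
    then obtain m where m: "c < \<phi> m"
      unfolding eventually_sequentially by blast
    have "\<forall>\<^sub>F n in sequentially. \<forall>i\<in>{..<k}. (Y i * \<pi> i - inverse (real (Suc m))) * w n \<le>
        PT (\<lambda>t. prune h t = ys ! i \<and> width_is n t)"
    proof (subst eventually_ball_finite_distrib, simp, intro ballI Suc.IH)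
      fix i assume "i \<in> {..<k}"
      then show "prune h (ys ! i) = ys ! i" using y by simp
      show "Y i * \<pi> i - inverse (real (Suc m)) < real (level h (ys ! i)) * prune_weight p h (ys ! i)"
        by (simp add: Y_def \<pi>_def)
    qed
    \<comment> \<open>The lower bound on n exceeds \<open>k * d ^ m\<close>, as
      \<open>width_is_of_branch\<close> asks, and \<open>d ^ m\<close>, which makes the events
      \<open>E i\<close> disjoint.\<close>
    then show ?case
      using eventually_gt_at_top[of "(k + 1) * d ^ m"]
    proof eventually_elim
      case (elim n)
      \<comment> \<open>The condition \<open>maxdeg t \<le> d\<close> holds almost surely; it is
        added because the bounds on the levels need it for each individual tree.\<close>
      define P where "P i j t \<longleftrightarrow> (prune h t = ys ! j \<and> (if j = i then width_is n t else height t \<le> m)) \<and> maxdeg t \<le> d" for i j t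
      define E where "E i t \<longleftrightarrow> length (subtrees t) = k \<and> (\<forall>j<k. P i j (subtrees t ! j))" for i t
      have PTE: "PT (E i) = pmf p k * (PT (\<lambda>t. prune h t = ys ! i \<and> width_is n t) * (\<Prod>j\<in>{..<k} - {i}. q j m))"
        if "i < k" for i
      proof -
        have "PT (E i) = pmf p k * (\<Prod>j<k. PT (P i j))"
          unfolding E_def by (rule PT_branches)
        also have "(\<Prod>j<k. PT (P i j)) = PT (P i i) * (\<Prod>j\<in>{..<k} - {i}. PT (P i j))"
          using that by (intro prod.remove) auto
        also have "(\<Prod>j\<in>{..<k} - {i}. PT (P i j)) = (\<Prod>j\<in>{..<k} - {i}. q j m)"
        proof (intro prod.cong refl)
          fix j assume "j \<in> {..<k} - {i}"
          then show "PT (P i j) = q j m"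
            unfolding q_def P_def using PT_and_maxdeg[OF d(1), of "\<lambda>t. prune h t = ys ! j \<and> height t \<le> m"] by simp
        qed
        also have "PT (P i i) = PT (\<lambda>t. prune h t = ys ! i \<and> width_is n t)"
          unfolding P_def using PT_and_maxdeg[OF d(1), of "\<lambda>t. prune h t = ys ! i \<and> width_is n t"] by simp
        finally show ?thesis .
      qed
      have disj: "disjoint_family_on (\<lambda>i. {t. E i t}) {..<k}"
      unfolding disjoint_family_on_def
      proof (intro ballI impI)
        fix i j assume ij: "i \<in> {..<k}" "j \<in> {..<k}" "i \<noteq> j"
        have False if "E i t" "E j t" for t
        proof -
          let ?s = "subtrees t ! i"
          have "P i i ?s" "P j i ?s" using that ij by (auto simp: E_def)
          then have "width_is n ?s" "height ?s \<le> m" "maxdeg ?s \<le> d" using ij by (auto simp: P_def)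
          then obtain b where b: "level b ?s = n" by (auto simp: width_is_def)
          show False
          proof (cases "b \<le> m")
            case True
            then have "d ^ b \<le> d ^ m" using d by (intro power_increasing) auto
            then show False using level_le_power[OF \<open>maxdeg ?s \<le> d\<close>, of b] b elim by simp
          next
            case False
            then show False using level_eq_0[of ?s b] \<open>height ?s \<le> m\<close> b elim by simp
          qed
        qed
        then show "{t. E i t} \<inter> {t. E j t} = {}" by blast
      qed
      have sub: "prune (Suc h) t = x \<and> width_is n t" if "i < k" "E i t" for i t
      proof -
        obtain ts where t: "t = Node ts" by (cases t)
        have len: "length ts = k" and P: "\<And>j. j < k \<Longrightarrow> P i j (ts ! j)"
          using that by (auto simp: E_def t)
        have "map (prune h) ts = ys"
          using len P by (auto simp: k_def P_def list_eq_iff_nth_eq)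
        moreover have "width_is n (Node ts)"
          using that len P[unfolded P_def] elim d(2)
          by (intro width_is_of_branch[of d i ts n m]) (auto split: if_splits)
        ultimately show ?thesis by (simp add: t x)
      qed
      have "c * w n \<le> \<phi> m * w n"
        using m w_nonneg by (intro mult_right_mono) auto
      also have "\<dots> = (\<Sum>i<k. pmf p k * ((Y i * \<pi> i - inverse (real (Suc m))) * w n * (\<Prod>j\<in>{..<k} - {i}. q j m)))"
        unfolding \<phi>_def sum_distrib_right by (intro sum.cong refl) (simp only: mult_ac)
      also have "\<dots> \<le> (\<Sum>i<k. pmf p k * (PT (\<lambda>t. prune h t = ys ! i \<and> width_is n t) * (\<Prod>j\<in>{..<k} - {i}. q j m)))"
        using elim by (intro sum_mono mult_left_mono mult_right_mono prod_nonneg) (auto simp: q_def)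
      also have "\<dots> = (\<Sum>i<k. PT (E i))"
        by (simp add: PTE)
      also have "\<dots> = measure_pmf.prob T (\<Union>i<k. {t. E i t})"
        using disj by (intro measure_pmf.finite_measure_finite_Union[symmetric]) auto
      also have "\<dots> \<le> PT (\<lambda>t. prune (Suc h) t = x \<and> width_is n t)"
        using sub by (intro measure_pmf.finite_measure_mono) auto
      finally show ?case .
    qed
  qed
  then show ?thesis
    unfolding spine_bound_def w_def by (simp add: mean1)
qed

text \<open>The full b-ary tree of height N has positive mass, and its last level has
  \<open>b ^ N > N\<close> nodes.\<close>

lemma infinite_width:
  assumes "offspring_mean p = 1"
  shows "infinite {n. PT (width_is n) > 0}"
proof -
  obtain b where b: "2 \<le> b" "pmf p b > 0" using ex_pmf_ge_2[OF assms p1] by blast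
  define full where "full = rec_nat (Node []) (\<lambda>_ t. Node (replicate b t))"
  have full: "full 0 = Node []" "full (Suc h) = Node (replicate b (full h))" for h
    by (simp_all add: full_def)
  have pos: "pmf T (full h) > 0" for h
    using b pmf_leaf_pos by (induction h) (simp_all add: full pmf_Node)
  have lev: "level h (full h) = b ^ h" for h
    by (induction h) (simp_all add: full sum_list_replicate)
  have "\<exists>n\<ge>N. PT (width_is n) > 0" for N
  proof -
    obtain n where n: "width_is n (full N)" using ex_width_is by blast
    have "N < b ^ N" using b by (intro power_gt_expt) auto
    also have "\<dots> \<le> n" using n lev[of N] by (metis width_is_def)
    finally have "N \<le> n" by simp
    moreover have "pmf T (full N) \<le> PT (width_is n)"
      unfolding measure_pmf_single[symmetric] using n by (intro measure_pmf.finite_measure_mono) auto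
    ultimately show ?thesis using pos[of N] by (intro exI[of _ n]) linarith
  qed
  then show ?thesis
    unfolding infinite_nat_iff_unbounded_le by blast
qed

end

section \<open>Walks with exchangeable steps\<close>

definition step_weight :: "nat pmf \<Rightarrow> nat list \<Rightarrow> real" where
  "step_weight p xs = prod_list (map (pmf p) xs)"

definition count_in :: "nat set \<Rightarrow> nat list \<Rightarrow> nat" where
  "count_in A xs = length (filter (\<lambda>d. d \<in> A) xs)"

text \<open>The step sequences \<open>d\<^sub>1, \<dots>, d\<^sub>m\<close> whose walk with increments \<open>d\<^sub>i - 1\<close> ends at \<open>-k\<close>.\<close>

definition walks :: "nat set \<Rightarrow> nat \<Rightarrow> int \<Rightarrow> int \<Rightarrow> nat list set" where
  "walks A m k n = {xs. length xs = m \<and> int (sum_list xs) = int m - k \<and> int (count_in A xs) = n}"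

definition walk_mass :: "nat pmf \<Rightarrow> nat set \<Rightarrow> nat \<Rightarrow> int \<Rightarrow> int \<Rightarrow> real" where
  "walk_mass p A m k n = (\<Sum>xs\<in>walks A m k n. step_weight p xs)"

lemma step_weight_nonneg [simp]: "0 \<le> step_weight p xs"
  unfolding step_weight_def by (auto intro!: prod_list_nonneg)

lemma count_in_le_length: "count_in A xs \<le> length xs"
  unfolding count_in_def by (rule length_filter_le)

lemma walk_mass_nonneg [simp]: "0 \<le> walk_mass p A m k n"
  unfolding walk_mass_def by (auto intro!: sum_nonneg)

lemma walks_bounded: "xs \<in> walks A m k n \<Longrightarrow> set xs \<subseteq> {..nat (int m - k)} \<and> length xs = m"
  using member_le_sum_list[of _ xs] by (force simp: walks_def)

lemma finite_walks [simp]: "finite (walks A m k n)"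
  by (rule finite_subset[OF _ finite_lists_length_eq[of "{..nat (int m - k)}" m]])
     (use walks_bounded in blast)+

text \<open>The parameters \<open>k\<close> and \<open>n\<close> are integers so that
  \<open>n - 1\<close> becomes negative at n = 0, where the set is then empty, instead of being cut
  off at 0.\<close>

lemma Cons_in_walks:
  "d # xs \<in> walks A (Suc m) k n \<longleftrightarrow> xs \<in> walks A m (k + int d - 1) (n - of_bool (d \<in> A))"
  by (auto simp: walks_def count_in_def)

text \<open>The steps are nonnegative with a prescribed sum, so the first one is bounded.
  \<open>N\<close> is left free so that a given step can be forced into its range.\<close>

lemma sum_walks_Suc:
  assumes "nat (int (Suc m) - k) \<le> N"
  shows "(\<Sum>xs\<in>walks A (Suc m) k n. f xs) =
    (\<Sum>d\<le>N. \<Sum>xs\<in>walks A m (k + int d - 1) (n - of_bool (d \<in> A)). f (d # xs))"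
proof -
  let ?X = "\<lambda>d. walks A m (k + int d - 1) (n - of_bool (d \<in> A))"
  have "walks A (Suc m) k n = (\<Union>d\<le>N. Cons d ` ?X d)"
  proof (intro equalityI subsetI)
    fix xs assume xs: "xs \<in> walks A (Suc m) k n"
    then obtain d ys where ys: "xs = d # ys" by (cases xs) (auto simp: walks_def)
    then have "d \<le> N" using walks_bounded[OF xs] assms by auto
    moreover have "ys \<in> ?X d" using xs unfolding ys Cons_in_walks .
    ultimately show "xs \<in> (\<Union>d\<le>N. Cons d ` ?X d)" unfolding ys by blast
  qed (auto simp: Cons_in_walks)
  then have "(\<Sum>xs\<in>walks A (Suc m) k n. f xs) = (\<Sum>xs\<in>(\<Union>d\<le>N. Cons d ` ?X d). f xs)"
    by simp
  also have "\<dots> = (\<Sum>d\<le>N. \<Sum>xs\<in>Cons d ` ?X d. f xs)"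
    by (rule sum.UNION_disjoint) auto
  also have "\<dots> = (\<Sum>d\<le>N. \<Sum>xs\<in>?X d. f (d # xs))"
    by (simp add: sum.reindex)
  finally show ?thesis .
qed

lemma walk_mass_Suc:
  assumes "nat (int (Suc m) - k) \<le> N"
  shows "walk_mass p A (Suc m) k n =
    (\<Sum>d\<le>N. pmf p d * walk_mass p A m (k + int d - 1) (n - of_bool (d \<in> A)))"
  unfolding walk_mass_def sum_walks_Suc[OF assms] by (simp add: step_weight_def sum_distrib_left)

text \<open>The steps are exchangeable, as cyclic shifts preserve \<open>walks\<close>.\<close>

lemma sum_walks_hd:
  assumes "m > 0"
  shows "real m * (\<Sum>xs\<in>walks A m k n. g (hd xs) * step_weight p xs) =
    (\<Sum>xs\<in>walks A m k n. sum_list (map g xs) * step_weight p xs)"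
proof -
  have inv: "sum_list (rotate j xs) = sum_list xs" "count_in A (rotate j xs) = count_in A xs"
    "step_weight p (rotate j xs) = step_weight p xs" for j xs
  proof -
    have mset: "mset (rotate j xs) = mset xs"
      by (metis rotate_drop_take mset_append add.commute append_take_drop_id)
    show "sum_list (rotate j xs) = sum_list xs"
      by (metis mset sum_mset_sum_list)
    show "count_in A (rotate j xs) = count_in A xs"
      unfolding count_in_def by (metis mset mset_filter size_mset)
    show "step_weight p (rotate j xs) = step_weight p xs"
      unfolding step_weight_def by (metis mset mset_map prod_mset_prod_list)
  qed
  have rot: "rotate j xs \<in> walks A m k n \<longleftrightarrow> xs \<in> walks A m k n" for j xs
    by (simp add: walks_def inv)
  \<comment> \<open>Rotation by j brings the entry at position j to the front.\<close>
  have eq: "(\<Sum>xs\<in>walks A m k n. g (xs ! j) * step_weight p xs) =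
      (\<Sum>xs\<in>walks A m k n. g (hd xs) * step_weight p xs)" if j: "j < m" for j
  proof (rule sum.reindex_bij_witness[of _ "rotate (m - j)" "rotate j"])
    fix xs assume xs: "xs \<in> walks A m k n"
    then have len: "length xs = m" by (simp add: walks_def)
    show "rotate (m - j) (rotate j xs) = xs" "rotate j (rotate (m - j) xs) = xs"
      using j len by (simp_all add: rotate_rotate rotate_id)
    show "rotate j xs \<in> walks A m k n" "rotate (m - j) xs \<in> walks A m k n"
      using xs by (simp_all add: rot)
    have "hd (rotate j xs) = xs ! j"
      using j len by (subst hd_rotate_conv_nth) auto
    then show "g (hd (rotate j xs)) * step_weight p (rotate j xs) = g (xs ! j) * step_weight p xs"
      by (simp add: inv)
  qed
  have "(\<Sum>xs\<in>walks A m k n. sum_list (map g xs) * step_weight p xs) =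
      (\<Sum>xs\<in>walks A m k n. \<Sum>j<m. g (xs ! j) * step_weight p xs)"
    by (intro sum.cong refl) (auto simp: walks_def sum_list_sum_nth atLeast0LessThan sum_distrib_right)
  also have "\<dots> = (\<Sum>j<m. \<Sum>xs\<in>walks A m k n. g (xs ! j) * step_weight p xs)"
    by (rule sum.swap)
  also have "\<dots> = real m * (\<Sum>xs\<in>walks A m k n. g (hd xs) * step_weight p xs)"
    by (simp add: eq)
  finally show ?thesis ..
qed

text \<open>
  Kemperman's formula, by induction on the number of steps: conditionally on the end point \<open>-k\<close>,
  the first of \<open>m\<close> steps has mean \<open>(m - k) / m\<close> by exchangeability.
\<close>

lemma hitting_time:
  fixes f :: "nat \<Rightarrow> nat \<Rightarrow> int \<Rightarrow> real"
  assumes f0: "\<And>k n. f 0 k n = of_bool (k = 0 \<and> n = 0)"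
    and f_Suc_0: "\<And>m n. f (Suc m) 0 n = 0"
    and f_Suc_Suc: "\<And>m k n. f (Suc m) (Suc k) n = (\<Sum>d\<le>m. pmf p d * f m (k + d) (n - of_bool (d \<in> A)))"
  shows "real m * f m k n = real k * walk_mass p A m (int k) n"
proof (induction m arbitrary: k n)
  case 0
  have "walks A 0 (int k) n = {}" if "k > 0"
    using that by (auto simp: walks_def)
  then show ?case by (cases "k = 0") (auto simp: walk_mass_def)
next
  case (Suc m)
  show ?case
  proof (cases k)
    case 0
    then show ?thesis by (simp add: f_Suc_0)
  next
    case k: (Suc k')
    define X where "X = (\<Sum>d\<le>m. pmf p d * walk_mass p A m (int (k' + d)) (n - of_bool (d \<in> A)))"
    have X: "walk_mass p A (Suc m) (int k) n = X"
      unfolding X_def by (subst walk_mass_Suc[of _ _ m]) (auto simp: k algebra_simps)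
    show ?thesis
    \<comment> \<open>The general argument cancels a factor \<open>m\<close>.\<close>
    proof (cases "m = 0")
      case True
      have "walk_mass p A 0 (int k') n = of_bool (k' = 0 \<and> n = 0)" for n
      proof -
        have "walks A 0 (int k') n = (if k' = 0 \<and> n = 0 then {[]} else {})"
          by (auto simp: walks_def count_in_def)
        then show ?thesis by (simp add: walk_mass_def step_weight_def)
      qed
      moreover have "f (Suc 0) (Suc k') n = pmf p 0 * of_bool (k' + 0 = 0 \<and> n - of_bool (0 \<in> A) = 0)"
        unfolding f_Suc_Suc f0 atMost_0 by (subst sum.insert) auto
      moreover have "X = pmf p 0 * walk_mass p A 0 (int (k' + 0)) (n - of_bool (0 \<in> A))"
        unfolding X_def True atMost_0 by (subst sum.insert) auto
      ultimately show ?thesis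
        using X by (cases "k' = 0") (auto simp: True k)
    next
      case False
      define Y where "Y = (\<Sum>d\<le>m. pmf p d * (real d * walk_mass p A m (int (k' + d)) (n - of_bool (d \<in> A))))"
      have Y: "real (Suc m) * Y = (real m - real k') * X"
      proof -
        have "Y = (\<Sum>xs\<in>walks A (Suc m) (int k) n. real (hd xs) * step_weight p xs)"
          unfolding Y_def
          by (subst sum_walks_Suc[of _ _ m])
             (auto simp: k algebra_simps walk_mass_def step_weight_def sum_distrib_left)
        also have "real (Suc m) * \<dots> = (\<Sum>xs\<in>walks A (Suc m) (int k) n. sum_list (map real xs) * step_weight p xs)"
          by (rule sum_walks_hd) simp
        also have "\<dots> = (\<Sum>xs\<in>walks A (Suc m) (int k) n. (real m - real k') * step_weight p xs)"
        proof (intro sum.cong refl)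
          fix xs assume "xs \<in> walks A (Suc m) (int k) n"
          then have "int (sum_list xs) = int m - int k'" by (simp add: walks_def k)
          moreover have "sum_list (map real xs) = real (sum_list xs)"
            by (induction xs) auto
          ultimately have "sum_list (map real xs) = real m - real k'"
            by linarith
          then show "sum_list (map real xs) * step_weight p xs = (real m - real k') * step_weight p xs"
            by simp
        qed
        also have "\<dots> = (real m - real k') * X"
          unfolding X[symmetric] walk_mass_def by (simp add: sum_distrib_left)
        finally show ?thesis .
      qed
      have "real m * f (Suc m) k n = (\<Sum>d\<le>m. pmf p d * (real m * f m (k' + d) (n - of_bool (d \<in> A))))"
        unfolding k f_Suc_Suc by (simp add: sum_distrib_left mult_ac)
      also have "\<dots> = real k' * X + Y"
        unfolding Suc X_def Y_def
        by (simp add: sum_distrib_left sum.distrib[symmetric] algebra_simps)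
      finally have "real m * (real (Suc m) * f (Suc m) k n) = real (Suc m) * (real k' * X) + real (Suc m) * Y"
        by (simp add: algebra_simps)
      \<comment> \<open>Here \<open>(m + 1) * k' + (m - k') = m * (k' + 1)\<close>.\<close>
      also have "\<dots> = real m * (real k * X)"
        unfolding Y by (simp add: k algebra_simps)
      finally show ?thesis
        using False by (simp add: X)
    qed
  qed
qed

section \<open>Exponentially small mass of walks with too few steps of a given value\<close>

lemma sum_lists_prod_list:
  fixes g :: "'a \<Rightarrow> real"
  assumes "finite S"
  shows "(\<Sum>xs\<in>{xs. set xs \<subseteq> S \<and> length xs = m}. prod_list (map g xs)) = (\<Sum>x\<in>S. g x) ^ m"
proof (induction m)
  case 0
  have "{xs. set xs \<subseteq> S \<and> length xs = 0} = {[]}" by auto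
  then show ?case by simp
next
  case (Suc m)
  let ?L = "{xs. set xs \<subseteq> S \<and> length xs = m}"
  have "(\<Sum>xs\<in>{xs. set xs \<subseteq> S \<and> length xs = Suc m}. prod_list (map g xs)) =
      (\<Sum>(xs, x)\<in>?L \<times> S. prod_list (map g xs) * g x)"
    unfolding lists_length_Suc_eq
    by (subst sum.reindex) (auto simp: inj_on_def mult.commute intro!: sum.cong)
  also have "\<dots> = (\<Sum>xs\<in>?L. prod_list (map g xs)) * (\<Sum>x\<in>S. g x)"
    by (simp add: sum_product sum.cartesian_product)
  finally show ?case using Suc by (simp add: mult.commute)
qed

lemma one_minus_exp_le: "0 \<le> x \<Longrightarrow> x - x\<^sup>2 / 2 \<le> 1 - exp (- x)" for x :: real
proof -
  assume x: "0 \<le> x"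
  have "(\<lambda>x. 1 - exp (- x) - (x - x\<^sup>2 / 2)) 0 \<le> (\<lambda>x. 1 - exp (- x) - (x - x\<^sup>2 / 2)) x"
  proof (rule DERIV_nonneg_imp_nondecreasing[OF x])
    fix y :: real assume "0 \<le> y" "y \<le> x"
    have "((\<lambda>x. 1 - exp (- x) - (x - x\<^sup>2 / 2)) has_real_derivative (exp (- y) - (1 - y))) (at y)"
      by (auto intro!: derivative_eq_intros)
    moreover have "exp (- y) - (1 - y) \<ge> 0"
      using exp_ge_add_one_self[of "- y"] by simp
    ultimately show "\<exists>z. ((\<lambda>x. 1 - exp (- x) - (x - x\<^sup>2 / 2)) has_real_derivative z) (at y) \<and> 0 \<le> z"
      by blast
  qed
  then show ?thesis by simp
qed

text \<open>Chernoff's bound with the tilting parameter e itself: one step contributes at most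
  \<open>exp (- (pmf p d * (e - e\<^sup>2 / 2)))\<close>, and together with the threshold and
  \<open>pmf p d \<le> 1\<close> the exponent is at most \<open>- e\<^sup>2 / 2\<close>. It is
  uniform in k and n because the sum is enlarged to all lists over a finite alphabet.\<close>

lemma count_list_lower_tail:
  assumes e: "0 < e"
  shows "(\<Sum>xs\<in>{xs\<in>walks A m k n. real (count_list xs d) \<le> (pmf p d - e) * real m}. step_weight p xs)
    \<le> exp (- e\<^sup>2 / 2) ^ m"
proof -
  let ?X = "{xs\<in>walks A m k n. real (count_list xs d) \<le> (pmf p d - e) * real m}"
  \<comment> \<open>Contains every step possible in \<open>walks A m k n\<close>, and
    \<open>d\<close> itself so that its term can be split off.\<close>
  define S where "S = insert d {..nat (int m - k)}"
  define g where "g x = pmf p x * (if x = d then exp (- e) else 1)" for x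
  have g: "0 \<le> g x" for x by (simp add: g_def)
  have wt: "step_weight p xs * exp (- e * real (count_list xs d)) = prod_list (map g xs)" for xs
  proof (induction xs)
    case Nil
    show ?case by (simp add: step_weight_def)
  next
    case (Cons x xs)
    have "exp (- e * real (count_list (x # xs) d)) =
        (if x = d then exp (- e) else 1) * exp (- e * real (count_list xs d))"
      by (simp add: exp_add[symmetric] algebra_simps)
    then have "step_weight p (x # xs) * exp (- e * real (count_list (x # xs) d)) =
        g x * (step_weight p xs * exp (- e * real (count_list xs d)))"
      by (simp add: step_weight_def g_def)
    then show ?case by (simp only: Cons list.map prod_list.Cons)
  qed
  have "(\<Sum>xs\<in>?X. step_weight p xs) \<le>
      (\<Sum>xs\<in>?X. exp (e * (pmf p d - e) * real m) * prod_list (map g xs))"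
  proof (intro sum_mono)
    fix xs assume "xs \<in> ?X"
    then have "e * real (count_list xs d) \<le> e * ((pmf p d - e) * real m)"
      using e by (intro mult_left_mono) auto
    then have "1 \<le> exp (e * (pmf p d - e) * real m + - e * real (count_list xs d))"
      by (simp add: mult.assoc)
    then have "step_weight p xs * 1 \<le>
        step_weight p xs * exp (e * (pmf p d - e) * real m + - e * real (count_list xs d))"
      by (intro mult_left_mono) auto
    also have "\<dots> = exp (e * (pmf p d - e) * real m) * prod_list (map g xs)"
      unfolding exp_add wt[symmetric] by (simp add: mult_ac)
    finally show "step_weight p xs \<le> exp (e * (pmf p d - e) * real m) * prod_list (map g xs)" by simp
  qed
  also have "\<dots> \<le> (\<Sum>xs\<in>{xs. set xs \<subseteq> S \<and> length xs = m}. exp (e * (pmf p d - e) * real m) * prod_list (map g xs))"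
  proof (rule sum_mono2)
    show "finite {xs. set xs \<subseteq> S \<and> length xs = m}"
      by (rule finite_lists_length_eq) (simp add: S_def)
    show "?X \<subseteq> {xs. set xs \<subseteq> S \<and> length xs = m}"
      using walks_bounded by (fastforce simp: S_def)
  qed (use g in \<open>auto intro!: mult_nonneg_nonneg prod_list_nonneg\<close>)
  also have "\<dots> = exp (e * (pmf p d - e) * real m) * (\<Sum>x\<in>S. g x) ^ m"
    by (subst sum_lists_prod_list[symmetric]) (auto simp: S_def sum_distrib_left)
  also have "\<dots> = (exp (e * (pmf p d - e)) * (\<Sum>x\<in>S. g x)) ^ m"
    by (simp add: power_mult_distrib exp_of_nat_mult[symmetric] mult.commute)
  also have "\<dots> \<le> (exp (- e\<^sup>2 / 2)) ^ m"
  proof (rule power_mono)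
    have "(\<Sum>x\<in>S. g x) = (\<Sum>x\<in>S. pmf p x) - pmf p d * (1 - exp (- e))"
    proof -
      have "(\<Sum>x\<in>S. g x) = (\<Sum>x\<in>S. pmf p x - (if x = d then pmf p d * (1 - exp (- e)) else 0))"
        by (intro sum.cong) (auto simp: g_def algebra_simps)
      also have "\<dots> = (\<Sum>x\<in>S. pmf p x) - pmf p d * (1 - exp (- e))"
        by (simp add: sum_subtractf S_def)
      finally show ?thesis .
    qed
    also have "(\<Sum>x\<in>S. pmf p x) \<le> 1"
      by (subst measure_measure_pmf_finite[symmetric]) (auto simp: S_def)
    finally have "(\<Sum>x\<in>S. g x) \<le> 1 + - (pmf p d * (1 - exp (- e)))" by simp
    also have "\<dots> \<le> exp (- (pmf p d * (1 - exp (- e))))"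
      by (rule exp_ge_add_one_self)
    also have "\<dots> \<le> exp (- (pmf p d * (e - e\<^sup>2 / 2)))"
      using one_minus_exp_le[of e] e by (simp add: mult_left_mono)
    finally have "exp (e * (pmf p d - e)) * (\<Sum>x\<in>S. g x) \<le> exp (e * (pmf p d - e)) * exp (- (pmf p d * (e - e\<^sup>2 / 2)))"
      by (intro mult_left_mono) auto
    also have "\<dots> = exp (- e\<^sup>2 + pmf p d * (e\<^sup>2 / 2))"
      by (simp flip: exp_add add: algebra_simps power2_eq_square)
    also have "\<dots> \<le> exp (- e\<^sup>2 / 2)"
      using mult_right_mono[OF pmf_le_1[of p d], of "e\<^sup>2 / 2"] by simp
    finally show "exp (e * (pmf p d - e)) * (\<Sum>x\<in>S. g x) \<le> exp (- e\<^sup>2 / 2)" .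
    show "0 \<le> exp (e * (pmf p d - e)) * (\<Sum>x\<in>S. g x)"
      using g by (intro mult_nonneg_nonneg sum_nonneg) auto
  qed
  finally show ?thesis .
qed

text \<open>By exchangeability the proportion of mass on walks starting with d is the mean
  proportion of steps equal to d, which is at least \<open>pmf p d - e\<close> off a set of
  exponentially small mass. The error is 0 unless \<open>n \<le> int (Suc m)\<close>, for want of
  walks; summed over m, the errors are then exponentially small in n.\<close>

lemma walk_mass_step:
  assumes e: "0 < e" "e < pmf p d"
  shows "(pmf p d - e) * (walk_mass p A (Suc m) k n - (if n \<le> int (Suc m) then exp (- e\<^sup>2 / 2) ^ Suc m else 0))
    \<le> pmf p d * walk_mass p A m (k + int d - 1) (n - of_bool (d \<in> A))"
proof -
  let ?X = "walks A (Suc m) k n"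
  let ?w = "step_weight p"
  let ?\<beta> = "if n \<le> int (Suc m) then exp (- e\<^sup>2 / 2) ^ Suc m else 0"
  define B where "B = {xs\<in>?X. real (count_list xs d) \<le> (pmf p d - e) * real (Suc m)}"
  define N where "N = max d (nat (int (Suc m) - k))"
  have cnt: "sum_list (map (\<lambda>x. of_bool (x = d)) xs) = real (count_list xs d)" for xs
    by (induction xs) auto
  have B: "(\<Sum>xs\<in>B. ?w xs) \<le> ?\<beta>"
  proof (cases "n \<le> int (Suc m)")
    case True
    then show ?thesis using count_list_lower_tail[OF e(1), where A = A and m = "Suc m" and k = k and n = n and p = p and d = d]
      unfolding B_def by (simp only: if_True)
  next
    case False
    have "xs \<notin> ?X" for xs
      using False count_in_le_length[of A xs] by (auto simp: walks_def)
    then have "?X = {}" by blast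
    then show ?thesis using False by (simp add: B_def)
  qed
  have "(pmf p d - e) * real (Suc m) * (walk_mass p A (Suc m) k n - ?\<beta>)
      \<le> (pmf p d - e) * real (Suc m) * ((\<Sum>xs\<in>?X. ?w xs) - (\<Sum>xs\<in>B. ?w xs))"
    using B e by (intro mult_left_mono) (auto simp: walk_mass_def)
  also have "(\<Sum>xs\<in>?X. ?w xs) - (\<Sum>xs\<in>B. ?w xs) = (\<Sum>xs\<in>?X - B. ?w xs)"
    by (subst sum_diff) (auto simp: B_def)
  also have "(pmf p d - e) * real (Suc m) * \<dots> = (\<Sum>xs\<in>?X - B. (pmf p d - e) * real (Suc m) * ?w xs)"
    by (simp add: sum_distrib_left)
  also have "\<dots> \<le> (\<Sum>xs\<in>?X - B. real (count_list xs d) * ?w xs)"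
    by (intro sum_mono mult_right_mono) (auto simp: B_def)
  also have "\<dots> \<le> (\<Sum>xs\<in>?X. real (count_list xs d) * ?w xs)"
    by (intro sum_mono2) auto
  also have "\<dots> = real (Suc m) * (\<Sum>xs\<in>?X. of_bool (hd xs = d) * ?w xs)"
    unfolding cnt[symmetric] by (rule sum_walks_hd[symmetric]) simp
  also have "(\<Sum>xs\<in>?X. of_bool (hd xs = d) * ?w xs) =
      (\<Sum>d'\<le>N. if d' = d then pmf p d * walk_mass p A m (k + int d - 1) (n - of_bool (d \<in> A)) else 0)"
    unfolding sum_walks_Suc[of m k N, unfolded N_def, OF max.cobounded2, folded N_def]
    by (intro sum.cong refl) (auto simp: walk_mass_def step_weight_def sum_distrib_left)
  also have "\<dots> = pmf p d * walk_mass p A m (k + int d - 1) (n - of_bool (d \<in> A))"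
    by (simp add: N_def)
  finally show ?thesis
    by (simp only: mult.assoc mult.left_commute[of _ "real (Suc m)"] mult_le_cancel_left)
qed

text \<open>The mass of the first \<open>M\<close> terms in Kemperman's formula, divided by \<open>k\<close>.\<close>

definition hit_mass :: "nat pmf \<Rightarrow> nat set \<Rightarrow> nat \<Rightarrow> int \<Rightarrow> int \<Rightarrow> real" where
  "hit_mass p A M k n = (\<Sum>m=1..M. walk_mass p A m k n / real m)"

lemma hit_mass_nonneg [simp]: "0 \<le> hit_mass p A M k n"
  unfolding hit_mass_def by (auto intro!: sum_nonneg)

text \<open>
  Up to an exponentially small error, a change of the end point and of the number of steps in \<open>A\<close>
  by the given amounts asymptotically does not decrease the mass.
\<close>

definition shift_bound :: "nat pmf \<Rightarrow> nat set \<Rightarrow> int \<Rightarrow> nat \<Rightarrow> bool" where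
  "shift_bound p A x c \<longleftrightarrow> (\<forall>e>0. \<exists>b C N. 0 < b \<and> b < 1 \<and> 0 \<le> C \<and> (\<forall>n\<ge>N. \<forall>k M.
     (1 - e) * hit_mass p A M k (int (n + c)) - C * b ^ n \<le> hit_mass p A M (k + x) (int n)))"

lemma sum_geometric_tail_le:
  fixes b :: real
  assumes "0 < b" "b < 1"
  shows "(\<Sum>j\<in>{j\<in>{2..M}. n \<le> j}. b ^ j) \<le> b ^ n / (1 - b)"
proof -
  have "(\<Sum>j\<in>{j\<in>{2..M}. n \<le> j}. b ^ j) \<le> (\<Sum>j\<in>{n..n + M}. b ^ j)"
    using assms by (intro sum_mono2) auto
  also have "\<dots> = b ^ n * (\<Sum>j\<le>M. b ^ j)"
    using sum.shift_bounds_cl_nat_ivl[of "\<lambda>j. b ^ j" 0 n M]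
    by (simp add: atMost_atLeast0 power_add sum_distrib_left mult.commute add.commute)
  also have "(\<Sum>j\<le>M. b ^ j) = (1 - b ^ Suc M) / (1 - b)"
    using assms sum_gp0[of b M] by simp
  also have "b ^ n * \<dots> \<le> b ^ n * (1 / (1 - b))"
    using assms by (intro mult_left_mono divide_right_mono) auto
  finally show ?thesis by simp
qed

text \<open>Sums \<open>walk_mass_step\<close> over the number of steps. Removing a step replaces
  the weight 1 / (m + 1) by the larger 1 / m, and the errors are dominated by a geometric series
  starting at index n.\<close>

lemma shift_bound_step:
  assumes d: "pmf p d > 0"
  shows "shift_bound p A (int d - 1) (of_bool (d \<in> A))"
  unfolding shift_bound_def
proof (intro allI impI)
  fix e :: real assume "e > 0"
  \<comment> \<open>Keeps \<delta> below \<open>pmf p d\<close> and the relative loss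
    \<open>\<delta> / pmf p d\<close> at most e.\<close>
  define \<delta> where "\<delta> = min e (1/2) * pmf p d"
  have \<delta>: "0 < \<delta>" "\<delta> < pmf p d" "\<delta> / pmf p d \<le> e"
    using \<open>e > 0\<close> d by (auto simp: \<delta>_def min_def)
  define b where "b = exp (- \<delta>\<^sup>2 / 2)"
  have b: "0 < b" "b < 1" using \<delta> by (auto simp: b_def)
  have "(1 - e) * hit_mass p A M k (int (n + of_bool (d \<in> A))) - 1 / (1 - b) * b ^ n
      \<le> hit_mass p A M (k + (int d - 1)) (int n)" if n: "n \<ge> 2" for n k M
  proof -
    let ?n = "int (n + of_bool (d \<in> A))"
    let ?W = "\<lambda>m. walk_mass p A m k ?n"
    let ?\<beta> = "\<lambda>m. if n \<le> m then b ^ m else 0"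
    have le: "(pmf p d - \<delta>) * (?W (Suc m) - ?\<beta> (Suc m)) / real (Suc m)
        \<le> pmf p d * (walk_mass p A m (k + (int d - 1)) (int n) / real m)" if "m \<in> {1..M}" for m
    proof -
      have "(pmf p d - \<delta>) * (?W (Suc m) - ?\<beta> (Suc m)) \<le>
         (pmf p d - \<delta>) * (?W (Suc m) - (if ?n \<le> int (Suc m) then exp (- \<delta>\<^sup>2 / 2) ^ Suc m else 0))"
        using \<delta> by (intro mult_left_mono) (auto simp: b_def)
      also have "\<dots> \<le> pmf p d * walk_mass p A m (k + (int d - 1)) (int n)"
        using walk_mass_step[OF \<delta>(1,2), of A m k ?n] by (simp add: algebra_simps)
      finally have "(pmf p d - \<delta>) * (?W (Suc m) - ?\<beta> (Suc m)) / real (Suc m) \<le>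
          pmf p d * walk_mass p A m (k + (int d - 1)) (int n) / real (Suc m)"
        by (intro divide_right_mono) auto
      also have "\<dots> \<le> pmf p d * walk_mass p A m (k + (int d - 1)) (int n) / real m"
        using that by (intro divide_left_mono) auto
      finally show ?thesis by simp
    qed
    \<comment> \<open>The term for one step would lead to a walk without steps; it vanishes because
      a single step cannot account for two or more values in \<open>A\<close>.\<close>
    have W1: "?W 1 = 0"
    proof -
      have "xs \<notin> walks A 1 k ?n" for xs
        using n count_in_le_length[of A xs] by (auto simp: walks_def)
      then have "walks A 1 k ?n = {}" by blast
      then show ?thesis by (simp add: walk_mass_def)
    qed
    have "hit_mass p A M k ?n \<le> hit_mass p A (Suc M) k ?n"
      by (simp add: hit_mass_def)
    also have "\<dots> = (\<Sum>m=1..M. ?W (Suc m) / real (Suc m))"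
    proof -
      have "(\<Sum>m=1..Suc M. g m) = g 1 + (\<Sum>m=1..M. g (Suc m))" for g :: "nat \<Rightarrow> real"
        by (induction M) auto
      from this[of "\<lambda>m. ?W m / real m"] show ?thesis
        unfolding hit_mass_def W1 by simp
    qed
    finally have 1: "hit_mass p A M k ?n \<le> (\<Sum>m=1..M. ?W (Suc m) / real (Suc m))" .
    have "(\<Sum>m=1..M. ?\<beta> (Suc m) / real (Suc m)) \<le> (\<Sum>m=1..M. ?\<beta> (Suc m))"
    proof (intro sum_mono)
      fix m :: nat
      have "0 \<le> ?\<beta> (Suc m)" using b by simp
      then show "?\<beta> (Suc m) / real (Suc m) \<le> ?\<beta> (Suc m)"
        using divide_left_mono[of 1 "real (Suc m)" "?\<beta> (Suc m)"] by simp
    qed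
    also have "\<dots> = (\<Sum>m=2..Suc M. ?\<beta> m)"
      using sum.shift_bounds_cl_Suc_ivl[of ?\<beta> 1 M] by (simp add: numeral_2_eq_2)
    also have "\<dots> = (\<Sum>m\<in>{m\<in>{2..Suc M}. n \<le> m}. b ^ m)"
      by (subst sum.inter_filter[symmetric]) auto
    also have "\<dots> \<le> b ^ n / (1 - b)"
      by (rule sum_geometric_tail_le[OF b])
    finally have 2: "(\<Sum>m=1..M. ?\<beta> (Suc m) / real (Suc m)) \<le> b ^ n / (1 - b)" .
    have "(pmf p d - \<delta>) * (hit_mass p A M k ?n - b ^ n / (1 - b)) \<le>
        (pmf p d - \<delta>) * ((\<Sum>m=1..M. ?W (Suc m) / real (Suc m)) - (\<Sum>m=1..M. ?\<beta> (Suc m) / real (Suc m)))"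
      using 1 2 \<delta> by (intro mult_left_mono) auto
    also have "\<dots> = (\<Sum>m=1..M. (pmf p d - \<delta>) * (?W (Suc m) - ?\<beta> (Suc m)) / real (Suc m))"
      unfolding sum_subtractf[symmetric] sum_distrib_left
      by (intro sum.cong refl) (simp add: diff_divide_distrib right_diff_distrib)
    also have "\<dots> \<le> (\<Sum>m=1..M. pmf p d * (walk_mass p A m (k + (int d - 1)) (int n) / real m))"
      by (intro sum_mono le)
    also have "\<dots> = pmf p d * hit_mass p A M (k + (int d - 1)) (int n)"
      by (simp add: hit_mass_def sum_distrib_left)
    finally have 3: "(1 - \<delta> / pmf p d) * (hit_mass p A M k ?n - b ^ n / (1 - b)) \<le>
        hit_mass p A M (k + (int d - 1)) (int n)"
      using d by (simp add: field_simps)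
    have "(1 - e) * hit_mass p A M k ?n - b ^ n / (1 - b) \<le>
        (1 - \<delta> / pmf p d) * hit_mass p A M k ?n - (1 - \<delta> / pmf p d) * (b ^ n / (1 - b))"
    proof (rule diff_mono)
      show "(1 - e) * hit_mass p A M k ?n \<le> (1 - \<delta> / pmf p d) * hit_mass p A M k ?n"
        using \<delta> by (intro mult_right_mono) auto
      show "(1 - \<delta> / pmf p d) * (b ^ n / (1 - b)) \<le> b ^ n / (1 - b)"
        using \<delta> b d by (intro mult_left_le_one_le) auto
    qed
    also have "\<dots> = (1 - \<delta> / pmf p d) * (hit_mass p A M k ?n - b ^ n / (1 - b))"
      by (simp add: right_diff_distrib)
    also note 3
    finally show ?thesis by simp
  qed
  then show "\<exists>b C N. 0 < b \<and> b < 1 \<and> 0 \<le> C \<and> (\<forall>n\<ge>N. \<forall>k M.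
     (1 - e) * hit_mass p A M k (int (n + of_bool (d \<in> A))) - C * b ^ n
       \<le> hit_mass p A M (k + (int d - 1)) (int n))"
    using b by (intro exI[of _ b] exI[of _ "1 / (1 - b)"] exI[of _ 2]) auto
qed

lemma shift_bound_0: "shift_bound p A 0 0"
  unfolding shift_bound_def
proof (intro allI impI)
  fix e :: real assume "e > 0"
  then have "(1 - e) * hit_mass p A M k n \<le> 1 * hit_mass p A M k n" for M k n
    by (intro mult_right_mono) auto
  then show "\<exists>b C N. 0 < b \<and> b < 1 \<and> 0 \<le> C \<and> (\<forall>n\<ge>N. \<forall>k M.
     (1 - e) * hit_mass p A M k (int (n + 0)) - C * b ^ n \<le> hit_mass p A M (k + 0) (int n))"
    by (intro exI[of _ "1/2"] exI[of _ 0]) auto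
qed

text \<open>The bounds hold for all end points, so the second one can be applied where the first one
  leads. The larger of the two bases serves for the combined error.\<close>

lemma shift_bound_add:
  assumes 1: "shift_bound p A x c" and 2: "shift_bound p A y d"
  shows "shift_bound p A (x + y) (c + d)"
  unfolding shift_bound_def
proof (intro allI impI)
  fix e :: real assume "e > 0"
  define \<epsilon> where "\<epsilon> = min e 1 / 2"
  have \<epsilon>: "0 < \<epsilon>" "\<epsilon> < 1" "1 - e \<le> (1 - \<epsilon>) * (1 - \<epsilon>)"
    using \<open>e > 0\<close> by (auto simp: \<epsilon>_def min_def field_simps power2_eq_square)
  from 1[unfolded shift_bound_def, rule_format, OF \<epsilon>(1)]
  obtain b C N where ex1: "0 < b \<and> b < 1 \<and> 0 \<le> C \<and> (\<forall>n\<ge>N. \<forall>k M.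
     (1 - \<epsilon>) * hit_mass p A M k (int (n + c)) - C * b ^ n \<le> hit_mass p A M (k + x) (int n))"
    by (elim exE) (rule that)
  then have b: "0 < b" "b < 1" "0 \<le> C" by simp_all
  have N: "(1 - \<epsilon>) * hit_mass p A M k (int (n + c)) - C * b ^ n \<le> hit_mass p A M (k + x) (int n)"
    if "n \<ge> N" for n k M
    using ex1[THEN conjunct2, THEN conjunct2, THEN conjunct2, rule_format] that by simp
  from 2[unfolded shift_bound_def, rule_format, OF \<epsilon>(1)]
  obtain b' C' N' where ex2: "0 < b' \<and> b' < 1 \<and> 0 \<le> C' \<and> (\<forall>n\<ge>N'. \<forall>k M.
     (1 - \<epsilon>) * hit_mass p A M k (int (n + d)) - C' * b' ^ n \<le> hit_mass p A M (k + y) (int n))"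
    by (elim exE) (rule that)
  then have b': "0 < b'" "b' < 1" "0 \<le> C'" by simp_all
  have N': "(1 - \<epsilon>) * hit_mass p A M k (int (n + d)) - C' * b' ^ n \<le> hit_mass p A M (k + y) (int n)"
    if "n \<ge> N'" for n k M
    using ex2[THEN conjunct2, THEN conjunct2, THEN conjunct2, rule_format] that by simp
  define B where "B = max b b'"
  have "(1 - e) * hit_mass p A M k (int (n + (c + d))) - (C + C') * B ^ n \<le>
      hit_mass p A M (k + (x + y)) (int n)" if n: "n \<ge> max N N'" for n k M
  proof -
    have "(1 - e) * hit_mass p A M k (int (n + (c + d))) \<le> (1 - \<epsilon>) * (1 - \<epsilon>) * hit_mass p A M k (int (n + (c + d)))"
      using \<epsilon> by (intro mult_right_mono) auto
    also have "\<dots> = (1 - \<epsilon>) * ((1 - \<epsilon>) * hit_mass p A M k (int (n + d + c)))"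
      by (simp add: add_ac mult.assoc)
    also have "\<dots> \<le> (1 - \<epsilon>) * (hit_mass p A M (k + x) (int (n + d)) + C * b ^ (n + d))"
      using N[of "n + d" M k] n \<epsilon> by (intro mult_left_mono) auto
    also have "\<dots> = (1 - \<epsilon>) * hit_mass p A M (k + x) (int (n + d)) + (1 - \<epsilon>) * (C * b ^ (n + d))"
      by (simp add: distrib_left)
    also have "(1 - \<epsilon>) * (C * b ^ (n + d)) \<le> 1 * (C * b ^ n)"
      using \<epsilon> b by (intro mult_mono power_decreasing mult_left_mono) auto
    also have "C * b ^ n \<le> C * B ^ n"
      using b by (intro mult_left_mono power_mono) (auto simp: B_def)
    also have "(1 - \<epsilon>) * hit_mass p A M (k + x) (int (n + d)) \<le> hit_mass p A M (k + x + y) (int n) + C' * b' ^ n"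
      using N'[of n M "k + x"] n by auto
    also have "C' * b' ^ n \<le> C' * B ^ n"
      using b' by (intro mult_left_mono power_mono) (auto simp: B_def)
    finally show ?thesis by (simp add: algebra_simps)
  qed
  then show "\<exists>b C N. 0 < b \<and> b < 1 \<and> 0 \<le> C \<and> (\<forall>n\<ge>N. \<forall>k M.
     (1 - e) * hit_mass p A M k (int (n + (c + d))) - C * b ^ n
       \<le> hit_mass p A M (k + (x + y)) (int n))"
    using b b' by (intro exI[of _ B] exI[of _ "C + C'"] exI[of _ "max N N'"]) (auto simp: B_def)
qed

section \<open>Nodes with out-degree in a given set\<close>

unbundle no vec_syntax
unbundle fps_syntax

text \<open>The power series in a variable marking \<phi>, restricted to the event \<open>P\<close>;
  for independent parts it becomes a Cauchy product.\<close>

definition gen_fun :: "'a pmf \<Rightarrow> ('a \<Rightarrow> nat) \<Rightarrow> ('a \<Rightarrow> bool) \<Rightarrow> real fps" where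
  "gen_fun q \<phi> P = Abs_fps (\<lambda>n. measure_pmf.prob q {x. P x \<and> \<phi> x = n})"

lemma gen_fun_pair:
  fixes q :: "'a :: countable pmf" and r :: "'b :: countable pmf"
  shows "gen_fun (pair_pmf q r) (\<lambda>(x, y). \<phi> x + \<psi> y) (\<lambda>(x, y). P x \<and> Q y) =
    gen_fun q \<phi> P * gen_fun r \<psi> Q"
proof (rule fps_ext)
  fix n
  let ?A = "\<lambda>i. {x. P x \<and> \<phi> x = i}" and ?B = "\<lambda>i. {y. Q y \<and> \<psi> y = n - i}"
  have "{z. (case z of (x, y) \<Rightarrow> P x \<and> Q y) \<and> (case z of (x, y) \<Rightarrow> \<phi> x + \<psi> y) = n} = (\<Union>i\<in>{0..n}. ?A i \<times> ?B i)"
    by auto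
  then have "gen_fun (pair_pmf q r) (\<lambda>(x, y). \<phi> x + \<psi> y) (\<lambda>(x, y). P x \<and> Q y) $ n =
      measure_pmf.prob (pair_pmf q r) (\<Union>i\<in>{0..n}. ?A i \<times> ?B i)"
    by (simp add: gen_fun_def)
  also have "\<dots> = (\<Sum>i\<in>{0..n}. measure_pmf.prob (pair_pmf q r) (?A i \<times> ?B i))"
    by (rule measure_pmf.finite_measure_finite_Union) (auto simp: disjoint_family_on_def)
  also have "\<dots> = (gen_fun q \<phi> P * gen_fun r \<psi> Q) $ n"
    by (simp add: fps_mult_nth gen_fun_def measure_pmf_prob_product)
  finally show "gen_fun (pair_pmf q r) (\<lambda>(x, y). \<phi> x + \<psi> y) (\<lambda>(x, y). P x \<and> Q y) $ n =
      (gen_fun q \<phi> P * gen_fun r \<psi> Q) $ n" .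
qed

lemma gen_fun_map: "gen_fun (map_pmf f q) \<phi> P = gen_fun q (\<lambda>x. \<phi> (f x)) (\<lambda>x. P (f x))"
  by (rule fps_ext) (simp add: gen_fun_def vimage_def)

lemma gen_fun_replicate:
  fixes q :: "'a :: countable pmf"
  shows "gen_fun (replicate_pmf n q) (\<lambda>xs. sum_list (map \<phi> xs)) (\<lambda>xs. length xs = n \<and> (\<forall>i<n. P i (xs ! i))) =
    (\<Prod>i<n. gen_fun q \<phi> (P i))"
proof (induction n arbitrary: P)
  case 0
  show ?case
    by (rule fps_ext) (auto simp: gen_fun_def indicator_def)
next
  case (Suc n)
  have rep: "replicate_pmf (Suc n) q = map_pmf (\<lambda>(x, xs). x # xs) (pair_pmf q (replicate_pmf n q))"
    by (simp add: pair_pmf_def map_bind_pmf)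
  have "gen_fun (replicate_pmf (Suc n) q) (\<lambda>xs. sum_list (map \<phi> xs)) (\<lambda>xs. length xs = Suc n \<and> (\<forall>i<Suc n. P i (xs ! i))) =
     gen_fun (pair_pmf q (replicate_pmf n q)) (\<lambda>(x, xs). \<phi> x + sum_list (map \<phi> xs))
       (\<lambda>(x, xs). P 0 x \<and> (length xs = n \<and> (\<forall>i<n. P (Suc i) (xs ! i))))"
    unfolding rep gen_fun_map
    by (intro arg_cong2[where f = "gen_fun _"] ext) (auto simp: less_Suc_eq_0_disj)
  also have "\<dots> = gen_fun q \<phi> (P 0) * (\<Prod>i<n. gen_fun q \<phi> (P (Suc i)))"
    unfolding gen_fun_pair by (simp only: Suc[of "\<lambda>i. P (Suc i)"])
  also have "\<dots> = (\<Prod>i<Suc n. gen_fun q \<phi> (P i))"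
    by (simp only: prod.lessThan_Suc_shift)
  finally show ?case .
qed

text \<open>The part of \<open>occ A t\<close> due to the nodes below height \<open>h\<close>, which
  the truncation determines.\<close>

primrec inner_occ :: "nat set \<Rightarrow> nat \<Rightarrow> ftree \<Rightarrow> nat" where
  "inner_occ A 0 t = 0"
| "inner_occ A (Suc h) t = of_bool (length (subtrees t) \<in> A) + sum_list (map (inner_occ A h) (subtrees t))"

lemma occ_UNIV_pos: "0 < occ UNIV t"
  by (cases t) simp

text \<open>One application of \<open>shift_bound_step\<close> for each node below height h: a node
  with d children moves the end point by d - 1, and these numbers add up to
  \<open>level h t - 1\<close>.\<close>

lemma shift_bound_tree:
  "prune_weight p h t \<noteq> 0 \<Longrightarrow> shift_bound p A (int (level h t) - 1) (inner_occ A h t)"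
proof (induction h arbitrary: t)
  case 0
  then show ?case by (simp add: shift_bound_0)
next
  case (Suc h)
  obtain ts where t: "t = Node ts" by (cases t)
  have p: "pmf p (length ts) > 0" and ts: "\<And>s. s \<in> set ts \<Longrightarrow> prune_weight p h s \<noteq> 0"
    using Suc.prems pmf_nonneg[of p "length ts"] by (auto simp: t prod_list_zero_iff less_le)
  \<comment> \<open>The list \<open>us\<close> varies separately from \<open>ts\<close>, so that the
    root degree stays fixed in the induction.\<close>
  have "set us \<subseteq> set ts \<Longrightarrow> shift_bound p A (int (length ts) - 1 + (\<Sum>s\<leftarrow>us. int (level h s) - 1))
      (of_bool (length ts \<in> A) + sum_list (map (inner_occ A h) us))" for us
  proof (induction us)
    case Nil
    show ?case using shift_bound_step[OF p, of A] by simp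
  next
    case (Cons u us)
    then have "shift_bound p A (int (length ts) - 1 + (\<Sum>s\<leftarrow>us. int (level h s) - 1) + (int (level h u) - 1))
      (of_bool (length ts \<in> A) + sum_list (map (inner_occ A h) us) + inner_occ A h u)"
      by (intro shift_bound_add[OF Cons.IH] Suc.IH ts) auto
    then show ?case by (simp add: add_ac)
  qed
  from this[of ts] have "shift_bound p A (int (length ts) - 1 + (\<Sum>s\<leftarrow>ts. int (level h s) - 1)) (inner_occ A (Suc h) t)"
    by (simp add: t)
  moreover have "int (length us) + (\<Sum>s\<leftarrow>us. int (level h s) - 1) = int (sum_list (map (level h) us))" for us
    by (induction us) auto
  ultimately show ?case by (simp add: t algebra_simps)
qed

section \<open>The law of \<open>occ A\<close> on trees and forests\<close>

context gw_tree_pmf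
begin

context
  fixes A :: "nat set"
begin

definition occ_prob :: "nat \<Rightarrow> real" where
  "occ_prob n = PT (\<lambda>t. occ A t = n)"

lemma occ_prob_nonneg [simp]: "0 \<le> occ_prob n"
  by (simp add: occ_prob_def)

text \<open>Given the truncation, \<open>occ A\<close> is a constant from the nodes below height h
  plus the contributions of independent branches, one for each node at height h.\<close>

lemma gen_fun_prune:
  assumes "prune h x = x"
  shows "gen_fun T (occ A) (\<lambda>t. prune h t = x) =
    fps_const (prune_weight p h x) * fps_X ^ inner_occ A h x * gen_fun T (occ A) (\<lambda>_. True) ^ level h x"
  using assms
proof (induction h arbitrary: x)
  case 0
  then show ?case by simp
next
  case (Suc h)
  obtain ys where x: "x = Node ys" by (cases x)
  define k where "k = length ys"
  have y: "prune h (ys ! i) = ys ! i" if "i < k" for i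
    using Suc.prems that by (simp add: x k_def list_eq_iff_nth_eq)
  define a where "a = (of_bool (k \<in> A) :: nat)"
  let ?F = "gen_fun T (occ A) (\<lambda>_. True)"
  let ?G = "gen_fun (replicate_pmf k T) (\<lambda>ts. sum_list (map (occ A) ts)) (\<lambda>ts. length ts = k \<and> (\<forall>i<k. prune h (ts ! i) = ys ! i))"
  have "gen_fun T (occ A) (\<lambda>t. prune (Suc h) t = x) = fps_const (pmf p k) * (fps_X ^ a * ?G)"
  proof (rule fps_ext)
    fix n
    have "gen_fun T (occ A) (\<lambda>t. prune (Suc h) t = x) $ n = PT (\<lambda>t. prune (Suc h) t = x \<and> occ A t = n)"
      by (simp add: gen_fun_def)
    also have "\<dots> = (\<integral>k'. (fps_X ^ a * ?G) $ n * indicator {k} k' \<partial>measure_pmf p)"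
      unfolding PT_rec
    proof (intro Bochner_Integration.integral_cong refl)
      fix k'
      show "measure_pmf.prob (replicate_pmf k' T) {ts. prune (Suc h) (Node ts) = x \<and> occ A (Node ts) = n} =
          (fps_X ^ a * ?G) $ n * indicator {k} k'"
      proof (cases "k' = k")
        case True
        have "{ts. prune (Suc h) (Node ts) = x \<and> occ A (Node ts) = n} =
            (if n < a then {} else {ts. (length ts = k \<and> (\<forall>i<k. prune h (ts ! i) = ys ! i)) \<and> sum_list (map (occ A) ts) = n - a})"
          by (auto simp: x k_def a_def list_eq_iff_nth_eq)
        then show ?thesis using True by (simp add: fps_X_power_mult_nth gen_fun_def)
      next
        case False
        then have empty: "{ts. length ts = k' \<and> prune (Suc h) (Node ts) = x \<and> occ A (Node ts) = n} = {}"
          by (auto simp: x k_def)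
        have "measure_pmf.prob (replicate_pmf k' T) {ts. prune (Suc h) (Node ts) = x \<and> occ A (Node ts) = n} = 0"
          by (subst AE_length_replicate) (simp only: empty measure_empty)
        then show ?thesis using False by simp
      qed
    qed
    also have "\<dots> = (fps_const (pmf p k) * (fps_X ^ a * ?G)) $ n"
      by (simp add: measure_pmf_single mult.commute)
    finally show "gen_fun T (occ A) (\<lambda>t. prune (Suc h) t = x) $ n = (fps_const (pmf p k) * (fps_X ^ a * ?G)) $ n" .
  qed
  also have "?G = (\<Prod>i<k. gen_fun T (occ A) (\<lambda>t. prune h t = ys ! i))"
    by (rule gen_fun_replicate)
  also have "\<dots> = (\<Prod>i<k. fps_const (prune_weight p h (ys ! i)) * fps_X ^ inner_occ A h (ys ! i) * ?F ^ level h (ys ! i))"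
    using y by (intro prod.cong refl Suc.IH) auto
  also have "\<dots> = prod_list (map (\<lambda>y. fps_const (prune_weight p h y) * fps_X ^ inner_occ A h y * ?F ^ level h y) ys)"
    by (simp add: k_def prod.list_conv_set_nth atLeast0LessThan)
  also have "\<dots> = fps_const (prod_list (map (prune_weight p h) ys)) * fps_X ^ sum_list (map (inner_occ A h) ys) *
      ?F ^ sum_list (map (level h) ys)"
    by (induction ys) (simp_all add: power_add mult_ac flip: fps_const_mult)
  finally show ?case
    by (simp add: x k_def a_def power_add mult_ac flip: fps_const_mult)
qed

text \<open>\<open>m\<close> is the total number of nodes, that is, the number of steps of the walk
  exploring the forest; \<open>n\<close> is an integer to fit \<open>hitting_time\<close>.\<close>

definition forest_prob :: "nat \<Rightarrow> nat \<Rightarrow> int \<Rightarrow> real" where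
  "forest_prob m k n = measure_pmf.prob (replicate_pmf k T)
     {ts. sum_list (map (occ UNIV) ts) = m \<and> int (sum_list (map (occ A) ts)) = n}"

lemma length_le_size: "length ts \<le> sum_list (map (occ UNIV) ts)"
proof -
  have "sum_list (map (\<lambda>_. 1) ts) \<le> sum_list (map (occ UNIV) ts)"
    using occ_UNIV_pos by (intro sum_list_mono) (simp add: Suc_le_eq)
  then show ?thesis by (simp add: sum_list_triv)
qed

lemma forest_prob_eq_0: "m < k \<Longrightarrow> forest_prob m k n = 0"
proof -
  assume "m < k"
  then have empty: "{ts. length ts = k \<and> sum_list (map (occ UNIV) ts) = m \<and> int (sum_list (map (occ A) ts)) = n} = {}"
    using length_le_size by (auto dest: leD)
  show ?thesis
    unfolding forest_prob_def by (subst AE_length_replicate) (simp only: empty measure_empty)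
qed

text \<open>Removing the root of the first tree of a forest.\<close>

lemma forest_prob_Suc:
  "forest_prob (Suc m) (Suc k) n = (\<Sum>d\<le>m. pmf p d * forest_prob m (k + d) (n - of_bool (d \<in> A)))"
proof -
  have rep: "replicate_pmf (Suc k) T =
      bind_pmf p (\<lambda>d. map_pmf (\<lambda>(us, ts). Node us # ts) (pair_pmf (replicate_pmf d T) (replicate_pmf k T)))"
  proof -
    have "replicate_pmf (Suc k) T = bind_pmf (map_pmf Node (bind_pmf p (\<lambda>d. replicate_pmf d T)))
        (\<lambda>x. bind_pmf (replicate_pmf k T) (\<lambda>xs. return_pmf (x # xs)))"
      using T_rec by simp
    then show ?thesis
      by (simp add: bind_map_pmf bind_assoc_pmf pair_pmf_def map_bind_pmf)
  qed
  have eq: "measure_pmf.prob (map_pmf (\<lambda>(us, ts). Node us # ts) (pair_pmf (replicate_pmf d T) (replicate_pmf k T)))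
      {ts. sum_list (map (occ UNIV) ts) = Suc m \<and> int (sum_list (map (occ A) ts)) = n} =
      forest_prob m (k + d) (n - of_bool (d \<in> A))" for d
  proof -
    have "replicate_pmf (k + d) T = map_pmf (\<lambda>(us, ts). us @ ts) (pair_pmf (replicate_pmf d T) (replicate_pmf k T))"
      using replicate_pmf_distrib[of d k T] by (simp add: add.commute pair_pmf_def map_bind_pmf)
    then show ?thesis
      unfolding forest_prob_def
      by (simp only: measure_map_pmf)
         (intro measure_pmf.finite_measure_eq_AE, auto simp: AE_measure_pmf_iff set_replicate_pmf)
  qed
  have "forest_prob (Suc m) (Suc k) n = (\<integral>d. forest_prob m (k + d) (n - of_bool (d \<in> A)) \<partial>measure_pmf p)"
    unfolding forest_prob_def[of "Suc m"] rep prob_bind_pmf eq ..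
  \<comment> \<open>A forest of \<open>k + d\<close> trees has at least as many nodes, so only
    \<open>d \<le> m\<close> contributes.\<close>
  also have "\<dots> = (\<Sum>d\<in>{..m}. forest_prob m (k + d) (n - of_bool (d \<in> A)) * pmf p d)"
  proof (rule integral_measure_pmf_real)
    fix d assume "forest_prob m (k + d) (n - of_bool (d \<in> A)) \<noteq> 0"
    then have "\<not> m < k + d" using forest_prob_eq_0 by blast
    then show "d \<in> {..m}" by simp
  qed simp
  finally show ?thesis by (simp add: mult.commute)
qed

text \<open>Kemperman's formula for forests of m nodes, summed over m; all sizes are finite, so no
  mass is lost in the limit.\<close>

lemma hit_mass_tendsto:
  assumes k: "1 \<le> k"
  shows "(\<lambda>M. real k * hit_mass p A M (int k) (int n)) \<longlonglongrightarrow> (gen_fun T (occ A) (\<lambda>_. True) ^ k) $ n"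
proof -
  have f0: "forest_prob 0 k n = of_bool (k = 0 \<and> n = 0)" for k n
  proof (cases "k = 0")
    case True
    then show ?thesis by (auto simp: forest_prob_def indicator_def)
  qed (simp add: forest_prob_eq_0)
  have f1: "forest_prob (Suc m) 0 n = 0" for m n
    by (auto simp: forest_prob_def indicator_def)
  \<comment> \<open>At \<open>m = 0\<close> the right-hand side is a division by 0, hence 0, which
    is correct because k is at least 1.\<close>
  have eq: "forest_prob m k (int n) = real k * (walk_mass p A m (int k) (int n) / real m)" for m
    using hitting_time[of forest_prob p A m k "int n", OF f0 f1 forest_prob_Suc] k
    by (cases "m = 0") (auto simp: f0 field_simps)
  let ?E = "\<lambda>m. {ts. sum_list (map (occ UNIV) ts) = m \<and> int (sum_list (map (occ A) ts)) = int n}"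
  have "(\<lambda>m. measure_pmf.prob (replicate_pmf k T) (?E m)) sums measure_pmf.prob (replicate_pmf k T) (\<Union>m. ?E m)"
    by (rule measure_pmf.finite_measure_UNION) (auto simp: disjoint_family_on_def)
  then have "(\<lambda>M. \<Sum>m<Suc M. forest_prob m k (int n)) \<longlonglongrightarrow> measure_pmf.prob (replicate_pmf k T) (\<Union>m. ?E m)"
    unfolding sums_def forest_prob_def by (rule LIMSEQ_Suc)
  also have "(\<lambda>M. \<Sum>m<Suc M. forest_prob m k (int n)) = (\<lambda>M. real k * hit_mass p A M (int k) (int n))"
  proof
    fix M
    have "(\<Sum>m<Suc M. g m) = g 0 + (\<Sum>m=1..M. g m)" for g :: "nat \<Rightarrow> real"
      by (induction M) auto
    from this[of "\<lambda>m. real k * (walk_mass p A m (int k) (int n) / real m)"]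
    show "(\<Sum>m<Suc M. forest_prob m k (int n)) = real k * hit_mass p A M (int k) (int n)"
      by (simp add: eq hit_mass_def sum_distrib_left del: sum.lessThan_Suc)
  qed
  also have "(\<Union>m. ?E m) = {ts. sum_list (map (occ A) ts) = n}" by auto
  also have "measure_pmf.prob (replicate_pmf k T) \<dots> = (gen_fun T (occ A) (\<lambda>_. True) ^ k) $ n"
    using gen_fun_replicate[of k T "occ A" "\<lambda>_ _. True"]
    by (subst AE_length_replicate) (simp add: gen_fun_def fps_eq_iff)
  finally show ?thesis .
qed

text \<open>
  If \<open>P(occ = n)\<close> decayed exponentially, then \<open>F(y) = E (y ^ occ)\<close> would be finite for some \<open>y > 1\<close>, but
  \<open>F(y) \<ge> E F(y)\<^sup>k > F(y)\<close>, where \<open>k\<close> has the critical distribution \<open>p\<close>.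
\<close>

lemma occ_prob_not_exponential:
  assumes mean1: "offspring_mean p = 1" and A: "measure_pmf.prob p A > 0"
    and b: "0 < b" "b < 1"
  shows "\<exists>n\<ge>N. K * b ^ n < occ_prob n"
proof (rule ccontr)
  assume "\<not> ?thesis"
  then have le: "occ_prob n \<le> K * b ^ n" if "n \<ge> N" for n
    using that by (auto simp: not_less)
  \<comment> \<open>Lies strictly between 1 and \<open>1 / b\<close>.\<close>
  define y where "y = (1 + 1 / b) / 2"
  have y: "1 < y" "y * b < 1" using b by (auto simp: y_def field_simps)
  have "summable (\<lambda>n. occ_prob n * y ^ n)"
  proof (rule summable_comparison_test_ev)
    show "\<forall>\<^sub>F n in sequentially. norm (occ_prob n * y ^ n) \<le> \<bar>K\<bar> * (y * b) ^ n"
      using eventually_ge_at_top[of N]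
    proof eventually_elim
      case (elim n)
      have "occ_prob n * y ^ n \<le> K * b ^ n * y ^ n"
        using le[OF elim] y by (intro mult_right_mono) auto
      also have "\<dots> \<le> \<bar>K\<bar> * b ^ n * y ^ n"
        using b y by (intro mult_right_mono) auto
      finally show ?case using y by (simp add: power_mult_distrib mult_ac)
    qed
    show "summable (\<lambda>n. \<bar>K\<bar> * (y * b) ^ n)"
      using y b by (intro summable_mult summable_geometric) (auto simp: abs_mult)
  qed
  then have fin: "(\<integral>\<^sup>+t. ennreal (y ^ occ A t) \<partial>measure_pmf T) < \<infinity>"
  proof -
    have "(\<integral>\<^sup>+t. ennreal (y ^ occ A t) \<partial>measure_pmf T) = (\<integral>\<^sup>+n. ennreal (y ^ n) \<partial>measure_pmf (map_pmf (occ A) T))"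
      by simp
    also have "\<dots> = (\<integral>\<^sup>+n. ennreal (pmf (map_pmf (occ A) T) n) * ennreal (y ^ n) \<partial>count_space UNIV)"
      by (rule nn_integral_measure_pmf)
    also have "\<dots> = (\<Sum>n. ennreal (occ_prob n * y ^ n))"
      unfolding nn_integral_count_space_nat
      using y(1) by (intro suminf_cong) (simp add: ennreal_mult pmf_map vimage_def occ_prob_def)
    also have "\<dots> = ennreal (\<Sum>n. occ_prob n * y ^ n)"
      using y \<open>summable _\<close> by (intro suminf_ennreal2) auto
    finally show ?thesis by simp
  qed
  have int: "integrable (measure_pmf T) (\<lambda>t. y ^ occ A t)"
    using fin y by (intro integrableI_nonneg) auto
  define X where "X = (\<integral>t. y ^ occ A t \<partial>measure_pmf T)"
  have X: "ennreal X = (\<integral>\<^sup>+t. ennreal (y ^ occ A t) \<partial>measure_pmf T)"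
    unfolding X_def using int y by (intro nn_integral_eq_integral[symmetric]) auto
  have "0 \<le> X" unfolding X_def using y by (intro integral_nonneg_AE) auto
  have "1 < X"
  proof -
    obtain d where d: "d \<in> A" "pmf p d > 0"
    proof -
      have "A \<inter> set_pmf p \<noteq> {}"
        using A measure_Int_set_pmf[of p A] by auto
      then show ?thesis using that by (auto simp: pmf_positive_iff)
    qed
    have nn: "AE t in measure_pmf T. 0 \<le> y ^ occ A t - 1"
      using y by auto
    have int': "integrable (measure_pmf T) (\<lambda>t. y ^ occ A t - 1)"
      using int by auto
    have "(\<integral>t. y ^ occ A t - 1 \<partial>measure_pmf T) \<noteq> 0"
    proof
      assume "(\<integral>t. y ^ occ A t - 1 \<partial>measure_pmf T) = 0"
      then have "AE t in measure_pmf T. y ^ occ A t - 1 = 0"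
        using integral_nonneg_eq_0_iff_AE[OF int' nn] by simp
      \<comment> \<open>A star whose centre has out-degree in \<open>A\<close> has positive mass and
        is counted by \<open>occ A\<close>.\<close>
      then have "y ^ occ A (Node (replicate d (Node []))) = 1"
        using pmf_star_pos[OF d(2)] unfolding AE_measure_pmf_iff
        by (metis diff_eq_diff_eq diff_self less_irrefl set_pmf_iff)
      moreover have "occ A (Node (replicate d (Node []))) > 0" using d by simp
      ultimately show False using y(1) one_less_power[OF y(1)] by (metis less_irrefl)
    qed
    moreover have "(\<integral>t. y ^ occ A t - 1 \<partial>measure_pmf T) \<ge> 0"
      using nn by (rule integral_nonneg_AE)
    moreover have "(\<integral>t. y ^ occ A t - 1 \<partial>measure_pmf T) = X - 1"
      using int by (simp add: X_def)
    ultimately show ?thesis by simp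
  qed
  have rep: "(\<integral>\<^sup>+ts. ennreal (y ^ sum_list (map (occ A) ts)) \<partial>measure_pmf (replicate_pmf k T)) = ennreal X ^ k" for k
  proof (induction k)
    case (Suc k)
    have "(\<integral>\<^sup>+ts. ennreal (y ^ sum_list (map (occ A) ts)) \<partial>measure_pmf (replicate_pmf (Suc k) T)) =
        (\<integral>\<^sup>+t. (\<integral>\<^sup>+ts. ennreal (y ^ occ A t) * ennreal (y ^ sum_list (map (occ A) ts)) \<partial>measure_pmf (replicate_pmf k T)) \<partial>measure_pmf T)"
      using y by (simp add: power_add ennreal_mult)
    also have "\<dots> = ennreal X * ennreal X ^ k"
      by (simp add: nn_integral_cmult nn_integral_multc Suc X)
    finally show ?case by simp
  qed simp
  have "(\<integral>\<^sup>+k. ennreal (X ^ k) \<partial>measure_pmf p) \<le>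
      (\<integral>\<^sup>+k. (\<integral>\<^sup>+ts. ennreal (y ^ occ A (Node ts)) \<partial>measure_pmf (replicate_pmf k T)) \<partial>measure_pmf p)"
  proof (intro nn_integral_mono)
    fix k
    have "ennreal (X ^ k) = (\<integral>\<^sup>+ts. ennreal (y ^ sum_list (map (occ A) ts)) \<partial>measure_pmf (replicate_pmf k T))"
      unfolding rep using \<open>0 \<le> X\<close> by (simp add: ennreal_power)
    \<comment> \<open>The contribution of the root to \<open>occ A\<close> is dropped.\<close>
    also have "\<dots> \<le> (\<integral>\<^sup>+ts. ennreal (y ^ occ A (Node ts)) \<partial>measure_pmf (replicate_pmf k T))"
      using y by (intro nn_integral_mono ennreal_leI power_increasing) auto
    finally show "ennreal (X ^ k) \<le> (\<integral>\<^sup>+ts. ennreal (y ^ occ A (Node ts)) \<partial>measure_pmf (replicate_pmf k T))" .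
  qed
  also have "\<dots> = (\<integral>\<^sup>+t. ennreal (y ^ occ A t) \<partial>measure_pmf (map_pmf Node (bind_pmf p (\<lambda>k. replicate_pmf k T))))"
    by simp
  also have "\<dots> = ennreal X"
    unfolding X using T_rec by simp
  finally have le: "(\<integral>\<^sup>+k. ennreal (X ^ k) \<partial>measure_pmf p) \<le> ennreal X" .
  then have intX: "integrable (measure_pmf p) (\<lambda>k. X ^ k)"
    using \<open>0 \<le> X\<close> by (intro integrableI_nonneg) (auto intro: le_less_trans)
  have "(\<integral>\<^sup>+k. ennreal (X ^ k) \<partial>measure_pmf p) = ennreal (\<integral>k. X ^ k \<partial>measure_pmf p)"
    using intX \<open>0 \<le> X\<close> by (intro nn_integral_eq_integral) auto
  then have "(\<integral>k. X ^ k \<partial>measure_pmf p) \<le> X"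
    using le \<open>0 \<le> X\<close> by simp
  moreover obtain k where "2 \<le> k" "pmf p k > 0" using ex_pmf_ge_2[OF mean1 p1] by blast
  then have "1 + offspring_mean p * (X - 1) < (\<integral>k. X ^ k \<partial>measure_pmf p)"
    using \<open>1 < X\<close> intX mean by (intro pgf_greater_line) auto
  ultimately show False using mean1 by simp
qed

text \<open>Join two trees below a root with b children, \<open>b \<ge> 2\<close>, the other
  children being leaves. Then \<kappa> is the mass spent on the root and the leaves, and
  \<open>c\<close> counts those among them whose out-degree lies in \<open>A\<close>.\<close>

lemma occ_prob_supermult:
  assumes mean1: "offspring_mean p = 1"
  shows "\<exists>\<kappa> c. 0 < \<kappa> \<and> (\<forall>m n. \<kappa> * occ_prob m * occ_prob n \<le> occ_prob (m + n + c))"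
proof -
  obtain b where "2 \<le> b" "pmf p b > 0" using ex_pmf_ge_2[OF mean1 p1] by blast
  then obtain b' where b: "b = Suc (Suc b')" by (metis Suc_le_D numeral_2_eq_2 Suc_le_mono)
  define c where "c = of_bool (b \<in> A) + b' * of_bool (0 \<in> A)"
  define \<kappa> where "\<kappa> = pmf p b * pmf T (Node []) ^ b'"
  have "\<kappa> * occ_prob m * occ_prob n \<le> occ_prob (m + n + c)" for m n
  proof -
    define P where "P i t \<longleftrightarrow> (if i = 0 then occ A t = m else if i = 1 then occ A t = n else t = Node [])" for i :: nat and t
    have "P 0 = (\<lambda>t. occ A t = m)" "P (Suc 0) = (\<lambda>t. occ A t = n)" "P (Suc (Suc i)) = (\<lambda>t. t = Node [])" for i
      by (auto simp: P_def fun_eq_iff)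
    then have "\<kappa> * occ_prob m * occ_prob n = pmf p b * (\<Prod>i<b. PT (P i))"
      unfolding b prod.lessThan_Suc_shift
      by (simp add: \<kappa>_def b occ_prob_def measure_pmf_single mult_ac)
    also have "\<dots> = PT (\<lambda>t. length (subtrees t) = b \<and> (\<forall>i<b. P i (subtrees t ! i)))"
      by (rule PT_branches[symmetric])
    also have "\<dots> \<le> occ_prob (m + n + c)"
      unfolding occ_prob_def
    proof (rule PT_mono)
      fix t assume t: "length (subtrees t) = b \<and> (\<forall>i<b. P i (subtrees t ! i))"
      obtain ts where ts: "t = Node ts" by (cases t)
      have len: "length ts = b" and P: "\<And>i. i < b \<Longrightarrow> P i (ts ! i)" using t by (auto simp: ts)
      have "sum_list (map (occ A) ts) = (\<Sum>i<b. occ A (ts ! i))"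
        by (simp add: sum_list_sum_nth len atLeast0LessThan)
      also have "\<dots> = m + n + (\<Sum>i<b'. occ A (ts ! Suc (Suc i)))"
        using P[of 0] P[of 1] by (simp add: b sum.lessThan_Suc_shift P_def del: sum.lessThan_Suc)
      also have "(\<Sum>i<b'. occ A (ts ! Suc (Suc i))) = (\<Sum>i<b'. of_bool (0 \<in> A))"
      proof (intro sum.cong refl)
        fix i assume "i \<in> {..<b'}"
        then have "ts ! Suc (Suc i) = Node []" using P[of "Suc (Suc i)"] by (simp add: b P_def)
        then show "occ A (ts ! Suc (Suc i)) = of_bool (0 \<in> A)" by simp
      qed
      finally show "occ A t = m + n + c" by (simp add: ts len c_def)
    qed
    finally show ?thesis .
  qed
  moreover have "0 < \<kappa>" using \<open>pmf p b > 0\<close> pmf_leaf_pos by (simp add: \<kappa>_def)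
  ultimately show ?thesis by blast
qed

definition occ_supp :: "nat set" where
  "occ_supp = {n. n \<ge> 1 \<and> occ_prob n > 0}"

lemma infinite_occ_supp:
  assumes mean1: "offspring_mean p = 1" and A: "measure_pmf.prob p A > 0"
  shows "infinite occ_supp"
proof -
  have "\<exists>n\<ge>N. n \<in> occ_supp" for N
    using occ_prob_not_exponential[OF mean1 A, of "1/2" "max 1 N" 0] by (auto simp: occ_supp_def)
  then show ?thesis
    unfolding infinite_nat_iff_unbounded_le by blast
qed

text \<open>
  Supermultiplicativity propagates a lower bound along each residue class modulo a suitable \<open>n\<^sub>0\<close>.
\<close>

lemma occ_prob_subexponential:
  assumes mean1: "offspring_mean p = 1" and A: "measure_pmf.prob p A > 0"
    and b: "0 < b" "b < 1"
  shows "\<forall>\<^sub>F n in sequentially_along occ_supp. C * b ^ n \<le> occ_prob n"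
proof -
  obtain \<kappa> c where \<kappa>: "0 < \<kappa>" and super: "\<And>m n. \<kappa> * occ_prob m * occ_prob n \<le> occ_prob (m + n + c)"
    using occ_prob_supermult[OF mean1] by blast
  \<comment> \<open>A rate between b and 1, so that \<open>C * b ^ n\<close> is eventually smaller
    than any positive multiple of \<open>\<beta> ^ n\<close>.\<close>
  define \<beta> where "\<beta> = (1 + b) / 2"
  have \<beta>: "0 < \<beta>" "\<beta> < 1" "b < \<beta>" using b by (auto simp: \<beta>_def)
  \<comment> \<open>The constant is chosen so that
    \<open>\<beta> ^ (n1 + c) \<le> \<kappa> * occ_prob n1\<close>: an increase by
    \<open>n0 = n1 + c\<close> costs at most the factor \<open>\<beta> ^ n0\<close>.\<close>
  obtain n1 where n1: "n1 \<ge> 1" "\<beta> ^ c / \<kappa> * \<beta> ^ n1 < occ_prob n1"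
    using occ_prob_not_exponential[OF mean1 A \<beta>(1,2)] by blast
  define n0 where "n0 = n1 + c"
  have n0: "n0 > 0" using n1 by (simp add: n0_def)
  have step: "occ_prob s * \<beta> ^ n0 \<le> occ_prob (s + n0)" for s
  proof -
    have "\<beta> ^ n0 \<le> \<kappa> * occ_prob n1"
      using n1(2) \<kappa> by (simp add: n0_def power_add field_simps)
    then have "occ_prob s * \<beta> ^ n0 \<le> occ_prob s * (\<kappa> * occ_prob n1)"
      by (intro mult_left_mono) auto
    also have "\<dots> \<le> occ_prob (s + n0)"
      using super[of s n1] by (simp add: n0_def mult_ac add.assoc)
    finally show ?thesis .
  qed
  have steps: "occ_prob s * \<beta> ^ (a * n0) \<le> occ_prob (s + a * n0)" for s a
  proof (induction a)
    case (Suc a)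
    have "occ_prob s * \<beta> ^ (Suc a * n0) = occ_prob s * \<beta> ^ (a * n0) * \<beta> ^ n0"
      by (simp add: power_add mult_ac)
    also have "\<dots> \<le> occ_prob (s + a * n0) * \<beta> ^ n0"
      using Suc \<beta> by (intro mult_right_mono) auto
    also have "\<dots> \<le> occ_prob (s + a * n0 + n0)" by (rule step)
    finally show ?case by (simp add: algebra_simps)
  qed simp
  define P where "P i s \<longleftrightarrow> s mod n0 = i \<and> occ_prob s > 0" for i s
  have P_pos: "P i s \<Longrightarrow> occ_prob s > 0" for i s by (simp add: P_def)
  \<comment> \<open>The mass at the least supported point of each residue class; empty classes get
    1, so the minimum \<open>D\<close> over all classes is positive.\<close>
  define r where "r i = (if \<exists>s. P i s then occ_prob (LEAST s. P i s) else 1)" for i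
  define D where "D = Min (r ` {..<n0})"
  have "D > 0"
  proof -
    have "D \<in> r ` {..<n0}"
      unfolding D_def using n0 by (intro Min_in) auto
    then obtain i where "D = r i" by blast
    then show ?thesis using P_pos[OF LeastI_ex[of "P i"]] by (simp add: r_def)
  qed
  have lower: "D * \<beta> ^ n \<le> occ_prob n" if n: "occ_prob n > 0" for n
  proof -
    define i where "i = n mod n0"
    define s where "s = (LEAST s. P i s)"
    have ex: "P i n" using n by (simp add: P_def i_def)
    have s: "P i s" "s \<le> n" unfolding s_def using ex by (auto intro: LeastI Least_le)
    have "D \<le> r i"
      unfolding D_def using n0 by (intro Min_le) (auto simp: i_def)
    then have D: "D \<le> occ_prob s" using ex by (auto simp: r_def s_def split: if_splits)
    have "n0 dvd n - s"
      using s mod_eq_dvd_iff_nat[of s n n0] by (simp add: P_def i_def)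
    then obtain a where a: "n = s + a * n0"
      using s(2) by (metis dvd_def le_add_diff_inverse mult.commute)
    have "D * \<beta> ^ n \<le> occ_prob s * \<beta> ^ (a * n0)"
      using D \<beta> \<open>D > 0\<close> by (intro mult_mono power_decreasing) (auto simp: a)
    also have "\<dots> \<le> occ_prob n" unfolding a by (rule steps)
    finally show ?thesis .
  qed
  have "(\<lambda>n. C * (b / \<beta>) ^ n) \<longlonglongrightarrow> C * 0"
    using b \<beta> by (intro tendsto_mult tendsto_const LIMSEQ_realpow_zero) auto
  then have "\<forall>\<^sub>F n in sequentially. C * (b / \<beta>) ^ n < D"
    using \<open>D > 0\<close> by (intro order_tendstoD(2)) auto
  then have "\<forall>\<^sub>F n in sequentially. n \<in> occ_supp \<longrightarrow> C * b ^ n \<le> occ_prob n"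
  proof eventually_elim
    case (elim n)
    then have "C * b ^ n \<le> D * \<beta> ^ n"
      using \<beta> by (simp add: power_divide field_simps)
    then show ?case using lower[of n] by (auto simp: occ_supp_def)
  qed
  then show ?thesis
    unfolding sequentially_along_def eventually_inf_principal .
qed

text \<open>The mass of the cylinder at \<open>n + a\<close> is the limit of
  \<open>w * real k\<close> times \<open>hit_mass\<close> for k trees at n, and
  \<open>shift_bound_tree\<close> compares it with \<open>hit_mass\<close> for one tree at
  \<open>n + a\<close>. The exponential error is absorbed by
  \<open>occ_prob_subexponential\<close>.\<close>

lemma spine_bound_occ:
  assumes mean1: "offspring_mean p = 1" and A: "measure_pmf.prob p A > 0"
  shows "spine_bound (\<lambda>n t. occ A t = n) (sequentially_along occ_supp)"
  unfolding spine_bound_def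
proof (intro allI impI)
  fix h x c
  assume x: "prune h x = x" and c: "c < real (level h x) / offspring_mean p ^ h * prune_weight p h x"
  define k where "k = level h x"
  define w where "w = prune_weight p h x"
  define a where "a = inner_occ A h x"
  have c: "c < real k * w" using c by (simp add: mean1 k_def w_def)
  have w: "0 \<le> w" unfolding w_def by (rule prune_weight_nonneg)
  show "\<forall>\<^sub>F n in sequentially_along occ_supp. c * PT (\<lambda>t. occ A t = n) \<le> PT (\<lambda>t. prune h t = x \<and> occ A t = n)"
  proof (cases "c \<le> 0")
    case True
    then have "c * PT (\<lambda>t. occ A t = n) \<le> 0" for n by (intro mult_nonpos_nonneg) auto
    then show ?thesis by (intro always_eventually allI order_trans[OF _ measure_nonneg])
  next
    case False
    then have "0 < real k * w" using c by linarith
    then have kw: "1 \<le> k" "0 < w" using w by (auto simp: zero_less_mult_iff)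
    \<comment> \<open>One e pays for the factor \<open>1 - e\<close> in the shift bound, the other
      for the exponential error.\<close>
    define e where "e = (1 - c / (real k * w)) / 2"
    have e: "0 < e" "c = real k * w * (1 - e - e)"
      using c kw by (auto simp: e_def field_simps)
    have "shift_bound p A (int k - 1) a"
      unfolding k_def a_def using kw by (intro shift_bound_tree) (simp add: w_def)
    from this[unfolded shift_bound_def, rule_format, OF e(1)]
    obtain b C N where ex: "0 < b \<and> b < 1 \<and> 0 \<le> C \<and> (\<forall>n\<ge>N. \<forall>k' M.
       (1 - e) * hit_mass p A M k' (int (n + a)) - C * b ^ n \<le> hit_mass p A M (k' + (int k - 1)) (int n))"
      by (elim exE) (rule that)
    then have b: "0 < b" "b < 1" by simp_all
    let ?F = "gen_fun T (occ A) (\<lambda>_. True)"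
    have key: "w * (real k * ((1 - e) * occ_prob (n + a) - C * b ^ n)) \<le> PT (\<lambda>t. prune h t = x \<and> occ A t = n + a)"
      if n: "n \<ge> N" for n
    proof -
      have 1: "(\<lambda>M. hit_mass p A M 1 (int (n + a))) \<longlonglongrightarrow> occ_prob (n + a)"
        using hit_mass_tendsto[of 1 "n + a"] by (simp add: gen_fun_def occ_prob_def)
      have 2: "(\<lambda>M. real k * hit_mass p A M (int k) (int n)) \<longlonglongrightarrow> (?F ^ k) $ n"
        by (rule hit_mass_tendsto[OF kw(1)])
      have "(\<lambda>M. real k * ((1 - e) * hit_mass p A M 1 (int (n + a)) - C * b ^ n))
          \<longlonglongrightarrow> real k * ((1 - e) * occ_prob (n + a) - C * b ^ n)"
        by (intro tendsto_intros 1)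
      then have "real k * ((1 - e) * occ_prob (n + a) - C * b ^ n) \<le> (?F ^ k) $ n"
      proof (rule LIMSEQ_le[OF _ 2])
        have "real k * ((1 - e) * hit_mass p A M 1 (int (n + a)) - C * b ^ n) \<le> real k * hit_mass p A M (int k) (int n)" for M
          using ex[THEN conjunct2, THEN conjunct2, THEN conjunct2, rule_format, OF n, of M 1]
          by (intro mult_left_mono) auto
        then show "\<exists>M0. \<forall>M\<ge>M0. real k * ((1 - e) * hit_mass p A M 1 (int (n + a)) - C * b ^ n)
            \<le> real k * hit_mass p A M (int k) (int n)" by blast
      qed
      then have "w * (real k * ((1 - e) * occ_prob (n + a) - C * b ^ n)) \<le> w * (?F ^ k) $ n"
        using w by (intro mult_left_mono)
      also have "\<dots> = gen_fun T (occ A) (\<lambda>t. prune h t = x) $ (n + a)"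
        unfolding gen_fun_prune[OF x] by (simp add: w_def k_def a_def mult.assoc fps_X_power_mult_nth)
      also have "\<dots> = PT (\<lambda>t. prune h t = x \<and> occ A t = n + a)"
        by (simp add: gen_fun_def)
      finally show ?thesis .
    qed
    \<comment> \<open>The constant makes the error \<open>C * b ^ (n - a)\<close> at most
      \<open>e * occ_prob n\<close>.\<close>
    have "\<forall>\<^sub>F n in sequentially_along occ_supp. C / (b ^ a * e) * b ^ n \<le> occ_prob n"
      by (rule occ_prob_subexponential[OF mean1 A b])
    moreover have "\<forall>\<^sub>F n in sequentially_along occ_supp. n \<ge> N + a"
      unfolding sequentially_along_def
      by (rule filter_leD[OF inf_le1 eventually_ge_at_top])
    ultimately show ?thesis
    proof eventually_elim
      case (elim n)
      define m where "m = n - a"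
      have n: "n = m + a" "m \<ge> N" using elim(2) by (auto simp: m_def)
      have "C * b ^ m \<le> e * occ_prob n"
        using elim(1) b e(1) by (simp add: n(1) power_add field_simps)
      then have "w * (real k * ((1 - e) * occ_prob n - e * occ_prob n)) \<le>
          w * (real k * ((1 - e) * occ_prob n - C * b ^ m))"
        using w by (intro mult_left_mono) auto
      also have "\<dots> \<le> PT (\<lambda>t. prune h t = x \<and> occ A t = n)"
        using key[OF n(2)] by (simp add: n(1))
      also have "w * (real k * ((1 - e) * occ_prob n - e * occ_prob n)) = c * occ_prob n"
        unfolding e(2) by (simp add: algebra_simps)
      finally show ?case by (simp add: occ_prob_def)
    qed
  qed
qed

end

end

section \<open>Convergence\<close>

context gw_tree_pmf
begin

lemma spine_bound_mono: "spine_bound E G \<Longrightarrow> F \<le> G \<Longrightarrow> spine_bound E F"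
  unfolding spine_bound_def using filter_leD by blast

lemma PT_maxdeg_pos: "1 \<le> n \<Longrightarrow> pmf p n > 0 \<Longrightarrow> PT (\<lambda>t. maxdeg t = n) > 0"
proof -
  assume n: "1 \<le> n" "pmf p n > 0"
  have "maxdeg (Node (replicate n (Node []))) = n"
    using n(1) by (simp add: set_replicate_conv_if max_def)
  then have "pmf T (Node (replicate n (Node []))) \<le> PT (\<lambda>t. maxdeg t = n)"
    unfolding measure_pmf_single[symmetric] by (intro measure_pmf.finite_measure_mono) auto
  then show ?thesis using pmf_star_pos[OF n(2)] by linarith
qed

text \<open>Some \<open>d \<ge> 1\<close> is charged by \<open>p\<close>; joining d copies of a tree
  below a new root raises the height by one and keeps the mass positive.\<close>

lemma PT_height_pos: "PT (\<lambda>t. height t = n) > 0"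
proof -
  obtain d where d: "1 \<le> d" "pmf p d > 0"
  proof -
    have "\<not> set_pmf p \<subseteq> {0}"
    proof
      assume "set_pmf p \<subseteq> {0}"
      then have "AE k in measure_pmf p. real k = 0" by (auto simp: AE_measure_pmf_iff)
      then have "offspring_mean p = 0"
        unfolding offspring_mean_def by (subst integral_cong_AE[where g = "\<lambda>_. 0"]) auto
      then show False using mean by simp
    qed
    then obtain d where "d \<in> set_pmf p" "d \<noteq> 0" by blast
    then show ?thesis using that[of d] by (auto simp: pmf_positive_iff)
  qed
  have "\<exists>t. height t = n \<and> pmf T t > 0"
  proof (induction n)
    case 0
    show ?case using pmf_leaf_pos by (intro exI[of _ "Node []"]) simp
  next
    case (Suc n)
    then obtain t where t: "height t = n" "pmf T t > 0" by blast
    have "pmf T (Node (replicate d t)) > 0"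
      using t d by (subst pmf_Node) simp
    moreover have "height (Node (replicate d t)) = Suc n"
      using t d by (simp add: set_replicate_conv_if max_def)
    ultimately show ?case by blast
  qed
  then obtain t where t: "height t = n" "pmf T t > 0" by blast
  then have "pmf T t \<le> PT (\<lambda>t. height t = n)"
    unfolding measure_pmf_single[symmetric] by (intro measure_pmf.finite_measure_mono) auto
  then show ?thesis using t by linarith
qed

end

text \<open>Joins the two estimates: cylinder masses are bounded from above for the immortal tree
  and from below for the conditional laws, so any c below the former is eventually a lower bound for
  the latter. Positivity along \<open>F\<close> makes the conditional laws probability measures
  there.\<close>

lemma conv_of_spine_bound:
  fixes E :: "nat \<Rightarrow> neveu_tree \<Rightarrow> bool"
  assumes gw: "galton_watson_tree p \<Omega> \<tau>"
    and mean: "0 < offspring_mean p" "offspring_mean p \<le> 1" and p1: "pmf p 1 \<noteq> 1"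
    and E: "\<And>n. Measurable.pred borel (E n)"
    and pos: "\<forall>\<^sub>F n in F. measure_pmf.prob (gw_pmf p) {t. E n (to_neveu t)} > 0"
    and bound: "gw_tree_pmf.spine_bound p (gw_pmf p) (\<lambda>n t. E n (to_neveu t)) F"
  shows "conv_in_distribution (\<lambda>n. cond_law \<Omega> \<tau> (E n)) (immortal_tree_law p) F"
proof (rule conv_in_distributionI)
  interpret gw_tree_pmf p "gw_pmf p"
    by unfold_locales (fact mean p1 gw_pmf_rec[OF gw mean p1])+
  show "prob_space (immortal_tree_law p)" "sets (immortal_tree_law p) = sets borel"
    using prob_space_immortal_tree_law[OF mean(1)] sets_immortal_tree_law[OF mean(1)] by auto
  show "\<forall>\<^sub>F n in F. prob_space (cond_law \<Omega> \<tau> (E n)) \<and> sets (cond_law \<Omega> \<tau> (E n)) = sets borel"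
    using pos by eventually_elim
      (intro conjI prob_space_cond_law[OF gw mean p1 E] sets_cond_law[OF gw mean p1 E])
  fix h x c
  assume x: "prune h x = x" and "c < measure (immortal_tree_law p) {s. tree_trunc h s = to_neveu x}"
  then have "c < real (level h x) / offspring_mean p ^ h * prune_weight p h x"
    using immortal_tree_law_cylinder_le[OF mean(1) x] by linarith
  then have "\<forall>\<^sub>F n in F. c * PT (\<lambda>t. E n (to_neveu t)) \<le> PT (\<lambda>t. prune h t = x \<and> E n (to_neveu t))"
    using bound x unfolding spine_bound_def by blast
  then show "\<forall>\<^sub>F n in F. c \<le> measure (cond_law \<Omega> \<tau> (E n)) {s. tree_trunc h s = to_neveu x}"
    using pos
  proof eventually_elim
    case (elim n)
    then show ?case
      by (simp add: cond_law_cylinder[OF gw mean p1 E elim(2)] pos_le_divide_eq)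
  qed
qed

lemma sequentially_along_le: "sequentially_along S \<le> sequentially"
  by (simp add: sequentially_along_def)

lemma eventually_sequentially_along: "(\<And>n. n \<in> S \<Longrightarrow> P n) \<Longrightarrow> \<forall>\<^sub>F n in sequentially_along S. P n"
  unfolding sequentially_along_def eventually_inf_principal by (intro always_eventually) blast

theorem corollary2p6:
  fixes p :: "nat pmf" and \<Omega> :: "'a measure" and \<tau> :: "'a \<Rightarrow> neveu_tree"
  assumes mean: "0 < offspring_mean p" "offspring_mean p \<le> 1"
    and p1: "pmf p 1 \<noteq> 1"
    and gw: "galton_watson_tree p \<Omega> \<tau>"
  shows
    "(\<forall>A::nat set. offspring_mean p = 1 \<and> measure_pmf.prob p A > 0 \<longrightarrow>
        (let S = {n. n \<ge> 1 \<and> \<P>(\<omega> in \<Omega>. tree_L A (\<tau> \<omega>) = enat n) > 0} in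
           infinite S \<and>
           conv_in_distribution (\<lambda>n. cond_law \<Omega> \<tau> (\<lambda>t. tree_L A t = enat n))
             (immortal_tree_law p) (sequentially_along S))) \<and>
     (let S = {n. n \<ge> 1 \<and> pmf p n > 0} in
        offspring_mean p = 1 \<and> infinite S \<longrightarrow>
        conv_in_distribution (\<lambda>n. cond_law \<Omega> \<tau> (\<lambda>t. tree_M t = enat n))
          (immortal_tree_law p) (sequentially_along S)) \<and>
     (offspring_mean p = 1 \<and> bdd_above (set_pmf p) \<longrightarrow>
        (let S = {n. n \<ge> 1 \<and> \<P>(\<omega> in \<Omega>. tree_W (\<tau> \<omega>) = enat n) > 0} in
           infinite S \<and>
           conv_in_distribution (\<lambda>n. cond_law \<Omega> \<tau> (\<lambda>t. tree_W t = enat n))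
             (immortal_tree_law p) (sequentially_along S))) \<and>
     conv_in_distribution (\<lambda>n. cond_law \<Omega> \<tau> (\<lambda>t. tree_H t = enat n))
       (immortal_tree_law p) sequentially"
proof -
  interpret gw_tree_pmf p "gw_pmf p"
    by unfold_locales (fact mean p1 gw_pmf_rec[OF gw mean p1])+
  note prob = prob_eq_gw_pmf[OF gw mean p1]
  note conv = conv_of_spine_bound[OF gw mean p1]
  have L: "\<forall>A::nat set. offspring_mean p = 1 \<and> measure_pmf.prob p A > 0 \<longrightarrow>
      (let S = {n. n \<ge> 1 \<and> \<P>(\<omega> in \<Omega>. tree_L A (\<tau> \<omega>) = enat n) > 0} in
         infinite S \<and>
         conv_in_distribution (\<lambda>n. cond_law \<Omega> \<tau> (\<lambda>t. tree_L A t = enat n))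
           (immortal_tree_law p) (sequentially_along S))"
    (is "\<forall>A. _ \<longrightarrow> ?L A")
  proof (intro allI impI, elim conjE)
    fix A assume A: "offspring_mean p = 1" "measure_pmf.prob p A > 0"
    have S: "{n. n \<ge> 1 \<and> \<P>(\<omega> in \<Omega>. tree_L A (\<tau> \<omega>) = enat n) > 0} = occ_supp A"
      by (simp add: prob[OF pred_tree_L] occ_supp_def occ_prob_def)
    have "conv_in_distribution (\<lambda>n. cond_law \<Omega> \<tau> (\<lambda>t. tree_L A t = enat n))
        (immortal_tree_law p) (sequentially_along (occ_supp A))"
      using spine_bound_occ[OF A]
      by (intro conv pred_tree_L eventually_sequentially_along) (auto simp: occ_supp_def occ_prob_def)
    then show "?L A"
      unfolding S Let_def using infinite_occ_supp[OF A] by blast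
  qed
  have M: "let S = {n. n \<ge> 1 \<and> pmf p n > 0} in
      offspring_mean p = 1 \<and> infinite S \<longrightarrow>
      conv_in_distribution (\<lambda>n. cond_law \<Omega> \<tau> (\<lambda>t. tree_M t = enat n))
        (immortal_tree_law p) (sequentially_along S)"
    unfolding Let_def
  proof (intro impI, elim conjE)
    assume crit: "offspring_mean p = 1"
    show "conv_in_distribution (\<lambda>n. cond_law \<Omega> \<tau> (\<lambda>t. tree_M t = enat n))
        (immortal_tree_law p) (sequentially_along {n. n \<ge> 1 \<and> pmf p n > 0})"
      using PT_maxdeg_pos spine_bound_mono[OF spine_bound_maxdeg[OF crit] sequentially_along_le]
      by (intro conv pred_tree_M eventually_sequentially_along) auto
  qed
  have W: "offspring_mean p = 1 \<and> bdd_above (set_pmf p) \<longrightarrow>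
      (let S = {n. n \<ge> 1 \<and> \<P>(\<omega> in \<Omega>. tree_W (\<tau> \<omega>) = enat n) > 0} in
         infinite S \<and>
         conv_in_distribution (\<lambda>n. cond_law \<Omega> \<tau> (\<lambda>t. tree_W t = enat n))
           (immortal_tree_law p) (sequentially_along S))"
    (is "_ \<longrightarrow> ?W")
  proof (intro impI, elim conjE)
    assume A: "offspring_mean p = 1" "bdd_above (set_pmf p)"
    have width: "tree_W (to_neveu t) = enat n \<longleftrightarrow> width_is n t" for n t
      by (simp add: tree_W_embed width_is_def)
    define S where "S = {n. n \<ge> 1 \<and> PT (width_is n) > 0}"
    have S: "{n. n \<ge> 1 \<and> \<P>(\<omega> in \<Omega>. tree_W (\<tau> \<omega>) = enat n) > 0} = S"
      by (simp add: prob[OF pred_tree_W] S_def width)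
    have "infinite ({n. PT (width_is n) > 0} - {0})"
      using infinite_width[OF A(1)] by simp
    moreover have "{n. PT (width_is n) > 0} - {0} \<subseteq> S"
      by (auto simp: S_def)
    ultimately have "infinite S" using finite_subset by blast
    obtain d where "set_pmf p \<subseteq> {..d}"
      using A(2) by (auto simp: bdd_above_def)
    \<comment> \<open>\<open>spine_bound_width\<close> asks for a degree bound of at least 1, which
      makes its powers monotone.\<close>
    then have d: "set_pmf p \<subseteq> {..max d 1}" by auto
    have "conv_in_distribution (\<lambda>n. cond_law \<Omega> \<tau> (\<lambda>t. tree_W t = enat n))
        (immortal_tree_law p) (sequentially_along S)"
      using spine_bound_mono[OF spine_bound_width[OF A(1) d] sequentially_along_le]
      by (intro conv pred_tree_W eventually_sequentially_along) (auto simp: width S_def)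
    then show ?W
      unfolding S Let_def using \<open>infinite S\<close> by blast
  qed
  have H: "conv_in_distribution (\<lambda>n. cond_law \<Omega> \<tau> (\<lambda>t. tree_H t = enat n))
      (immortal_tree_law p) sequentially"
    using PT_height_pos spine_bound_height by (intro conv pred_tree_H always_eventually) auto
  show ?thesis
    by (intro conjI L M W H)
qed

end
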